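(* Let $\Omega\subset\mathbb{R}^2$ be an open, simply connected, bounded set and let $\alpha\in(0,1)$. For every integer $j\ge 1$, the function $a\in\Omega\mapsto\lambda_j^a\in\mathbb{R}$ has an extremal point in $\Omega$.
   Context: For $a=(a_1,a_2)\in\Omega$, the Aharonov-Bohm potential with pole $a$ and circulation $\alpha$ is $A_a(x)=\alpha\left(-\frac{x_2-a_2}{|x-a|^2},\frac{x_1-a_1}{|x-a|^2}\right)$, $x\in\Omega\setminus\{a\}$. The space $H^1_{A_a}(\Omega)$ is the completion of $C_0^\infty(\Omega\setminus\{a\})$ (complex-valued functions) with respect to the norm $\|u\|_{H^1_{A_a}(\Omega)}=\|(i\nabla+A_a)u\|_{L^2(\Omega)}$; equivalently $H^1_{A_a}(\Omega)=\{u\in H^1_0(\Omega): u/|x-a|\in L^2(\Omega)\}$. The operator $(i\nabla+A_a)^2$ with zero boundary conditions on $\partial\Omega$ is the operator associated with the quadratic form $\|(i\nabla+A_a)u\|_{L^2(\Omega)}^2$ on $H^1_{A_a}(\Omega)$. Its spectrum is a diverging sequence of positive eigenvalues $\lambda_1^a\le\lambda_2^a\le\dots$, counted with multiplicity, given by $$\lambda_j^a=\inf_{W\subset H^1_{A_a}(\Omega),\ \dim W=j}\ \sup_{\Phi\in W\setminus\{0\}}\frac{\|\Phi\|^2_{H^1_{A_a}(\Omega)}}{\|\Phi\|^2_{L^2(\Omega)}}.$$ An extremal point is a point of (local) maximum or minimum. *)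

theory Defs
  imports "HOL-Analysis.Analysis" "HOL-Library.Function_Algebras"
begin

fun continuously_differentiable ::
  "nat \<Rightarrow> ('a::real_normed_vector \<Rightarrow> 'b::real_normed_vector) \<Rightarrow> bool" where
  "continuously_differentiable 0 f \<longleftrightarrow> continuous_on UNIV f"
| "continuously_differentiable (Suc k) f \<longleftrightarrow>
     f differentiable_on UNIV \<and>
     (\<forall>v. continuously_differentiable k (\<lambda>x. frechet_derivative f (at x) v))"

text \<open>Elements of \<open>C\<^sub>0\<^sup>\<infinity>(U)\<close> are extended by zero to the whole plane.\<close>

definition test_functions :: "(real^2) set \<Rightarrow> (real^2 \<Rightarrow> complex) set" where
  "test_functions U =
     {\<phi>. (\<forall>k. continuously_differentiable k \<phi>) \<and>
         compact (closure {x. \<phi> x \<noteq> 0}) \<and> closure {x. \<phi> x \<noteq> 0} \<subseteq> U}"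

definition L2_functions :: "(real^2) set \<Rightarrow> (real^2 \<Rightarrow> complex) set" where
  "L2_functions \<Omega> =
     {u. u \<in> borel_measurable (lebesgue_on \<Omega>) \<and>
         integrable (lebesgue_on \<Omega>) (\<lambda>x. (norm (u x))\<^sup>2)}"

definition L2_norm :: "(real^2) set \<Rightarrow> (real^2 \<Rightarrow> 'b::real_normed_vector) \<Rightarrow> real" where
  "L2_norm \<Omega> u = sqrt (\<integral>x. (norm (u x))\<^sup>2 \<partial>lebesgue_on \<Omega>)"

definition AB_potential :: "real \<Rightarrow> real^2 \<Rightarrow> real^2 \<Rightarrow> real^2" where
  "AB_potential \<alpha> a x =
     \<alpha> *\<^sub>R vector [- (x$2 - a$2) / (norm (x - a))\<^sup>2, (x$1 - a$1) / (norm (x - a))\<^sup>2]"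

text \<open>\<open>(i\<nabla> + A\<^sub>a)\<phi>\<close>, as a field with values in \<open>\<complex>\<^sup>2\<close>.\<close>

definition magnetic_gradient ::
  "real \<Rightarrow> real^2 \<Rightarrow> (real^2 \<Rightarrow> complex) \<Rightarrow> real^2 \<Rightarrow> complex^2" where
  "magnetic_gradient \<alpha> a \<phi> x =
     (\<chi> k. \<i> * frechet_derivative \<phi> (at x) (axis k 1)
           + complex_of_real (AB_potential \<alpha> a x $ k) * \<phi> x)"

definition magnetic_norm ::
  "real \<Rightarrow> (real^2) set \<Rightarrow> real^2 \<Rightarrow> (real^2 \<Rightarrow> complex) \<Rightarrow> real" where
  "magnetic_norm \<alpha> \<Omega> a \<phi> = L2_norm \<Omega> (magnetic_gradient \<alpha> a \<phi>)"

text \<open>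
  The completion of the test functions for the magnetic norm is realised inside \<open>L\<^sup>2(\<Omega>)\<close>:
  the class of a Cauchy sequence is identified with the \<open>L\<^sup>2\<close> limit of that sequence. This is
  legitimate because on a bounded \<open>\<Omega>\<close> the magnetic norm dominates the \<open>L\<^sup>2\<close> norm (diamagnetic and
  Poincare inequalities) and the quadratic form is closable.
\<close>

definition completion_sequence ::
  "real \<Rightarrow> (real^2) set \<Rightarrow> real^2 \<Rightarrow> (nat \<Rightarrow> real^2 \<Rightarrow> complex) \<Rightarrow> (real^2 \<Rightarrow> complex) \<Rightarrow> bool"
where
  "completion_sequence \<alpha> \<Omega> a \<phi> u \<longleftrightarrow>
     (\<forall>n. \<phi> n \<in> test_functions (\<Omega> - {a})) \<and>
     (\<forall>e>0. \<exists>N. \<forall>m\<ge>N. \<forall>n\<ge>N. magnetic_norm \<alpha> \<Omega> a (\<phi> m - \<phi> n) < e) \<and>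
     (\<lambda>n. L2_norm \<Omega> (\<phi> n - u)) \<longlonglongrightarrow> 0"

definition H1_magnetic :: "real \<Rightarrow> (real^2) set \<Rightarrow> real^2 \<Rightarrow> (real^2 \<Rightarrow> complex) set" where
  "H1_magnetic \<alpha> \<Omega> a = {u \<in> L2_functions \<Omega>. \<exists>\<phi>. completion_sequence \<alpha> \<Omega> a \<phi> u}"

definition H1_magnetic_norm ::
  "real \<Rightarrow> (real^2) set \<Rightarrow> real^2 \<Rightarrow> (real^2 \<Rightarrow> complex) \<Rightarrow> real" where
  "H1_magnetic_norm \<alpha> \<Omega> a u =
     (THE r. \<exists>\<phi>. completion_sequence \<alpha> \<Omega> a \<phi> u \<and>
                 (\<lambda>n. magnetic_norm \<alpha> \<Omega> a (\<phi> n)) \<longlonglongrightarrow> r)"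

definition cscale :: "complex \<Rightarrow> ('a \<Rightarrow> complex) \<Rightarrow> 'a \<Rightarrow> complex" where
  "cscale c f = (\<lambda>x. c * f x)"

interpretation cfun: vector_space "cscale :: complex \<Rightarrow> ('a \<Rightarrow> complex) \<Rightarrow> 'a \<Rightarrow> complex"
  by unfold_locales (auto simp: cscale_def fun_eq_iff algebra_simps)

text \<open>
  Elements of \<open>H1_magnetic\<close> are functions rather than classes modulo equality almost everywhere.
  A \<open>j\<close>-dimensional space of classes is given by a \<open>j\<close>-dimensional complex space of representatives in
  which only the zero function vanishes almost everywhere in \<open>\<Omega>\<close>.
\<close>

definition H1_subspaces ::
  "real \<Rightarrow> (real^2) set \<Rightarrow> real^2 \<Rightarrow> nat \<Rightarrow> (real^2 \<Rightarrow> complex) set set" where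
  "H1_subspaces \<alpha> \<Omega> a j =
     {W. W \<subseteq> H1_magnetic \<alpha> \<Omega> a \<and> cfun.subspace W \<and> cfun.dim W = j \<and>
         (\<forall>\<Phi>\<in>W. (AE x in lebesgue_on \<Omega>. \<Phi> x = 0) \<longrightarrow> \<Phi> = 0)}"

definition AB_eigenvalue :: "real \<Rightarrow> (real^2) set \<Rightarrow> nat \<Rightarrow> real^2 \<Rightarrow> real" where
  "AB_eigenvalue \<alpha> \<Omega> j a =
     (INF W \<in> H1_subspaces \<alpha> \<Omega> a j.
        SUP \<Phi> \<in> W - {0}. (H1_magnetic_norm \<alpha> \<Omega> a \<Phi>)\<^sup>2 / (L2_norm \<Omega> \<Phi>)\<^sup>2)"

definition extremal_point :: "('a::topological_space \<Rightarrow> real) \<Rightarrow> 'a set \<Rightarrow> 'a \<Rightarrow> bool" where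
  "extremal_point f S a \<longleftrightarrow>
     a \<in> S \<and> ((\<forall>\<^sub>F b in at a within S. f b \<le> f a) \<or> (\<forall>\<^sub>F b in at a within S. f a \<le> f b))"

end

theory Submission
  imports Defs
begin

text \<open>
  The eigenvalue makes sense for every pole \<open>a\<close> in the plane, also on the boundary of \<open>\<Omega>\<close> and outside;
  this gives a function \<open>f\<close> on the whole plane. Two facts give the theorem: \<open>f\<close> is continuous on the plane, and
  \<open>f\<close> is constant on the complement of \<open>\<Omega>\<close>. On the compact closure of \<open>\<Omega>\<close> the function attains its
  maximum and its minimum. If one of them is attained in \<open>\<Omega>\<close>, that point is extremal; otherwise both
  are attained on the boundary, where \<open>f\<close> has only one value, so \<open>f\<close> is constant on \<open>\<Omega>\<close>.

  Both facts come from comparing the quadratic forms of two poles by multiplication with a suitable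
  function \<open>g\<close> (\<open>transplants\<close>): it maps trial spaces for \<open>a\<close> to trial spaces for \<open>b\<close>, and
  \<open>AB_eigenvalue_transplant\<close> turns an error \<open>d\<close> in the comparison into a bound for the eigenvalues.

  For continuity, \<open>g\<close> is a cutoff that vanishes on a small disc around \<open>a\<close> containing \<open>b\<close>
  (\<open>cutoff_transplants\<close>). Outside that disc the two potentials are uniformly close. The price of the
  cutoff is controlled by Hardy's inequality, \<open>\<parallel>\<phi> / |x - a|\<parallel> \<le> C \<parallel>(i\<nabla> + A\<^sub>a)\<phi>\<parallel>\<close>: a cutoff that is a
  function of \<open>ln |x - a|\<close> with small slope \<open>\<delta>\<close> has gradient at most \<open>\<delta> / |x - a|\<close>, so the term
  \<open>|\<nabla>g| |\<phi>|\<close> costs only \<open>\<delta> C\<close> times the form. All constants are independent of the poles, so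
  the argument treats poles inside, on the boundary of, and outside \<open>\<Omega>\<close> alike.

  Hardy's inequality is where \<open>0 < \<alpha> < 1\<close> enters. Along a circle around the pole the form controls
  the derivative of \<open>exp (-i\<alpha>t) \<phi>\<close>, and this function changes by the factor \<open>exp (-2\<pi>i\<alpha>) \<noteq> 1\<close> in one
  turn, so \<open>\<phi>\<close> itself is controlled. Averaging over all rotations gives the inequality in the plane.

  For poles \<open>b\<close> and \<open>b'\<close> outside \<open>\<Omega>\<close>, the function \<open>g = exp (i\<alpha>\<theta>)\<close> is a gauge transformation, with
  \<open>\<theta>\<close> the difference of the polar angles around \<open>b'\<close> and \<open>b\<close>. Because \<open>\<Omega>\<close> is simply connected, \<open>\<theta>\<close>
  is a single valued function on \<open>\<Omega>\<close>, and the two operators are unitarily equivalent.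

  Three points about the definition have to be settled on the way. The norm of the completed space is
  given by a definite description, so one needs closability of the form
  (\<open>magnetic_norm_closable\<close>). The supremum and the infimum over the reals need bounded and nonempty
  sets; this is \<open>H1_subspaces_rayleigh\<close>, which rests on the equivalence of norms in finite dimension,
  and \<open>H1_subspaces_nonempty\<close>.
\<close>

section \<open>Functions of class C^k and smooth cutoff functions\<close>

text \<open>
  The potential is smooth only away from its pole and a gauge factor only inside \<open>\<Omega>\<close>, so smoothness has
  to be relative to an open set.
\<close>

fun Ck_on :: "nat \<Rightarrow> 'a::real_normed_vector set \<Rightarrow> ('a \<Rightarrow> 'b::real_normed_vector) \<Rightarrow> bool" where
  "Ck_on 0 S f \<longleftrightarrow> continuous_on S f"
| "Ck_on (Suc k) S f \<longleftrightarrow>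
     (\<forall>x\<in>S. f differentiable (at x)) \<and> (\<forall>v. Ck_on k S (\<lambda>x. frechet_derivative f (at x) v))"

definition smooth_on :: "'a::real_normed_vector set \<Rightarrow> ('a \<Rightarrow> 'b::real_normed_vector) \<Rightarrow> bool" where
  "smooth_on S f \<longleftrightarrow> (\<forall>k. Ck_on k S f)"

lemma continuously_differentiable_eq_Ck_on:
  "continuously_differentiable k f \<longleftrightarrow> Ck_on k UNIV f"
  by (induction k arbitrary: f) (auto simp: differentiable_on_def)

lemma frechet_derivative_cong_open:
  assumes "open S" "x \<in> S" "\<And>y. y \<in> S \<Longrightarrow> f y = g y"
  shows "frechet_derivative f (at x) = frechet_derivative g (at x)"
proof -
  have "(f has_derivative D) (at x) \<longleftrightarrow> (g has_derivative D) (at x)" for D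
    using has_derivative_transform_within_open[OF _ assms(1,2), of f D UNIV g]
      has_derivative_transform_within_open[OF _ assms(1,2), of g D UNIV f] assms(3) by auto
  then show ?thesis unfolding frechet_derivative_def by simp
qed

lemma frechet_derivative_eq_0_outside:
  assumes "compact K" "\<And>x. x \<notin> K \<Longrightarrow> f x = 0" "x \<notin> K"
  shows "frechet_derivative f (at x) v = 0"
proof -
  have "open (- K)" using assms(1) compact_imp_closed by auto
  then have "frechet_derivative f (at x) = frechet_derivative (\<lambda>_. 0) (at x)"
    using assms(2,3) by (intro frechet_derivative_cong_open[of "- K"]) auto
  then show ?thesis by (simp add: frechet_derivative_const)
qed

lemma differentiable_cong_open:
  assumes "open S" "x \<in> S" "\<And>y. y \<in> S \<Longrightarrow> f y = g y"
  shows "f differentiable (at x) \<longleftrightarrow> g differentiable (at x)"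
  unfolding differentiable_def
  using has_derivative_transform_within_open[OF _ assms(1,2), of f _ UNIV g]
      has_derivative_transform_within_open[OF _ assms(1,2), of g _ UNIV f] assms(3) by auto

lemma Ck_on_cong:
  assumes "open S" "\<And>x. x \<in> S \<Longrightarrow> f x = g x"
  shows "Ck_on k S f \<longleftrightarrow> Ck_on k S g"
  using assms(2)
proof (induction k arbitrary: f g)
  case 0
  then show ?case using continuous_on_cong[of S S f g] by auto
next
  case (Suc k)
  have 1: "Ck_on k S (\<lambda>x. frechet_derivative f (at x) v) \<longleftrightarrow> Ck_on k S (\<lambda>x. frechet_derivative g (at x) v)" for v
    by (rule Suc.IH) (use frechet_derivative_cong_open[OF assms(1) _ Suc.prems] in force)
  have 2: "f differentiable (at x) \<longleftrightarrow> g differentiable (at x)" if "x \<in> S" for x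
    by (rule differentiable_cong_open[OF assms(1) that Suc.prems])
  show ?case unfolding Ck_on.simps using 1 2 by blast
qed

text \<open>
  On an open set derivatives are unique, so any expression for the derivative may replace the
  operator \<open>frechet_derivative\<close> in the recursion. All closure properties below are instances.
\<close>

lemma Ck_on_SucI:
  assumes "open S" "\<And>x. x \<in> S \<Longrightarrow> (f has_derivative f' x) (at x)"
    and "\<And>v. Ck_on k S (\<lambda>x. f' x v)"
  shows "Ck_on (Suc k) S f"
proof -
  have "frechet_derivative f (at x) = f' x" if "x \<in> S" for x
    using assms(2)[OF that] frechet_derivative_at by metis
  then have "Ck_on k S (\<lambda>x. frechet_derivative f (at x) v) \<longleftrightarrow> Ck_on k S (\<lambda>x. f' x v)" for v
    by (intro Ck_on_cong assms(1)) auto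
  then show ?thesis using assms(2,3) by (auto simp: differentiable_def)
qed

lemma Ck_on_has_derivative:
  assumes "Ck_on (Suc k) S f" "x \<in> S"
  shows "(f has_derivative frechet_derivative f (at x)) (at x)"
  using assms by (auto simp: frechet_derivative_works[symmetric])

lemma Ck_on_Suc_D: "Ck_on (Suc k) S f \<Longrightarrow> Ck_on k S f"
proof (induction k arbitrary: f)
  case 0
  then show ?case
    by (auto intro!: continuous_at_imp_continuous_on differentiable_imp_continuous_within)
qed auto

lemma Ck_on_subset: "Ck_on k S f \<Longrightarrow> T \<subseteq> S \<Longrightarrow> Ck_on k T f"
  by (induction k arbitrary: f) (auto intro: continuous_on_subset)

lemma Ck_on_Un:
  "open S \<Longrightarrow> open T \<Longrightarrow> Ck_on k S f \<Longrightarrow> Ck_on k T f \<Longrightarrow> Ck_on k (S \<union> T) f"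
  by (induction k arbitrary: f) (auto intro: continuous_on_open_Un)

lemma Ck_on_const: "Ck_on k S (\<lambda>x. c)"
  by (induction k arbitrary: c) (auto simp: frechet_derivative_const)

lemma Ck_on_bounded_linear_compose:
  assumes "bounded_linear L" "open S" "Ck_on k S f"
  shows "Ck_on k S (\<lambda>x. L (f x))"
  using assms(3)
proof (induction k arbitrary: f)
  case 0
  then show ?case using bounded_linear.continuous_on[OF assms(1)] by auto
next
  case (Suc k)
  show ?case
  proof (rule Ck_on_SucI[OF assms(2)])
    show "((\<lambda>x. L (f x)) has_derivative (\<lambda>v. L (frechet_derivative f (at x) v))) (at x)" if "x \<in> S" for x
      using Ck_on_has_derivative[OF Suc.prems that] bounded_linear.has_derivative[OF assms(1)] by blast
  qed (use Suc in auto)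
qed

lemma Ck_on_id: "open S \<Longrightarrow> Ck_on k S (\<lambda>x. x)"
proof (induction k)
  case (Suc k)
  show ?case by (rule Ck_on_SucI[OF Suc.prems has_derivative_ident]) (rule Ck_on_const)
qed auto

lemma Ck_on_bounded_linear: "bounded_linear L \<Longrightarrow> open S \<Longrightarrow> Ck_on k S L"
  using Ck_on_bounded_linear_compose[OF _ _ Ck_on_id] by blast

lemma Ck_on_add:
  assumes "open S" "Ck_on k S f" "Ck_on k S g"
  shows "Ck_on k S (\<lambda>x. f x + g x)"
  using assms(2,3)
proof (induction k arbitrary: f g)
  case 0
  then show ?case by (auto intro: continuous_intros)
next
  case (Suc k)
  show ?case
    by (rule Ck_on_SucI[OF assms(1) has_derivative_add[OF Ck_on_has_derivative[OF Suc.prems(1)] Ck_on_has_derivative[OF Suc.prems(2)]]])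
      (use Suc in auto)
qed

lemma Ck_on_bilinear:
  assumes "bounded_bilinear pr" "open S" "Ck_on k S f" "Ck_on k S g"
  shows "Ck_on k S (\<lambda>x. pr (f x) (g x))"
  using assms(3,4)
proof (induction k arbitrary: f g)
  case 0
  then show ?case using bounded_bilinear.continuous_on[OF assms(1)] by auto
next
  case (Suc k)
  show ?case
  proof (rule Ck_on_SucI[OF assms(2)])
    show "((\<lambda>x. pr (f x) (g x)) has_derivative
        (\<lambda>v. pr (f x) (frechet_derivative g (at x) v) + pr (frechet_derivative f (at x) v) (g x))) (at x)"
      if "x \<in> S" for x
      using bounded_bilinear.FDERIV[OF assms(1) Ck_on_has_derivative[OF Suc.prems(1) that]
          Ck_on_has_derivative[OF Suc.prems(2) that]] .
    show "Ck_on k S (\<lambda>x. pr (f x) (frechet_derivative g (at x) v) + pr (frechet_derivative f (at x) v) (g x))" for v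
      using Suc.prems Ck_on_Suc_D
      by (intro Ck_on_add assms(2) Suc.IH) (auto intro: Ck_on_Suc_D)
  qed
qed

lemma Ck_on_compose_real:
  fixes f :: "'a::real_normed_vector \<Rightarrow> real"
  assumes "open S" "open U" "f ` S \<subseteq> U" "Ck_on k S f" "Ck_on k U h"
  shows "Ck_on k S (\<lambda>x. h (f x))"
  using assms(4,5)
proof (induction k arbitrary: h)
  case 0
  then show ?case using assms(3) by (auto intro: continuous_on_compose2)
next
  case (Suc k)
  show ?case
  proof (rule Ck_on_SucI[OF assms(1)])
    show "((\<lambda>x. h (f x)) has_derivative
        (\<lambda>v. frechet_derivative f (at x) v *\<^sub>R frechet_derivative h (at (f x)) 1)) (at x)"
      if "x \<in> S" for x
    proof -
      have h: "(h has_derivative frechet_derivative h (at (f x))) (at (f x))"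
        using Ck_on_has_derivative[OF Suc.prems(2)] assms(3) that by auto
      have "(\<lambda>v. frechet_derivative h (at (f x)) (frechet_derivative f (at x) v))
          = (\<lambda>v. frechet_derivative f (at x) v *\<^sub>R frechet_derivative h (at (f x)) 1)"
      proof
        fix v
        show "frechet_derivative h (at (f x)) (frechet_derivative f (at x) v)
            = frechet_derivative f (at x) v *\<^sub>R frechet_derivative h (at (f x)) 1"
          using linear_scale[OF has_derivative_linear[OF h], of "frechet_derivative f (at x) v" 1] by simp
      qed
      then show ?thesis
        using has_derivative_compose[OF Ck_on_has_derivative[OF Suc.prems(1) that] h] by metis
    qed
    show "Ck_on k S (\<lambda>x. frechet_derivative f (at x) v *\<^sub>R frechet_derivative h (at (f x)) 1)" for v
      using Suc.prems
      by (intro Ck_on_bilinear[OF bounded_bilinear_scaleR assms(1)] Suc.IH) (auto intro: Ck_on_Suc_D)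
  qed
qed

lemma Ck_on_real_SucI:
  fixes h :: "real \<Rightarrow> 'b::real_normed_vector"
  assumes "open U" "\<And>t. t \<in> U \<Longrightarrow> (h has_vector_derivative h' t) (at t)" "Ck_on k U h'"
  shows "Ck_on (Suc k) U h"
proof (rule Ck_on_SucI[OF assms(1)])
  show "(h has_derivative (\<lambda>v. v *\<^sub>R h' t)) (at t)" if "t \<in> U" for t
    using assms(2)[OF that] by (simp add: has_vector_derivative_def)
  show "Ck_on k U (\<lambda>x. v *\<^sub>R h' x)" for v
    by (rule Ck_on_bounded_linear_compose[OF bounded_linear_scaleR_right assms(1,3)])
qed

lemma smooth_on_inverse: "smooth_on (- {0}) (inverse :: real \<Rightarrow> real)"
  unfolding smooth_on_def
proof
  fix k show "Ck_on k (- {0}) (inverse :: real \<Rightarrow> real)"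
  proof (induction k)
    case 0
    then show ?case by (auto intro!: continuous_intros)
  next
    case (Suc k)
    show ?case
    proof (rule Ck_on_real_SucI)
      show "(inverse has_vector_derivative - (inverse t * inverse t)) (at t)" if "t \<in> - {0}" for t :: real
        using that DERIV_inverse[of t]
        by (auto simp: has_real_derivative_iff_has_vector_derivative[symmetric] power2_eq_square)
      show "Ck_on k (- {0}) (\<lambda>t::real. - (inverse t * inverse t))"
        by (intro Ck_on_bounded_linear_compose[OF bounded_linear_minus[OF bounded_linear_ident]]
            Ck_on_bilinear[OF bounded_bilinear_mult] Suc) auto
    qed auto
  qed
qed

lemma smooth_on_ln: "smooth_on {0<..} (ln :: real \<Rightarrow> real)"
  unfolding smooth_on_def
proof
  fix k show "Ck_on k {0<..} (ln :: real \<Rightarrow> real)"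
  proof (cases k)
    case 0
    then show ?thesis by (auto intro!: continuous_intros)
  next
    case (Suc k)
    show ?thesis unfolding Suc
    proof (rule Ck_on_real_SucI)
      show "(ln has_vector_derivative inverse t) (at t)" if "t \<in> {0<..}" for t :: real
        using that DERIV_ln[of t]
        by (auto simp: has_real_derivative_iff_has_vector_derivative[symmetric])
      show "Ck_on k {0<..} (inverse :: real \<Rightarrow> real)"
        by (rule Ck_on_subset[of _ "- {0}"]) (use smooth_on_inverse in \<open>auto simp: smooth_on_def\<close>)
    qed auto
  qed
qed

lemma smooth_on_cis: "smooth_on UNIV cis"
  unfolding smooth_on_def
proof
  fix k show "Ck_on k UNIV cis"
  proof (induction k)
    case 0
    then show ?case by (auto intro!: continuous_intros)
  next
    case (Suc k)
    show ?case
    proof (rule Ck_on_real_SucI)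
      show "(cis has_vector_derivative \<i> * cis t) (at t)" for t
        unfolding has_vector_derivative_def
        by (rule has_derivative_eq_rhs, rule has_derivative_cis[OF has_derivative_ident])
          (auto simp: fun_eq_iff scaleR_conv_of_real complex_eq_iff)
      show "Ck_on k UNIV (\<lambda>t. \<i> * cis t)"
        by (intro Ck_on_bounded_linear_compose[OF bounded_linear_mult_right] Suc) auto
    qed auto
  qed
qed

text \<open>
  For \<open>m = 0\<close> this is the classical smooth function that vanishes to infinite order at the origin. The
  powers of \<open>1 / t\<close> are included because they arise on differentiation.
\<close>

definition flat :: "nat \<Rightarrow> real \<Rightarrow> real" where
  "flat m t = (if t > 0 then exp (- inverse t) * inverse t ^ m else 0)"

lemma flat_tendsto_0: "(flat m \<longlongrightarrow> 0) (at_right 0)"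
proof -
  have "((\<lambda>s::real. s ^ m / exp s) \<longlongrightarrow> 0) at_top"
    by (rule tendsto_power_div_exp_0)
  then have "((\<lambda>t::real. inverse t ^ m / exp (inverse t)) \<longlongrightarrow> 0) (at_right 0)"
    by (rule filterlim_compose[OF _ filterlim_inverse_at_top_right])
  then show ?thesis
    by (rule Lim_transform_eventually)
      (auto simp: eventually_at_right_field flat_def exp_minus field_simps intro!: exI[of _ 1])
qed

text \<open>
  At the origin the difference quotient of \<open>flat m\<close> is \<open>flat (m + 1)\<close> on the right and zero on the left,
  so the formula that holds for positive \<open>t\<close> persists.
\<close>

lemma flat_has_derivative:
  "(flat m has_real_derivative flat (m + 2) t - m * flat (m + 1) t) (at t)"
proof -
  consider "t > 0" | "t < 0" | "t = 0" by linarith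
  then show ?thesis
  proof cases
    case 1
    have "((\<lambda>t. exp (- inverse t) * inverse t ^ m) has_real_derivative flat (m + 2) t - m * flat (m + 1) t) (at t)"
      using 1 by (auto intro!: derivative_eq_intros simp: flat_def power2_eq_square)
        (cases m; auto simp: algebra_simps)
    then show ?thesis
      by (rule has_field_derivative_transform_within_open[of _ _ _ "{0<..}"]) (use 1 in \<open>auto simp: flat_def\<close>)
  next
    case 2
    have "((\<lambda>t. 0) has_real_derivative flat (m + 2) t - m * flat (m + 1) t) (at t)"
      using 2 by (auto simp: flat_def)
    then show ?thesis
      by (rule has_field_derivative_transform_within_open[of _ _ _ "{..<0}"]) (use 2 in \<open>auto simp: flat_def\<close>)
  next
    case 3
    have "((\<lambda>h. flat m h / h) \<longlongrightarrow> 0) (at_right 0)"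
      by (rule Lim_transform_eventually[OF flat_tendsto_0[of "Suc m"]])
        (auto simp: eventually_at_right_field flat_def field_simps intro!: exI[of _ 1])
    moreover have "((\<lambda>h. flat m h / h) \<longlongrightarrow> 0) (at_left 0)"
      by (rule Lim_transform_eventually[OF tendsto_const])
        (auto simp: eventually_at_left_field flat_def intro!: exI[of _ "-1"])
    ultimately have "((\<lambda>h. flat m h / h) \<longlongrightarrow> 0) (at 0)"
      by (simp add: filterlim_split_at)
    then show ?thesis using 3 by (simp add: DERIV_def flat_def)
  qed
qed

lemma smooth_on_flat: "smooth_on UNIV (flat m)"
  unfolding smooth_on_def
proof
  fix k show "Ck_on k UNIV (flat m)"
  proof (induction k arbitrary: m)
    case 0
    show ?case using flat_has_derivative[of m] by (auto intro!: DERIV_isCont continuous_at_imp_continuous_on)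
  next
    case (Suc k)
    show ?case
    proof (rule Ck_on_real_SucI)
      show "(flat m has_vector_derivative flat (m + 2) t + (- real m) * flat (m + 1) t) (at t)" for t
        using flat_has_derivative[of m t]
        by (simp add: has_real_derivative_iff_has_vector_derivative)
      show "Ck_on k UNIV (\<lambda>t. flat (m + 2) t + (- real m) * flat (m + 1) t)"
        by (intro Ck_on_add Ck_on_bounded_linear_compose[OF bounded_linear_mult_right] Suc) auto
    qed auto
  qed
qed

text \<open>
  The quotient of \<open>flat 0 t\<close> by \<open>flat 0 t + flat 0 (1 - t)\<close>; the denominator is positive because \<open>t\<close> or
  \<open>1 - t\<close> is.
\<close>

lemma smooth_step_exists:
  obtains \<sigma> :: "real \<Rightarrow> real" where
    "smooth_on UNIV \<sigma>" "\<And>t. t \<le> 0 \<Longrightarrow> \<sigma> t = 0" "\<And>t. t \<ge> 1 \<Longrightarrow> \<sigma> t = 1"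
    "\<And>t. 0 \<le> \<sigma> t \<and> \<sigma> t \<le> 1"
proof
  define \<sigma> where "\<sigma> = (\<lambda>t::real. flat 0 t * inverse (flat 0 t + flat 0 (1 - t)))"
  have nonneg: "flat 0 t \<ge> 0" for t by (simp add: flat_def)
  have pos: "flat 0 t + flat 0 (1 - t) > 0" for t
    by (cases "t > 0"; cases "t < 1") (auto simp: flat_def intro!: add_pos_pos)
  have flat0: "Ck_on k UNIV (flat 0)" for k
    using smooth_on_flat by (simp add: smooth_on_def)
  have "Ck_on k UNIV (\<lambda>t::real. 1 + - t)" for k
    by (intro Ck_on_add Ck_on_const Ck_on_bounded_linear bounded_linear_minus bounded_linear_ident) auto
  then have f1: "Ck_on k UNIV (\<lambda>t. flat 0 (1 - t))" for k
    using Ck_on_compose_real[OF open_UNIV open_UNIV _ _ flat0, of "\<lambda>t::real. 1 - t" k] by simp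
  have "Ck_on k UNIV (\<lambda>t. inverse (flat 0 t + flat 0 (1 - t)))" for k
  proof (rule Ck_on_compose_real[of _ "- {0}" _ _ inverse])
    show "(\<lambda>t. flat 0 t + flat 0 (1 - t)) ` UNIV \<subseteq> - {0}"
    proof clarify
      fix t assume "flat 0 t + flat 0 (1 - t) = 0"
      then show False using pos[of t] by simp
    qed
    show "Ck_on k UNIV (\<lambda>t. flat 0 t + flat 0 (1 - t))"
      by (intro Ck_on_add flat0 f1 open_UNIV)
    show "Ck_on k (- {0}) (inverse :: real \<Rightarrow> real)"
      using smooth_on_inverse by (simp add: smooth_on_def)
  qed auto
  then show "smooth_on UNIV \<sigma>" unfolding smooth_on_def \<sigma>_def
    by (intro allI Ck_on_bilinear[OF bounded_bilinear_mult] flat0 open_UNIV)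
  show "\<sigma> t = 0" if "t \<le> 0" for t using that by (simp add: \<sigma>_def flat_def)
  show "\<sigma> t = 1" if "t \<ge> 1" for t using that pos[of t] by (simp add: \<sigma>_def flat_def)
  show "0 \<le> \<sigma> t \<and> \<sigma> t \<le> 1" for t
    using pos[of t] nonneg[of t] nonneg[of "1 - t"] by (auto simp: \<sigma>_def field_simps)
qed

text \<open>
  The derivative is continuous and vanishes outside the compact interval from 0 to 1.
\<close>

lemma smooth_on_derivative_bounded:
  fixes \<sigma> :: "real \<Rightarrow> real"
  assumes "smooth_on UNIV \<sigma>" "\<And>t. t \<le> 0 \<Longrightarrow> \<sigma> t = 0" "\<And>t. t \<ge> 1 \<Longrightarrow> \<sigma> t = 1"
  obtains \<sigma>' C where "\<And>t. (\<sigma> has_real_derivative \<sigma>' t) (at t)" "\<And>t. \<bar>\<sigma>' t\<bar> \<le> C" "C > 0"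
proof -
  define \<sigma>' where "\<sigma>' t = frechet_derivative \<sigma> (at t) 1" for t
  have C1: "Ck_on 1 UNIV \<sigma>" using assms(1) by (simp add: smooth_on_def)
  have der: "(\<sigma> has_real_derivative \<sigma>' t) (at t)" for t
  proof -
    have h: "(\<sigma> has_derivative frechet_derivative \<sigma> (at t)) (at t)"
      using C1 by (auto simp: frechet_derivative_works[symmetric])
    have "frechet_derivative \<sigma> (at t) s = \<sigma>' t * s" for s
      using linear_scale[OF has_derivative_linear[OF h], of s 1] by (simp add: \<sigma>'_def)
    then have "frechet_derivative \<sigma> (at t) = (*) (\<sigma>' t)" by (simp add: fun_eq_iff)
    then show ?thesis using h by (simp add: has_field_derivative_def)
  qed
  have cont: "continuous_on {0..1} \<sigma>'"
  proof -
    have "continuous_on UNIV \<sigma>'" using C1 by (simp add: \<sigma>'_def[abs_def])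
    then show ?thesis by (rule continuous_on_subset) simp
  qed
  have zero: "\<sigma>' t = 0" if "t < 0 \<or> t > 1" for t
  proof -
    have "(\<sigma> has_real_derivative 0) (at t)"
    proof (cases "t < 0")
      case True
      show ?thesis
        by (rule has_field_derivative_transform_within_open[of "\<lambda>_. 0" _ _ "{..<0}"]) (use True assms(2) in auto)
    next
      case False
      show ?thesis
        by (rule has_field_derivative_transform_within_open[of "\<lambda>_. 1" _ _ "{1<..}"]) (use False that assms(3) in auto)
    qed
    then show ?thesis using der DERIV_unique by blast
  qed
  have "bounded (\<sigma>' ` {0..1})"
    using compact_continuous_image[OF cont] compact_imp_bounded by auto
  then obtain B where B: "B > 0" "\<And>t. t \<in> {0..1} \<Longrightarrow> \<bar>\<sigma>' t\<bar> \<le> B"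
    unfolding bounded_pos by auto
  show ?thesis
  proof (rule that[OF der _ B(1)])
    fix t show "\<bar>\<sigma>' t\<bar> \<le> B" using B zero[of t] by (cases "t \<in> {0..1}") auto
  qed
qed

lemma smooth_onD: "smooth_on S f \<Longrightarrow> Ck_on k S f"
  by (simp add: smooth_on_def)

lemma smooth_on_has_derivative:
  "smooth_on S f \<Longrightarrow> x \<in> S \<Longrightarrow> (f has_derivative frechet_derivative f (at x)) (at x)"
  using Ck_on_has_derivative[of 0] smooth_onD by blast

lemma smooth_on_derivative: "smooth_on S f \<Longrightarrow> smooth_on S (\<lambda>x. frechet_derivative f (at x) v)"
  unfolding smooth_on_def by (metis Ck_on.simps(2))

lemma smooth_on_continuous: "smooth_on S f \<Longrightarrow> continuous_on S f"
  using smooth_onD[of S f 0] by simp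

lemma smooth_on_mult:
  fixes f g :: "'a::real_normed_vector \<Rightarrow> 'b::real_normed_algebra"
  shows "open S \<Longrightarrow> smooth_on S f \<Longrightarrow> smooth_on S g \<Longrightarrow> smooth_on S (\<lambda>x. f x * g x)"
  unfolding smooth_on_def using Ck_on_bilinear[OF bounded_bilinear_mult] by blast

lemma smooth_on_add: "open S \<Longrightarrow> smooth_on S f \<Longrightarrow> smooth_on S g \<Longrightarrow> smooth_on S (\<lambda>x. f x + g x)"
  unfolding smooth_on_def using Ck_on_add by blast

lemma smooth_on_linear_compose:
  "bounded_linear L \<Longrightarrow> open S \<Longrightarrow> smooth_on S f \<Longrightarrow> smooth_on S (\<lambda>x. L (f x))"
  unfolding smooth_on_def using Ck_on_bounded_linear_compose by blast

lemma smooth_on_const: "smooth_on S (\<lambda>x. c)"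
  by (simp add: smooth_on_def Ck_on_const)

lemma smooth_on_diff: "open S \<Longrightarrow> smooth_on S f \<Longrightarrow> smooth_on S g \<Longrightarrow> smooth_on S (\<lambda>x. f x - g x)"
  using smooth_on_add[of S f "\<lambda>x. - g x"]
    smooth_on_linear_compose[OF bounded_linear_minus[OF bounded_linear_ident], of S g] by simp

lemma smooth_on_linear: "bounded_linear L \<Longrightarrow> open S \<Longrightarrow> smooth_on S L"
  by (simp add: smooth_on_def Ck_on_bounded_linear)

lemma smooth_on_compose_real:
  fixes f :: "'a::real_normed_vector \<Rightarrow> real"
  shows "open S \<Longrightarrow> open U \<Longrightarrow> f ` S \<subseteq> U \<Longrightarrow> smooth_on S f \<Longrightarrow> smooth_on U h \<Longrightarrow> smooth_on S (\<lambda>x. h (f x))"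
  unfolding smooth_on_def using Ck_on_compose_real by blast

lemma smooth_on_subset: "smooth_on S f \<Longrightarrow> T \<subseteq> S \<Longrightarrow> smooth_on T f"
  unfolding smooth_on_def using Ck_on_subset by blast

lemma smooth_on_cong: "open S \<Longrightarrow> (\<And>x. x \<in> S \<Longrightarrow> f x = g x) \<Longrightarrow> smooth_on S f \<longleftrightarrow> smooth_on S g"
  unfolding smooth_on_def using Ck_on_cong by blast

lemma smooth_on_Un: "open S \<Longrightarrow> open T \<Longrightarrow> smooth_on S f \<Longrightarrow> smooth_on T f \<Longrightarrow> smooth_on (S \<union> T) f"
  unfolding smooth_on_def using Ck_on_Un by blast

text \<open>
  The product is smooth on \<open>S\<close> and zero on the complement of \<open>K\<close>, and these two open sets cover the space.
\<close>

lemma smooth_on_mult_extend: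
  fixes g \<phi> :: "'a::real_normed_vector \<Rightarrow> complex"
  assumes "open S" "compact K" "K \<subseteq> S" "smooth_on S g" "smooth_on UNIV \<phi>" "\<And>x. x \<notin> K \<Longrightarrow> \<phi> x = 0"
  shows "smooth_on UNIV (\<lambda>x. g x * \<phi> x)"
proof -
  have o: "open (- K)" using assms(2) compact_imp_closed by auto
  have "smooth_on S (\<lambda>x. g x * \<phi> x)"
    using assms(1,4) smooth_on_subset[OF assms(5), of S] by (intro smooth_on_mult) auto
  moreover have "smooth_on (- K) (\<lambda>x. g x * \<phi> x)"
    using smooth_on_cong[OF o, of "\<lambda>x. g x * \<phi> x" "\<lambda>x. 0"] assms(6) smooth_on_const[of "- K" "0::complex"] by auto
  ultimately have "smooth_on (S \<union> - K) (\<lambda>x. g x * \<phi> x)" by (intro smooth_on_Un assms o)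
  moreover have "S \<union> - K = UNIV" using assms(3) by auto
  ultimately show ?thesis by simp
qed

lemma smooth_on_norm_power2:
  fixes a :: "'a::real_inner"
  shows "smooth_on UNIV (\<lambda>x. (norm (x - a))\<^sup>2)"
proof -
  have "smooth_on UNIV (\<lambda>x. x - a)"
    by (intro smooth_on_diff smooth_on_const smooth_on_linear bounded_linear_ident open_UNIV)
  then show ?thesis
    unfolding smooth_on_def power2_norm_eq_inner
    by (intro allI Ck_on_bilinear[OF bounded_bilinear_inner] open_UNIV) auto
qed

section \<open>Square integrable functions and integration by parts\<close>

text \<open>
  The quadratic polynomial \<open>\<integral> (f - t g)\<^sup>2\<close> in \<open>t\<close> is nonnegative, so its discriminant is not positive.
\<close>

lemma Cauchy_Schwarz_integral:
  fixes f g :: "'a \<Rightarrow> real"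
  assumes "f \<in> borel_measurable M" "g \<in> borel_measurable M"
    and "integrable M (\<lambda>x. (f x)\<^sup>2)" "integrable M (\<lambda>x. (g x)\<^sup>2)"
  shows "integrable M (\<lambda>x. f x * g x)"
    and "(\<integral>x. f x * g x \<partial>M) \<le> sqrt (\<integral>x. (f x)\<^sup>2 \<partial>M) * sqrt (\<integral>x. (g x)\<^sup>2 \<partial>M)"
proof -
  show fg: "integrable M (\<lambda>x. f x * g x)"
  proof (rule Bochner_Integration.integrable_bound[OF Bochner_Integration.integrable_add[OF assms(3,4)]])
    show "AE x in M. norm (f x * g x) \<le> norm ((f x)\<^sup>2 + (g x)\<^sup>2)"
    proof (rule AE_I2)
      fix x
      have "2 * (\<bar>f x\<bar> * \<bar>g x\<bar>) \<le> (f x)\<^sup>2 + (g x)\<^sup>2"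
        using sum_squares_bound[of "\<bar>f x\<bar>" "\<bar>g x\<bar>"] by (simp add: mult.assoc)
      then show "norm (f x * g x) \<le> norm ((f x)\<^sup>2 + (g x)\<^sup>2)"
        by (simp add: abs_mult) (smt (verit) mult_nonneg_nonneg abs_ge_zero)
    qed
  qed (use assms in measurable)
  define A B C where "A = (\<integral>x. (f x)\<^sup>2 \<partial>M)" and "B = (\<integral>x. f x * g x \<partial>M)" and "C = (\<integral>x. (g x)\<^sup>2 \<partial>M)"
  have nn: "A \<ge> 0" "C \<ge> 0" by (auto simp: A_def C_def)
  have q: "0 \<le> A - 2 * t * B + t\<^sup>2 * C" for t
  proof -
    have "0 \<le> (\<integral>x. (f x - t * g x)\<^sup>2 \<partial>M)" by simp
    also have "\<dots> = (\<integral>x. ((f x)\<^sup>2 - (2 * t) * (f x * g x)) + t\<^sup>2 * (g x)\<^sup>2 \<partial>M)"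
      by (rule Bochner_Integration.integral_cong) (auto simp: power2_eq_square algebra_simps)
    also have "\<dots> = A - 2 * t * B + t\<^sup>2 * C"
      unfolding A_def B_def C_def using fg assms(3,4)
      by (subst Bochner_Integration.integral_add) auto
    finally show ?thesis .
  qed
  have "B\<^sup>2 \<le> A * C"
  proof (cases "C = 0")
    case True
    have "B = 0"
    proof (rule ccontr)
      assume "B \<noteq> 0"
      then show False using q[of "(A + 1) / (2 * B)"] True nn by (simp add: field_simps)
    qed
    then show ?thesis using True by simp
  next
    case False
    then have "C > 0" using nn by simp
    then show ?thesis using q[of "B / C"] by (simp add: field_simps power2_eq_square)
  qed
  then have "\<bar>B\<bar> \<le> sqrt (A * C)" by (simp add: real_le_rsqrt)
  then show "B \<le> sqrt A * sqrt C" by (simp add: real_sqrt_mult)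
qed

definition sq_integrable :: "(real^2) set \<Rightarrow> (real^2 \<Rightarrow> 'b::{second_countable_topology,real_normed_vector}) \<Rightarrow> bool" where
  "sq_integrable \<Omega> F \<longleftrightarrow> F \<in> borel_measurable (lebesgue_on \<Omega>) \<and> integrable (lebesgue_on \<Omega>) (\<lambda>x. (norm (F x))\<^sup>2)"

lemma L2_functions_eq: "L2_functions \<Omega> = {u. sq_integrable \<Omega> u}"
  by (simp add: L2_functions_def sq_integrable_def)

lemma sq_integrable_bound:
  assumes "sq_integrable \<Omega> F" "G \<in> borel_measurable (lebesgue_on \<Omega>)"
    and "\<And>x. x \<in> \<Omega> \<Longrightarrow> norm (G x) \<le> c * norm (F x)"
  shows "sq_integrable \<Omega> G"
proof -
  have "integrable (lebesgue_on \<Omega>) (\<lambda>x. c\<^sup>2 * (norm (F x))\<^sup>2)"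
    using assms(1) by (simp add: sq_integrable_def)
  moreover have "(\<lambda>x. (norm (G x))\<^sup>2) \<in> borel_measurable (lebesgue_on \<Omega>)" using assms(2) by simp
  moreover have "AE x in lebesgue_on \<Omega>. norm ((norm (G x))\<^sup>2) \<le> norm (c\<^sup>2 * (norm (F x))\<^sup>2)"
    using power_mono[OF assms(3), of _ 2] by (intro AE_I2) (auto simp: power_mult_distrib)
  ultimately have "integrable (lebesgue_on \<Omega>) (\<lambda>x. (norm (G x))\<^sup>2)"
    by (rule Bochner_Integration.integrable_bound)
  then show ?thesis using assms(2) by (simp add: sq_integrable_def)
qed

lemma sq_integrable_norm: "sq_integrable \<Omega> F \<Longrightarrow> sq_integrable \<Omega> (\<lambda>x. norm (F x))"
  by (rule sq_integrable_bound[of _ _ _ 1]) (auto simp: sq_integrable_def)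

lemma sq_integrable_cmult:
  fixes F :: "real^2 \<Rightarrow> 'b::{second_countable_topology,real_normed_algebra}"
  shows "sq_integrable \<Omega> F \<Longrightarrow> sq_integrable \<Omega> (\<lambda>x. c * F x)"
  by (rule sq_integrable_bound[of _ _ _ "norm c"]) (auto simp: sq_integrable_def norm_mult_ineq)

lemma L2_norm_nonneg: "0 \<le> L2_norm \<Omega> F"
  by (simp add: L2_norm_def)

lemma L2_norm_power2: "(L2_norm \<Omega> F)\<^sup>2 = (\<integral>x. (norm (F x))\<^sup>2 \<partial>lebesgue_on \<Omega>)"
  by (simp add: L2_norm_def)

lemma L2_norm_norm: "L2_norm \<Omega> (\<lambda>x. norm (F x)) = L2_norm \<Omega> F"
  by (simp add: L2_norm_def)

lemma L2_norm_cong: "(\<And>x. x \<in> \<Omega> \<Longrightarrow> norm (F x) = norm (G x)) \<Longrightarrow> L2_norm \<Omega> F = L2_norm \<Omega> G"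
  unfolding L2_norm_def by (rule arg_cong[where f=sqrt], rule Bochner_Integration.integral_cong) auto

lemma L2_norm_mono:
  assumes "sq_integrable \<Omega> F" "\<And>x. x \<in> \<Omega> \<Longrightarrow> norm (G x) \<le> norm (F x)"
  shows "L2_norm \<Omega> G \<le> L2_norm \<Omega> F"
  unfolding L2_norm_def
proof (rule real_sqrt_le_mono, cases "integrable (lebesgue_on \<Omega>) (\<lambda>x. (norm (G x))\<^sup>2)")
  case True
  then show "(\<integral>x. (norm (G x))\<^sup>2 \<partial>lebesgue_on \<Omega>) \<le> (\<integral>x. (norm (F x))\<^sup>2 \<partial>lebesgue_on \<Omega>)"
    using assms by (intro integral_mono) (auto simp: sq_integrable_def intro!: power_mono)
qed (simp add: not_integrable_integral_eq)

lemma L2_norm_cmult: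
  fixes F :: "real^2 \<Rightarrow> 'b::real_normed_div_algebra"
  shows "L2_norm \<Omega> (\<lambda>x. c * F x) = norm c * L2_norm \<Omega> F"
proof -
  have "L2_norm \<Omega> (\<lambda>x. c * F x) = sqrt (\<integral>x. (norm c)\<^sup>2 * (norm (F x))\<^sup>2 \<partial>lebesgue_on \<Omega>)"
    by (simp add: L2_norm_def norm_mult power_mult_distrib)
  then show ?thesis by (simp add: L2_norm_def real_sqrt_mult)
qed

lemma sq_integrable_inner:
  fixes F G :: "real^2 \<Rightarrow> 'b::euclidean_space"
  assumes "sq_integrable \<Omega> F" "sq_integrable \<Omega> G"
  shows "integrable (lebesgue_on \<Omega>) (\<lambda>x. F x \<bullet> G x)"
    and "\<bar>\<integral>x. F x \<bullet> G x \<partial>lebesgue_on \<Omega>\<bar> \<le> L2_norm \<Omega> F * L2_norm \<Omega> G"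
proof -
  have fg: "integrable (lebesgue_on \<Omega>) (\<lambda>x. norm (F x) * norm (G x))"
    "(\<integral>x. norm (F x) * norm (G x) \<partial>lebesgue_on \<Omega>) \<le> L2_norm \<Omega> F * L2_norm \<Omega> G"
    using assms unfolding L2_norm_def sq_integrable_def
    by (auto intro!: Cauchy_Schwarz_integral)
  show i: "integrable (lebesgue_on \<Omega>) (\<lambda>x. F x \<bullet> G x)"
    by (rule Bochner_Integration.integrable_bound[OF fg(1)])
      (use assms in \<open>auto simp: sq_integrable_def intro!: AE_I2 Cauchy_Schwarz_ineq2\<close>)
  have "\<bar>\<integral>x. F x \<bullet> G x \<partial>lebesgue_on \<Omega>\<bar> \<le> (\<integral>x. norm (F x \<bullet> G x) \<partial>lebesgue_on \<Omega>)"
    using integral_norm_bound[of "lebesgue_on \<Omega>" "\<lambda>x. F x \<bullet> G x"] by simp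
  also have "\<dots> \<le> (\<integral>x. norm (F x) * norm (G x) \<partial>lebesgue_on \<Omega>)"
    by (rule integral_mono) (use i fg in \<open>auto intro!: Cauchy_Schwarz_ineq2\<close>)
  finally show "\<bar>\<integral>x. F x \<bullet> G x \<partial>lebesgue_on \<Omega>\<bar> \<le> L2_norm \<Omega> F * L2_norm \<Omega> G" using fg(2) by simp
qed

lemma sq_integrable_add:
  fixes F G :: "real^2 \<Rightarrow> 'b::euclidean_space"
  assumes "sq_integrable \<Omega> F" "sq_integrable \<Omega> G"
  shows "sq_integrable \<Omega> (\<lambda>x. F x + G x)"
    and "L2_norm \<Omega> (\<lambda>x. F x + G x) \<le> L2_norm \<Omega> F + L2_norm \<Omega> G"
proof -
  have eq: "(norm (F x + G x))\<^sup>2 = ((norm (F x))\<^sup>2 + (norm (G x))\<^sup>2) + 2 * (F x \<bullet> G x)" for x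
    by (simp add: power2_norm_eq_inner inner_simps inner_commute)
  have int: "integrable (lebesgue_on \<Omega>) (\<lambda>x. (norm (F x))\<^sup>2)" "integrable (lebesgue_on \<Omega>) (\<lambda>x. (norm (G x))\<^sup>2)"
    using assms by (auto simp: sq_integrable_def)
  note ip = sq_integrable_inner[OF assms]
  show "sq_integrable \<Omega> (\<lambda>x. F x + G x)"
    unfolding sq_integrable_def eq using assms int ip(1) by (auto simp: sq_integrable_def)
  have "(L2_norm \<Omega> (\<lambda>x. F x + G x))\<^sup>2 = (L2_norm \<Omega> F)\<^sup>2 + (L2_norm \<Omega> G)\<^sup>2 + 2 * (\<integral>x. F x \<bullet> G x \<partial>lebesgue_on \<Omega>)"
    unfolding L2_norm_power2 eq using int ip(1)
    by (subst Bochner_Integration.integral_add) auto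
  also have "\<dots> \<le> (L2_norm \<Omega> F + L2_norm \<Omega> G)\<^sup>2"
    using ip(2) by (simp add: power2_sum)
  finally show "L2_norm \<Omega> (\<lambda>x. F x + G x) \<le> L2_norm \<Omega> F + L2_norm \<Omega> G"
    by (rule power2_le_imp_le) (simp add: L2_norm_nonneg)
qed

lemma sq_integrable_diff:
  fixes F G :: "real^2 \<Rightarrow> 'b::euclidean_space"
  assumes "sq_integrable \<Omega> F" "sq_integrable \<Omega> G"
  shows "sq_integrable \<Omega> (\<lambda>x. F x - G x)"
    and "L2_norm \<Omega> (\<lambda>x. F x - G x) \<le> L2_norm \<Omega> F + L2_norm \<Omega> G"
proof -
  have "sq_integrable \<Omega> (\<lambda>x. - G x)" "L2_norm \<Omega> (\<lambda>x. - G x) = L2_norm \<Omega> G"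
    using assms(2) by (auto simp: sq_integrable_def L2_norm_def)
  then show "sq_integrable \<Omega> (\<lambda>x. F x - G x)"
    and "L2_norm \<Omega> (\<lambda>x. F x - G x) \<le> L2_norm \<Omega> F + L2_norm \<Omega> G"
    using sq_integrable_add[OF assms(1), of "\<lambda>x. - G x"] by auto
qed

lemma L2_norm_triangle_diff:
  fixes F G :: "real^2 \<Rightarrow> 'b::euclidean_space"
  assumes "sq_integrable \<Omega> F" "sq_integrable \<Omega> G"
  shows "\<bar>L2_norm \<Omega> F - L2_norm \<Omega> G\<bar> \<le> L2_norm \<Omega> (\<lambda>x. F x - G x)"
  using sq_integrable_add(2)[OF sq_integrable_diff(1)[OF assms] assms(2)]
    sq_integrable_add(2)[OF sq_integrable_diff(1)[OF assms(2,1)] assms(1)]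
    L2_norm_cong[of \<Omega> "\<lambda>x. F x - G x" "\<lambda>x. G x - F x"]
  by (auto simp: norm_minus_commute)

lemma L2_norm_eq_0_iff:
  assumes "sq_integrable \<Omega> F"
  shows "L2_norm \<Omega> F = 0 \<longleftrightarrow> (AE x in lebesgue_on \<Omega>. F x = 0)"
  using assms by (simp add: L2_norm_def integral_nonneg_eq_0_iff_AE sq_integrable_def)

lemma integrable_continuous_compact_support:
  fixes f :: "'a::euclidean_space \<Rightarrow> 'b::euclidean_space"
  assumes "continuous_on UNIV f" "compact K" "\<And>x. x \<notin> K \<Longrightarrow> f x = 0"
  shows "integrable lborel f"
proof -
  have "integrable lborel (\<lambda>x. indicator K x *\<^sub>R f x)"
    using borel_integrable_compact[OF assms(2) continuous_on_subset[OF assms(1)]] by simp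
  moreover have "(\<lambda>x. indicator K x *\<^sub>R f x) = f" using assms(3) by (auto simp: indicator_def fun_eq_iff)
  ultimately show ?thesis by simp
qed

lemma sq_integrable_if_lborel:
  fixes f :: "real^2 \<Rightarrow> 'b::euclidean_space"
  assumes f: "f \<in> borel_measurable borel" and "integrable lborel (\<lambda>x. (norm (f x))\<^sup>2)" "open \<Omega>"
  shows "sq_integrable \<Omega> f"
proof -
  have "integrable lebesgue (\<lambda>x. (norm (f x))\<^sup>2)"
    using assms by (subst integrable_completion) auto
  then have "integrable (lebesgue_on \<Omega>) (\<lambda>x. (norm (f x))\<^sup>2)"
    using assms(3) integrable_mult_indicator[of \<Omega> lebesgue "\<lambda>x. (norm (f x))\<^sup>2"]
    by (subst integrable_restrict_space) auto
  moreover have "f \<in> borel_measurable (lebesgue_on \<Omega>)"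
    using f by (intro measurable_restrict_space1 measurable_completion) auto
  ultimately show ?thesis by (simp add: sq_integrable_def)
qed

lemma sq_integrable_continuous_compact_support:
  fixes f :: "real^2 \<Rightarrow> 'b::euclidean_space"
  assumes "continuous_on UNIV f" "compact K" "\<And>x. x \<notin> K \<Longrightarrow> f x = 0" "open \<Omega>"
  shows "sq_integrable \<Omega> f"
proof (rule sq_integrable_if_lborel[OF _ _ assms(4)])
  show "f \<in> borel_measurable borel" using assms(1) by (rule borel_measurable_continuous_onI)
  show "integrable lborel (\<lambda>x. (norm (f x))\<^sup>2)"
    using assms by (intro integrable_continuous_compact_support[of _ K]) (auto intro!: continuous_intros)
qed

lemma integral_lebesgue_on_eq_lborel:
  fixes f :: "real^2 \<Rightarrow> 'b::euclidean_space"
  assumes "f \<in> borel_measurable borel" "open \<Omega>" "\<And>x. x \<notin> \<Omega> \<Longrightarrow> f x = 0"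
  shows "(\<integral>x. f x \<partial>lebesgue_on \<Omega>) = (\<integral>x. f x \<partial>lborel)"
proof -
  have "(\<integral>x. f x \<partial>lebesgue_on \<Omega>) = (\<integral>x. indicator \<Omega> x *\<^sub>R f x \<partial>lebesgue)"
    using assms(2) by (intro integral_restrict_space) auto
  also have "(\<lambda>x. indicator \<Omega> x *\<^sub>R f x) = f" using assms(3) by (auto simp: indicator_def fun_eq_iff)
  also have "(\<integral>x. f x \<partial>lebesgue) = (\<integral>x. f x \<partial>lborel)"
    using assms(1) by (intro integral_completion) auto
  finally show ?thesis .
qed

lemma lborel_integral_translate:
  fixes f :: "'a::euclidean_space \<Rightarrow> 'b::euclidean_space"
  assumes "f \<in> borel_measurable borel"
  shows "(\<integral>x. f (x + c) \<partial>lborel) = (\<integral>x. f x \<partial>lborel)"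
proof -
  have "(\<integral>x. f x \<partial>lborel) = (\<integral>x. f x \<partial>distr lborel borel ((+) c))"
    by (simp add: lborel_distr_plus)
  also have "\<dots> = (\<integral>x. f (c + x) \<partial>lborel)"
    using assms by (intro integral_distr) auto
  finally show ?thesis by (simp add: add.commute)
qed

text \<open>
  The Lebesgue measure is invariant under translations, so the integral of every difference quotient of
  \<open>f\<close> in direction \<open>e\<close> is zero, and dominated convergence passes to the derivative.
\<close>

lemma integral_derivative_compact_support:
  fixes f :: "'a::euclidean_space \<Rightarrow> 'b::euclidean_space"
  assumes C1: "Ck_on 1 UNIV f" and K: "compact K" "\<And>x. x \<notin> K \<Longrightarrow> f x = 0"
  shows "(\<integral>x. frechet_derivative f (at x) e \<partial>lborel) = 0"
proof -
  define f' where "f' x = frechet_derivative f (at x) e" for x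
  have der: "(f has_derivative frechet_derivative f (at x)) (at x)" for x
    using C1 by (auto simp: frechet_derivative_works[symmetric])
  have cont: "continuous_on UNIV f" using C1 by (auto intro!: differentiable_imp_continuous_on simp: differentiable_on_def)
  have cont': "continuous_on UNIV f'" using C1 by (simp add: f'_def[abs_def])
  have meas[measurable]: "f \<in> borel_measurable borel" "f' \<in> borel_measurable borel"
    using cont cont' by (auto intro: borel_measurable_continuous_onI)
  \<comment> \<open>Difference quotients with steps at most one vanish outside of \<open>K\<close> and \<open>K'\<close>.\<close>
  define K' where "K' = (\<lambda>(x, t). x - t *\<^sub>R e) ` (K \<times> {0..1})"
  have K': "compact K'" unfolding K'_def
    by (intro compact_continuous_image compact_Times K) (auto intro!: continuous_intros simp: case_prod_unfold)
  have line: "((\<lambda>t. f (x + t *\<^sub>R e)) has_vector_derivative f' (x + t *\<^sub>R e)) (at t within T)" for x t T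
  proof -
    have l: "((\<lambda>t. x + t *\<^sub>R e) has_derivative (\<lambda>t. t *\<^sub>R e)) (at t within T)"
      by (auto intro!: derivative_eq_intros)
    have "((\<lambda>t. f (x + t *\<^sub>R e)) has_derivative (\<lambda>s. frechet_derivative f (at (x + t *\<^sub>R e)) (s *\<^sub>R e))) (at t within T)"
      by (rule has_derivative_compose[OF l der])
    then show ?thesis
      by (simp add: has_vector_derivative_def f'_def linear_scale[OF has_derivative_linear[OF der]])
  qed
  have zero: "f' x = 0" if "x \<notin> K" for x
    unfolding f'_def by (rule frechet_derivative_eq_0_outside[OF K that])
  have "bounded (f' ` K)"
    by (intro compact_imp_bounded compact_continuous_image continuous_on_subset[OF cont'] K) auto
  then obtain B where B: "\<And>x. x \<in> K \<Longrightarrow> norm (f' x) \<le> B" "B > 0"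
    unfolding bounded_pos by auto
  then have B': "norm (f' x) \<le> B" for x using zero[of x] by (cases "x \<in> K") auto
  define q where "q n x = real (Suc n) *\<^sub>R (f (x + (1 / real (Suc n)) *\<^sub>R e) - f x)" for n x
  have qbound: "norm (q n x) \<le> B * indicator (K \<union> K') x" for n x
  proof (cases "x \<in> K \<union> K'")
    case True
    have "norm (f (x + (1 / real (Suc n)) *\<^sub>R e) - f (x + 0 *\<^sub>R e)) \<le> B * norm (1 / real (Suc n) - 0)"
      by (rule differentiable_bound[where S=UNIV and f = "\<lambda>t. f (x + t *\<^sub>R e)" and f' = "\<lambda>t s. s *\<^sub>R f' (x + t *\<^sub>R e)"])
        (use line[unfolded has_vector_derivative_def] B' in \<open>auto simp: mult.commute[of B] intro!: onorm_le mult_left_mono\<close>)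
    then have "real (Suc n) * norm (f (x + (1 / real (Suc n)) *\<^sub>R e) - f x) \<le> B"
      by (simp add: field_simps)
    moreover have "norm (q n x) = real (Suc n) * norm (f (x + (1 / real (Suc n)) *\<^sub>R e) - f x)"
      unfolding q_def norm_scaleR by simp
    ultimately show ?thesis using True by simp
  next
    case False
    have "x + (1 / real (Suc n)) *\<^sub>R e \<notin> K"
    proof
      assume "x + (1 / real (Suc n)) *\<^sub>R e \<in> K"
      then have "x \<in> K'" unfolding K'_def
        by (intro image_eqI[of _ _ "(x + (1 / real (Suc n)) *\<^sub>R e, 1 / real (Suc n))"]) auto
      then show False using False by simp
    qed
    then show ?thesis using False K(2) by (simp add: q_def)
  qed
  have lim: "(\<lambda>n. q n x) \<longlonglongrightarrow> f' x" for x
  proof -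
    have "((\<lambda>h. norm (f (x + (0 + h) *\<^sub>R e) - f (x + 0 *\<^sub>R e) - h *\<^sub>R f' (x + 0 *\<^sub>R e)) / norm h) \<longlongrightarrow> 0) (at 0)"
      using line[of x 0 UNIV] unfolding has_vector_derivative_def has_derivative_at by blast
    moreover have "norm (f (x + (0 + h) *\<^sub>R e) - f (x + 0 *\<^sub>R e) - h *\<^sub>R f' (x + 0 *\<^sub>R e)) / norm h
        = norm (inverse h *\<^sub>R (f (x + h *\<^sub>R e) - f x) - f' x)" if "h \<noteq> 0" for h
    proof -
      have "inverse h *\<^sub>R (f (x + h *\<^sub>R e) - f x) - f' x = inverse h *\<^sub>R (f (x + h *\<^sub>R e) - f x - h *\<^sub>R f' x)"
        using that by (simp add: scaleR_diff_right)
      then show ?thesis by (simp add: divide_inverse mult.commute)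
    qed
    then have "\<forall>\<^sub>F h in at 0. norm (f (x + (0 + h) *\<^sub>R e) - f (x + 0 *\<^sub>R e) - h *\<^sub>R f' (x + 0 *\<^sub>R e)) / norm h
        = norm (inverse h *\<^sub>R (f (x + h *\<^sub>R e) - f x) - f' x)"
      by (auto simp: eventually_at_filter)
    ultimately have "((\<lambda>h. norm (inverse h *\<^sub>R (f (x + h *\<^sub>R e) - f x) - f' x)) \<longlongrightarrow> 0) (at 0)"
      by (rule Lim_transform_eventually)
    then have L: "((\<lambda>h. inverse h *\<^sub>R (f (x + h *\<^sub>R e) - f x)) \<longlongrightarrow> f' x) (at 0)"
      by (simp add: tendsto_norm_zero_iff LIM_zero_iff)
    have "filterlim (\<lambda>n. 1 / real (Suc n)) (at 0) sequentially"
      using LIMSEQ_Suc[OF lim_1_over_n] by (auto simp: filterlim_at)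
    from filterlim_compose[OF L this] show ?thesis by (simp add: q_def field_simps)
  qed
  have "(\<lambda>n. \<integral>x. q n x \<partial>lborel) \<longlonglongrightarrow> (\<integral>x. f' x \<partial>lborel)"
  proof (rule integral_dominated_convergence)
    show "integrable lborel (\<lambda>x. B * indicator (K \<union> K') x :: real)"
    proof (rule integrable_mult_right, rule integrable_real_indicator)
      show "K \<union> K' \<in> sets lborel" using K K' by (auto intro: borel_compact)
      show "emeasure lborel (K \<union> K') < \<infinity>"
        using K K' by (intro emeasure_bounded_finite) (auto simp: compact_imp_bounded)
    qed
  qed (use qbound lim in \<open>auto simp: q_def\<close>)
  moreover have "(\<integral>x. q n x \<partial>lborel) = 0" for n
  proof -
    have i: "integrable lborel f" by (rule integrable_continuous_compact_support[OF cont K])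
    have i': "integrable lborel (\<lambda>x. f (x + (1 / real (Suc n)) *\<^sub>R e))"
    proof (rule integrable_continuous_compact_support[of _ "(\<lambda>x. x - (1 / real (Suc n)) *\<^sub>R e) ` K"])
      show "continuous_on UNIV (\<lambda>x. f (x + (1 / real (Suc n)) *\<^sub>R e))"
        by (rule continuous_on_compose2[OF cont]) (auto intro!: continuous_intros)
      show "compact ((\<lambda>x. x - (1 / real (Suc n)) *\<^sub>R e) ` K)"
        by (intro compact_continuous_image K) (auto intro!: continuous_intros)
      show "f (x + (1 / real (Suc n)) *\<^sub>R e) = 0" if "x \<notin> (\<lambda>x. x - (1 / real (Suc n)) *\<^sub>R e) ` K" for x
        using that by (intro K(2)) (metis add_diff_cancel_right' image_eqI)
    qed
    show ?thesis unfolding q_def using i i' lborel_integral_translate[OF meas(1)]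
      by simp
  qed
  ultimately show ?thesis by (simp add: f'_def LIMSEQ_const_iff)
qed

section \<open>Test functions and the magnetic gradient\<close>

text \<open>
  Some compact set outside of which the function vanishes is easier to exhibit than the closure of the
  support.
\<close>

lemma test_functions_iff:
  "\<phi> \<in> test_functions U \<longleftrightarrow>
     smooth_on UNIV \<phi> \<and> (\<exists>K. compact K \<and> K \<subseteq> U \<and> (\<forall>x. x \<notin> K \<longrightarrow> \<phi> x = 0))"
proof
  assume "\<phi> \<in> test_functions U"
  then show "smooth_on UNIV \<phi> \<and> (\<exists>K. compact K \<and> K \<subseteq> U \<and> (\<forall>x. x \<notin> K \<longrightarrow> \<phi> x = 0))"
    unfolding test_functions_def smooth_on_def continuously_differentiable_eq_Ck_on
    by (auto intro!: exI[of _ "closure {x. \<phi> x \<noteq> 0}"] closure_subset[THEN subsetD])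
next
  assume "smooth_on UNIV \<phi> \<and> (\<exists>K. compact K \<and> K \<subseteq> U \<and> (\<forall>x. x \<notin> K \<longrightarrow> \<phi> x = 0))"
  then obtain K where K: "smooth_on UNIV \<phi>" "compact K" "K \<subseteq> U" "\<And>x. x \<notin> K \<Longrightarrow> \<phi> x = 0" by blast
  have "closure {x. \<phi> x \<noteq> 0} \<subseteq> K"
    using K by (intro closure_minimal compact_imp_closed) auto
  moreover from this have "compact (closure {x. \<phi> x \<noteq> 0})"
    using K(2) by (metis closed_Int_compact closed_closure inf.absorb_iff1)
  ultimately show "\<phi> \<in> test_functions U"
    using K unfolding test_functions_def smooth_on_def continuously_differentiable_eq_Ck_on by blast
qed

lemma test_function_add:
  assumes "\<phi> \<in> test_functions U" "\<psi> \<in> test_functions U"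
  shows "\<phi> + \<psi> \<in> test_functions U"
proof -
  obtain K L where "smooth_on UNIV \<phi>" "compact K" "K \<subseteq> U" "\<forall>x. x \<notin> K \<longrightarrow> \<phi> x = 0"
    "smooth_on UNIV \<psi>" "compact L" "L \<subseteq> U" "\<forall>x. x \<notin> L \<longrightarrow> \<psi> x = 0"
    using assms unfolding test_functions_iff by blast
  then show ?thesis unfolding test_functions_iff plus_fun_def
    by (auto intro!: smooth_on_add exI[of _ "K \<union> L"])
qed

lemma test_function_mult:
  assumes "\<phi> \<in> test_functions U" "open S" "smooth_on S g" "U \<subseteq> S"
  shows "(\<lambda>x. g x * \<phi> x) \<in> test_functions U"
proof -
  obtain K where K: "smooth_on UNIV \<phi>" "compact K" "K \<subseteq> U" "\<forall>x. x \<notin> K \<longrightarrow> \<phi> x = 0"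
    using assms unfolding test_functions_iff by blast
  then show ?thesis unfolding test_functions_iff
    using smooth_on_mult_extend[OF assms(2) K(2) _ assms(3) K(1)] assms(4)
    by (auto intro!: exI[of _ K])
qed

lemma test_function_cscale: "\<phi> \<in> test_functions U \<Longrightarrow> cscale c \<phi> \<in> test_functions U"
  unfolding cscale_def by (rule test_function_mult[of _ _ UNIV]) (auto intro: smooth_on_const)

lemma test_function_diff:
  assumes "\<phi> \<in> test_functions U" "\<psi> \<in> test_functions U"
  shows "\<phi> - \<psi> \<in> test_functions U"
proof -
  have "\<phi> - \<psi> = \<phi> + cscale (-1) \<psi>" by (auto simp: cscale_def)
  then show ?thesis using test_function_add test_function_cscale assms by metis
qed

lemma test_function_0: "0 \<in> test_functions U"
  unfolding test_functions_iff zero_fun_def by (auto intro!: smooth_on_const exI[of _ "{}"])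

lemma test_function_sq_integrable:
  "\<phi> \<in> test_functions U \<Longrightarrow> open \<Omega> \<Longrightarrow> sq_integrable \<Omega> \<phi>"
  unfolding test_functions_iff
  using sq_integrable_continuous_compact_support smooth_on_continuous by blast

lemma test_function_has_derivative:
  "\<phi> \<in> test_functions U \<Longrightarrow> (\<phi> has_derivative frechet_derivative \<phi> (at x)) (at x)"
  unfolding test_functions_iff using smooth_on_has_derivative by blast

lemma test_function_derivative:
  assumes "\<phi> \<in> test_functions U"
  shows "(\<lambda>x. frechet_derivative \<phi> (at x) v) \<in> test_functions U"
proof -
  obtain K where K: "smooth_on UNIV \<phi>" "compact K" "K \<subseteq> U" "\<forall>x. x \<notin> K \<longrightarrow> \<phi> x = 0"
    using assms unfolding test_functions_iff by blast
  have "frechet_derivative \<phi> (at x) v = 0" if "x \<notin> K" for x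
    using frechet_derivative_eq_0_outside[OF K(2) _ that] K(4) by blast
  then show ?thesis unfolding test_functions_iff
    using K smooth_on_derivative by blast
qed

lemma AB_potential_nth:
  "AB_potential \<alpha> a x $ 1 = \<alpha> * (- (x$2 - a$2) / (norm (x - a))\<^sup>2)"
  "AB_potential \<alpha> a x $ 2 = \<alpha> * ((x$1 - a$1) / (norm (x - a))\<^sup>2)"
  by (simp_all add: AB_potential_def)

lemma smooth_on_AB_potential: "smooth_on (- {a}) (\<lambda>x. AB_potential \<alpha> a x $ k)"
proof -
  have o: "open (- {a})" by auto
  have s: "smooth_on (- {a}) (\<lambda>x. c * (x $ i - a $ i))" for c i
    by (intro smooth_on_mult smooth_on_diff smooth_on_const smooth_on_linear bounded_linear_vec_nth o)
  have n: "smooth_on (- {a}) (\<lambda>x. inverse ((norm (x - a))\<^sup>2))"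
    by (rule smooth_on_compose_real[OF o, of "- {0}"])
      (auto intro: smooth_on_inverse smooth_on_subset[OF smooth_on_norm_power2])
  have "AB_potential \<alpha> a x $ k = (if k = 1 then (- \<alpha>) * (x$2 - a$2) * inverse ((norm (x - a))\<^sup>2)
     else \<alpha> * (x$1 - a$1) * inverse ((norm (x - a))\<^sup>2))" for x
    using exhaust_2[of k] AB_potential_nth[of \<alpha> a x] by (auto simp: divide_inverse algebra_simps)
  then show ?thesis
    using smooth_on_mult[OF o s n, of "-\<alpha>" 2] smooth_on_mult[OF o s n, of "\<alpha>" 1]
    by (cases "k = 1") auto
qed

lemma test_function_magnetic_gradient:
  assumes "\<phi> \<in> test_functions (\<Omega> - {a})"
  shows "(\<lambda>x. magnetic_gradient \<alpha> a \<phi> x $ k) \<in> test_functions (\<Omega> - {a})"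
proof -
  have "cscale \<i> (\<lambda>x. frechet_derivative \<phi> (at x) (axis k 1)) \<in> test_functions (\<Omega> - {a})"
    by (intro test_function_cscale test_function_derivative assms)
  moreover have "(\<lambda>x. complex_of_real (AB_potential \<alpha> a x $ k) * \<phi> x) \<in> test_functions (\<Omega> - {a})"
  proof (rule test_function_mult[OF assms, of "- {a}"])
    show "smooth_on (- {a}) (\<lambda>x. complex_of_real (AB_potential \<alpha> a x $ k))"
      by (intro smooth_on_linear_compose[OF bounded_linear_of_real] smooth_on_AB_potential) auto
  qed auto
  ultimately have "cscale \<i> (\<lambda>x. frechet_derivative \<phi> (at x) (axis k 1)) +
     (\<lambda>x. complex_of_real (AB_potential \<alpha> a x $ k) * \<phi> x) \<in> test_functions (\<Omega> - {a})"
    by (rule test_function_add)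
  then show ?thesis by (simp add: magnetic_gradient_def cscale_def plus_fun_def)
qed

lemma magnetic_gradient_test_support:
  assumes "\<phi> \<in> test_functions (\<Omega> - {a})"
  obtains K where "compact K" "K \<subseteq> \<Omega> - {a}" "\<And>x. x \<notin> K \<Longrightarrow> \<phi> x = 0" "\<And>x. x \<notin> K \<Longrightarrow> magnetic_gradient \<alpha> a \<phi> x = 0"
    "continuous_on UNIV (magnetic_gradient \<alpha> a \<phi>)"
proof -
  obtain K1 where K1: "compact K1" "K1 \<subseteq> \<Omega> - {a}" "\<And>x. x \<notin> K1 \<Longrightarrow> magnetic_gradient \<alpha> a \<phi> x $ 1 = 0"
    using test_function_magnetic_gradient[OF assms, of \<alpha> 1] unfolding test_functions_iff by blast
  obtain K2 where K2: "compact K2" "K2 \<subseteq> \<Omega> - {a}" "\<And>x. x \<notin> K2 \<Longrightarrow> magnetic_gradient \<alpha> a \<phi> x $ 2 = 0"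
    using test_function_magnetic_gradient[OF assms, of \<alpha> 2] unfolding test_functions_iff by blast
  obtain K3 where K3: "compact K3" "K3 \<subseteq> \<Omega> - {a}" "\<And>x. x \<notin> K3 \<Longrightarrow> \<phi> x = 0"
    using assms unfolding test_functions_iff by blast
  have c: "continuous_on UNIV (\<lambda>x. magnetic_gradient \<alpha> a \<phi> x $ k)" for k
    using test_function_magnetic_gradient[OF assms, of \<alpha> k] unfolding test_functions_iff
    by (blast intro: smooth_on_continuous)
  show ?thesis
  proof
    show "compact (K1 \<union> K2 \<union> K3)" "K1 \<union> K2 \<union> K3 \<subseteq> \<Omega> - {a}" using K1 K2 K3 by auto
    show "magnetic_gradient \<alpha> a \<phi> x = 0" if "x \<notin> K1 \<union> K2 \<union> K3" for x
      using that K1(3) K2(3) by (simp add: vec_eq_iff forall_2)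
    show "continuous_on UNIV (magnetic_gradient \<alpha> a \<phi>)"
      using continuous_on_vec_lambda[of UNIV "\<lambda>k x. magnetic_gradient \<alpha> a \<phi> x $ k"] c by simp
  qed (use K3 in auto)
qed

lemma sq_integrable_magnetic_gradient:
  assumes "\<phi> \<in> test_functions (\<Omega> - {a})" "open \<Omega>"
  shows "sq_integrable \<Omega> (magnetic_gradient \<alpha> a \<phi>)"
  using magnetic_gradient_test_support[OF assms(1)] sq_integrable_continuous_compact_support[OF _ _ _ assms(2)]
  by metis

text \<open>
  Product rule and change of pole in one formula: the error is a multiple of \<open>\<phi>\<close> alone. It vanishes if \<open>g\<close>
  is a gauge transformation, and it is small if \<open>g\<close> is a cutoff with small gradient that removes a
  neighbourhood of both poles.
\<close>

lemma magnetic_gradient_mult: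
  assumes "(g has_derivative g') (at x)" "(\<phi> has_derivative \<phi>') (at x)"
  shows "magnetic_gradient \<alpha> b (\<lambda>x. g x * \<phi> x) x $ k =
     g x * magnetic_gradient \<alpha> a \<phi> x $ k +
     (\<i> * g' (axis k 1) + of_real (AB_potential \<alpha> b x $ k - AB_potential \<alpha> a x $ k) * g x) * \<phi> x"
proof -
  have 1: "frechet_derivative (\<lambda>x. g x * \<phi> x) (at x) = (\<lambda>v. g x * \<phi>' v + g' v * \<phi> x)"
    using frechet_derivative_at[OF has_derivative_mult[OF assms]] by simp
  have 2: "frechet_derivative \<phi> (at x) = \<phi>'"
    using frechet_derivative_at[OF assms(2)] by simp
  show ?thesis unfolding magnetic_gradient_def 1 2 by (simp add: algebra_simps)
qed

lemma magnetic_gradient_add: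
  assumes "\<phi> \<in> test_functions U" "\<psi> \<in> test_functions V"
  shows "magnetic_gradient \<alpha> a (\<phi> + \<psi>) = (\<lambda>x. magnetic_gradient \<alpha> a \<phi> x + magnetic_gradient \<alpha> a \<psi> x)"
proof
  fix x
  have "frechet_derivative (\<phi> + \<psi>) (at x) = (\<lambda>v. frechet_derivative \<phi> (at x) v + frechet_derivative \<psi> (at x) v)"
    using frechet_derivative_at[OF has_derivative_add[OF test_function_has_derivative[OF assms(1)] test_function_has_derivative[OF assms(2)]]]
    by (simp add: plus_fun_def)
  then show "magnetic_gradient \<alpha> a (\<phi> + \<psi>) x = magnetic_gradient \<alpha> a \<phi> x + magnetic_gradient \<alpha> a \<psi> x"
    by (simp add: magnetic_gradient_def vec_eq_iff algebra_simps)
qed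

lemma magnetic_gradient_cscale:
  assumes "\<phi> \<in> test_functions U"
  shows "magnetic_gradient \<alpha> a (cscale c \<phi>) x = (\<chi> k. c * magnetic_gradient \<alpha> a \<phi> x $ k)"
  using magnetic_gradient_mult[OF has_derivative_const[of c] test_function_has_derivative[OF assms],
      where \<alpha>=\<alpha> and b=a and a=a]
  by (simp add: vec_eq_iff cscale_def)

lemma norm_complex2_power2: "(norm (v::complex^2))\<^sup>2 = (norm (v$1))\<^sup>2 + (norm (v$2))\<^sup>2"
  by (simp add: norm_vec_def L2_set_def sum_2)

lemma magnetic_norm_cscale:
  assumes "\<phi> \<in> test_functions U"
  shows "magnetic_norm \<alpha> \<Omega> a (cscale c \<phi>) = norm c * magnetic_norm \<alpha> \<Omega> a \<phi>"
proof -
  have "norm (magnetic_gradient \<alpha> a (cscale c \<phi>) x) = norm c * norm (magnetic_gradient \<alpha> a \<phi> x)" for x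
    unfolding magnetic_gradient_cscale[OF assms]
    by (rule power2_eq_imp_eq)
      (auto simp: norm_complex2_power2 power_mult_distrib norm_mult algebra_simps)
  then have "magnetic_norm \<alpha> \<Omega> a (cscale c \<phi>) = L2_norm \<Omega> (\<lambda>x. norm c * norm (magnetic_gradient \<alpha> a \<phi> x))"
    unfolding magnetic_norm_def by (intro L2_norm_cong) simp
  then show ?thesis by (simp add: L2_norm_cmult L2_norm_norm magnetic_norm_def)
qed

lemma magnetic_norm_nonneg: "0 \<le> magnetic_norm \<alpha> \<Omega> a \<phi>"
  by (simp add: magnetic_norm_def L2_norm_nonneg)

lemma magnetic_norm_add:
  assumes "\<phi> \<in> test_functions (\<Omega> - {a})" "\<psi> \<in> test_functions (\<Omega> - {a})" "open \<Omega>"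
  shows "magnetic_norm \<alpha> \<Omega> a (\<phi> + \<psi>) \<le> magnetic_norm \<alpha> \<Omega> a \<phi> + magnetic_norm \<alpha> \<Omega> a \<psi>"
  unfolding magnetic_norm_def magnetic_gradient_add[OF assms(1,2)]
  using sq_integrable_add(2) sq_integrable_magnetic_gradient assms by blast

lemma magnetic_gradient_diff:
  assumes "\<phi> \<in> test_functions U" "\<psi> \<in> test_functions V"
  shows "magnetic_gradient \<alpha> a (\<phi> - \<psi>) = (\<lambda>x. magnetic_gradient \<alpha> a \<phi> x - magnetic_gradient \<alpha> a \<psi> x)"
proof -
  have e: "\<phi> - \<psi> = \<phi> + cscale (-1) \<psi>" by (auto simp: cscale_def)
  show ?thesis unfolding e magnetic_gradient_add[OF assms(1) test_function_cscale[OF assms(2)]]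
     magnetic_gradient_cscale[OF assms(2)]
    by (simp add: fun_eq_iff vec_eq_iff)
qed

lemma magnetic_norm_diff:
  assumes "\<phi> \<in> test_functions (\<Omega> - {a})" "\<psi> \<in> test_functions (\<Omega> - {a})" "open \<Omega>"
  shows "magnetic_norm \<alpha> \<Omega> a (\<phi> - \<psi>) \<le> magnetic_norm \<alpha> \<Omega> a \<phi> + magnetic_norm \<alpha> \<Omega> a \<psi>"
    and "\<bar>magnetic_norm \<alpha> \<Omega> a \<phi> - magnetic_norm \<alpha> \<Omega> a \<psi>\<bar> \<le> magnetic_norm \<alpha> \<Omega> a (\<phi> - \<psi>)"
  unfolding magnetic_norm_def magnetic_gradient_diff[OF assms(1,2)]
  using sq_integrable_diff(2) L2_norm_triangle_diff sq_integrable_magnetic_gradient assms by blast+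

section \<open>The completed space and its norm\<close>

text \<open>
  The difference of the two integrands is the partial derivative of \<open>F \<bullet> (\<i> * \<psi>)\<close>, a function with
  compact support.
\<close>

lemma magnetic_gradient_symmetric:
  assumes "F \<in> test_functions (\<Omega> - {a})" "\<psi> \<in> test_functions (\<Omega> - {a})" "open \<Omega>"
  shows "(\<integral>x. F x \<bullet> magnetic_gradient \<alpha> a \<psi> x $ k \<partial>lebesgue_on \<Omega>)
       = (\<integral>x. magnetic_gradient \<alpha> a F x $ k \<bullet> \<psi> x \<partial>lebesgue_on \<Omega>)"
proof -
  define h where "h x = F x \<bullet> (\<i> * \<psi> x)" for x
  obtain K where K: "smooth_on UNIV F" "compact K" "K \<subseteq> \<Omega> - {a}" "\<And>x. x \<notin> K \<Longrightarrow> F x = 0"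
    using assms unfolding test_functions_iff by blast
  have \<psi>: "smooth_on UNIV \<psi>" using assms unfolding test_functions_iff by blast
  note dF = test_function_has_derivative[OF assms(1)] and d\<psi> = test_function_has_derivative[OF assms(2)]
  have h: "Ck_on 1 UNIV h" unfolding h_def
    by (intro Ck_on_bilinear[OF bounded_bilinear_inner] smooth_onD[OF K(1)]
        smooth_onD[OF smooth_on_linear_compose[OF bounded_linear_mult_right _ \<psi>]] open_UNIV)
  have dh: "frechet_derivative h (at x) v = F x \<bullet> (\<i> * frechet_derivative \<psi> (at x) v) + frechet_derivative F (at x) v \<bullet> (\<i> * \<psi> x)" for x v
    using fun_cong[OF frechet_derivative_at[OF has_derivative_inner[OF dF has_derivative_mult[OF has_derivative_const d\<psi>]], of x \<i>], of v]
    unfolding h_def[abs_def] by simp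
  have eq: "F x \<bullet> magnetic_gradient \<alpha> a \<psi> x $ k - magnetic_gradient \<alpha> a F x $ k \<bullet> \<psi> x = frechet_derivative h (at x) (axis k 1)" for x
    unfolding dh by (simp add: magnetic_gradient_def inner_complex_def algebra_simps)
  have int: "integrable (lebesgue_on \<Omega>) (\<lambda>x. F x \<bullet> magnetic_gradient \<alpha> a \<psi> x $ k)"
    "integrable (lebesgue_on \<Omega>) (\<lambda>x. magnetic_gradient \<alpha> a F x $ k \<bullet> \<psi> x)"
    by (rule sq_integrable_inner(1)[OF test_function_sq_integrable[OF _ assms(3)] test_function_sq_integrable[OF _ assms(3)]];
        (rule assms(1,2) | rule test_function_magnetic_gradient[OF assms(1)] test_function_magnetic_gradient[OF assms(2)]))+
  have "(\<integral>x. F x \<bullet> magnetic_gradient \<alpha> a \<psi> x $ k \<partial>lebesgue_on \<Omega>) - (\<integral>x. magnetic_gradient \<alpha> a F x $ k \<bullet> \<psi> x \<partial>lebesgue_on \<Omega>)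
     = (\<integral>x. frechet_derivative h (at x) (axis k 1) \<partial>lebesgue_on \<Omega>)"
    unfolding Bochner_Integration.integral_diff[OF int, symmetric] eq ..
  also have "\<dots> = (\<integral>x. frechet_derivative h (at x) (axis k 1) \<partial>lborel)"
  proof (rule integral_lebesgue_on_eq_lborel)
    show "(\<lambda>x. frechet_derivative h (at x) (axis k 1)) \<in> borel_measurable borel"
      using h by (intro borel_measurable_continuous_onI) simp
    show "frechet_derivative h (at x) (axis k 1) = 0" if "x \<notin> \<Omega>" for x
    proof -
      have "F x = 0" "frechet_derivative F (at x) (axis k 1) = 0"
      proof -
        show "F x = 0" using that K by blast
        obtain K' where "K' \<subseteq> \<Omega> - {a}" "\<And>x. x \<notin> K' \<Longrightarrow> frechet_derivative F (at x) (axis k 1) = 0"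
          using test_function_derivative[OF assms(1), of "axis k 1"] unfolding test_functions_iff by blast
        then show "frechet_derivative F (at x) (axis k 1) = 0" using that by blast
      qed
      then show ?thesis by (simp add: dh)
    qed
  qed fact
  also have "\<dots> = 0"
    by (rule integral_derivative_compact_support[OF h K(2)]) (simp add: h_def K(4))
  finally show ?thesis by simp
qed

text \<open>
  The components of the magnetic gradient of \<open>\<phi>\<close> are test functions themselves, so a second derivative can
  be moved onto \<open>\<phi>\<close>; what remains is continuous in the \<open>L\<^sup>2\<close> norm of \<open>\<psi>\<close>.
\<close>

lemma inner_magnetic_gradient_bound:
  assumes "\<phi> \<in> test_functions (\<Omega> - {a})" "open \<Omega>"
  obtains C where "\<And>\<psi>. \<psi> \<in> test_functions (\<Omega> - {a}) \<Longrightarrow>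
    (\<integral>x. magnetic_gradient \<alpha> a \<phi> x \<bullet> magnetic_gradient \<alpha> a \<psi> x \<partial>lebesgue_on \<Omega>) \<le> C * L2_norm \<Omega> \<psi>"
proof -
  define F where "F k x = magnetic_gradient \<alpha> a \<phi> x $ k" for k x
  have F: "F k \<in> test_functions (\<Omega> - {a})" for k
    unfolding F_def by (rule test_function_magnetic_gradient[OF assms(1)])
  define G where "G k x = magnetic_gradient \<alpha> a (F k) x $ k" for k x
  have G: "sq_integrable \<Omega> (G k)" for k
    unfolding G_def by (rule test_function_sq_integrable[OF test_function_magnetic_gradient[OF F] assms(2)])
  show thesis
  proof (rule that)
    fix \<psi> assume \<psi>: "\<psi> \<in> test_functions (\<Omega> - {a})"
    have i: "integrable (lebesgue_on \<Omega>) (\<lambda>x. F k x \<bullet> magnetic_gradient \<alpha> a \<psi> x $ k)" for k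
      by (intro sq_integrable_inner(1) test_function_sq_integrable[OF F assms(2)]
          test_function_sq_integrable[OF test_function_magnetic_gradient[OF \<psi>] assms(2)])
    have b: "(\<integral>x. F k x \<bullet> magnetic_gradient \<alpha> a \<psi> x $ k \<partial>lebesgue_on \<Omega>) \<le> L2_norm \<Omega> (G k) * L2_norm \<Omega> \<psi>" for k
      unfolding magnetic_gradient_symmetric[OF F \<psi> assms(2)]
      using sq_integrable_inner(2)[OF G[of k] test_function_sq_integrable[OF \<psi> assms(2)]]
      unfolding G_def by linarith
    have "(\<integral>x. magnetic_gradient \<alpha> a \<phi> x \<bullet> magnetic_gradient \<alpha> a \<psi> x \<partial>lebesgue_on \<Omega>)
        = (\<integral>x. F 1 x \<bullet> magnetic_gradient \<alpha> a \<psi> x $ 1 + F 2 x \<bullet> magnetic_gradient \<alpha> a \<psi> x $ 2 \<partial>lebesgue_on \<Omega>)"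
      by (simp add: inner_vec_def sum_2 F_def)
    also have "\<dots> = (\<integral>x. F 1 x \<bullet> magnetic_gradient \<alpha> a \<psi> x $ 1 \<partial>lebesgue_on \<Omega>) + (\<integral>x. F 2 x \<bullet> magnetic_gradient \<alpha> a \<psi> x $ 2 \<partial>lebesgue_on \<Omega>)"
      by (rule Bochner_Integration.integral_add[OF i i])
    also have "\<dots> \<le> (L2_norm \<Omega> (G 1) + L2_norm \<Omega> (G 2)) * L2_norm \<Omega> \<psi>"
      using b[of 1] b[of 2] by (simp add: algebra_simps)
    finally show "(\<integral>x. magnetic_gradient \<alpha> a \<phi> x \<bullet> magnetic_gradient \<alpha> a \<psi> x \<partial>lebesgue_on \<Omega>)
      \<le> (L2_norm \<Omega> (G 1) + L2_norm \<Omega> (G 2)) * L2_norm \<Omega> \<psi>" .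
  qed
qed

text \<open>
  Write \<open>D\<close> for the magnetic gradient. In
  \<open>\<parallel>D \<psi>\<^sub>n\<parallel>\<^sup>2 = \<langle>D \<psi>\<^sub>n, D \<psi>\<^sub>n - D \<psi>\<^sub>m\<rangle> + \<langle>D \<psi>\<^sub>n, D \<psi>\<^sub>m\<rangle>\<close> the first term is small by the Cauchy property, and
  for fixed \<open>n\<close> the second one tends to zero as \<open>m\<close> grows, by integration by parts.
\<close>

lemma magnetic_norm_closable:
  assumes "open \<Omega>" "\<And>n. \<psi> n \<in> test_functions (\<Omega> - {a})"
    and cauchy: "\<And>e. e > 0 \<Longrightarrow> \<exists>N. \<forall>m\<ge>N. \<forall>n\<ge>N. magnetic_norm \<alpha> \<Omega> a (\<psi> m - \<psi> n) < e"
    and null: "(\<lambda>n. L2_norm \<Omega> (\<psi> n)) \<longlonglongrightarrow> 0"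
  shows "(\<lambda>n. magnetic_norm \<alpha> \<Omega> a (\<psi> n)) \<longlonglongrightarrow> 0"
proof (rule LIMSEQ_I)
  fix e :: real assume "e > 0"
  then obtain N where N: "\<And>m n. m \<ge> N \<Longrightarrow> n \<ge> N \<Longrightarrow> magnetic_norm \<alpha> \<Omega> a (\<psi> m - \<psi> n) < e / 2"
    using cauchy[of "e / 2"] by auto
  have "magnetic_norm \<alpha> \<Omega> a (\<psi> n) < e" if n: "n \<ge> N" for n
  proof -
    let ?D = "\<lambda>n. magnetic_gradient \<alpha> a (\<psi> n)"
    let ?r = "magnetic_norm \<alpha> \<Omega> a (\<psi> n)"
    have sq: "sq_integrable \<Omega> (?D n)" for n
      by (rule sq_integrable_magnetic_gradient[OF assms(2,1)])
    obtain C where C: "\<And>\<psi>'. \<psi>' \<in> test_functions (\<Omega> - {a}) \<Longrightarrow>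
      (\<integral>x. ?D n x \<bullet> magnetic_gradient \<alpha> a \<psi>' x \<partial>lebesgue_on \<Omega>) \<le> C * L2_norm \<Omega> \<psi>'"
      using inner_magnetic_gradient_bound[OF assms(2,1), where \<alpha>=\<alpha>] by blast
    have bound: "?r\<^sup>2 \<le> ?r * (e / 2) + C * L2_norm \<Omega> (\<psi> m)" if m: "m \<ge> N" for m
    proof -
      have "?r\<^sup>2 = (\<integral>x. ?D n x \<bullet> (?D n x - ?D m x) + ?D n x \<bullet> ?D m x \<partial>lebesgue_on \<Omega>)"
        by (simp add: magnetic_norm_def L2_norm_power2 power2_norm_eq_inner inner_diff_right)
      also have "\<dots> = (\<integral>x. ?D n x \<bullet> (?D n x - ?D m x) \<partial>lebesgue_on \<Omega>) + (\<integral>x. ?D n x \<bullet> ?D m x \<partial>lebesgue_on \<Omega>)"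
        by (intro Bochner_Integration.integral_add sq_integrable_inner sq_integrable_diff sq)
      also have "\<dots> \<le> ?r * magnetic_norm \<alpha> \<Omega> a (\<psi> n - \<psi> m) + C * L2_norm \<Omega> (\<psi> m)"
        using C[OF assms(2)[of m]] sq_integrable_inner(2)[OF sq[of n] sq_integrable_diff(1)[OF sq[of n] sq[of m]]]
        unfolding magnetic_norm_def magnetic_gradient_diff[OF assms(2) assms(2)] by linarith
      also have "\<dots> \<le> ?r * (e / 2) + C * L2_norm \<Omega> (\<psi> m)"
        using N[OF n m] magnetic_norm_nonneg[of \<alpha> \<Omega> a "\<psi> n"] by (intro add_right_mono mult_left_mono) auto
      finally show ?thesis .
    qed
    have "(\<lambda>m. ?r * (e / 2) + C * L2_norm \<Omega> (\<psi> m)) \<longlonglongrightarrow> ?r * (e / 2) + C * 0"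
      by (intro tendsto_intros null)
    then have "?r\<^sup>2 \<le> ?r * (e / 2) + C * 0"
      by (rule LIMSEQ_le_const) (use bound in auto)
    then have "?r \<le> e / 2" using magnetic_norm_nonneg[of \<alpha> \<Omega> a "\<psi> n"] \<open>e > 0\<close>
      by (cases "?r = 0") (auto simp: power2_eq_square)
    then show ?thesis using \<open>e > 0\<close> by simp
  qed
  then show "\<exists>N. \<forall>n\<ge>N. norm (magnetic_norm \<alpha> \<Omega> a (\<psi> n) - 0) < e"
    by (auto simp: magnetic_norm_nonneg)
qed

lemma L2_norm_tendsto_0_le:
  assumes "c \<longlonglongrightarrow> 0" "\<And>n. L2_norm \<Omega> (F n) \<le> c n"
  shows "(\<lambda>n. L2_norm \<Omega> (F n)) \<longlonglongrightarrow> 0"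
  by (rule tendsto_sandwich[OF _ _ tendsto_const assms(1)]) (use assms(2) in \<open>auto simp: L2_norm_nonneg\<close>)

lemma completion_sequenceD:
  assumes "completion_sequence \<alpha> \<Omega> a \<phi> u"
  shows "\<phi> n \<in> test_functions (\<Omega> - {a})"
    and "e > 0 \<Longrightarrow> \<exists>N. \<forall>m\<ge>N. \<forall>n\<ge>N. magnetic_norm \<alpha> \<Omega> a (\<phi> m - \<phi> n) < e"
    and "(\<lambda>n. L2_norm \<Omega> (\<phi> n - u)) \<longlonglongrightarrow> 0"
  using assms by (simp_all add: completion_sequence_def)

lemma completion_sequence_add:
  assumes "completion_sequence \<alpha> \<Omega> a \<phi> u" "completion_sequence \<alpha> \<Omega> a \<psi> v"
    and u: "sq_integrable \<Omega> u" and v: "sq_integrable \<Omega> v" and op: "open \<Omega>"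
  shows "completion_sequence \<alpha> \<Omega> a (\<lambda>n. \<phi> n + \<psi> n) (u + v)"
  unfolding completion_sequence_def
proof (intro conjI allI impI)
  note t = completion_sequenceD[OF assms(1)] and t' = completion_sequenceD[OF assms(2)]
  show "\<phi> n + \<psi> n \<in> test_functions (\<Omega> - {a})" for n
    by (intro test_function_add t(1) t'(1))
  fix e :: real assume "e > 0"
  then have "e / 2 > 0" by simp
  then obtain N1 N2 where N: "\<And>m n. m \<ge> N1 \<Longrightarrow> n \<ge> N1 \<Longrightarrow> magnetic_norm \<alpha> \<Omega> a (\<phi> m - \<phi> n) < e / 2"
      "\<And>m n. m \<ge> N2 \<Longrightarrow> n \<ge> N2 \<Longrightarrow> magnetic_norm \<alpha> \<Omega> a (\<psi> m - \<psi> n) < e / 2"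
    using t(2)[of "e / 2"] t'(2)[of "e / 2"] by blast
  have "magnetic_norm \<alpha> \<Omega> a (\<phi> m + \<psi> m - (\<phi> n + \<psi> n)) < e" if "m \<ge> max N1 N2" "n \<ge> max N1 N2" for m n
  proof -
    have e: "\<phi> m + \<psi> m - (\<phi> n + \<psi> n) = (\<phi> m - \<phi> n) + (\<psi> m - \<psi> n)" by (simp add: fun_eq_iff)
    show ?thesis unfolding e
      using magnetic_norm_add[OF test_function_diff[OF t(1) t(1)] test_function_diff[OF t'(1) t'(1)] op, of \<alpha> m n m n]
        N(1)[of m n] N(2)[of m n] that by auto
  qed
  then show "\<exists>N. \<forall>m\<ge>N. \<forall>n\<ge>N. magnetic_norm \<alpha> \<Omega> a (\<phi> m + \<psi> m - (\<phi> n + \<psi> n)) < e" by blast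
next
  note t = completion_sequenceD[OF assms(1)] and t' = completion_sequenceD[OF assms(2)]
  have b: "L2_norm \<Omega> (\<phi> n + \<psi> n - (u + v)) \<le> L2_norm \<Omega> (\<phi> n - u) + L2_norm \<Omega> (\<psi> n - v)" for n
    using sq_integrable_add(2)[OF sq_integrable_diff(1)[OF test_function_sq_integrable[OF t(1) op] u]
        sq_integrable_diff(1)[OF test_function_sq_integrable[OF t'(1) op] v], of n n]
    by (simp add: fun_diff_def plus_fun_def algebra_simps)
  have "(\<lambda>n. L2_norm \<Omega> (\<phi> n - u) + L2_norm \<Omega> (\<psi> n - v)) \<longlonglongrightarrow> 0"
    using tendsto_add[OF t(3) t'(3)] by simp
  then show "(\<lambda>n. L2_norm \<Omega> (\<phi> n + \<psi> n - (u + v))) \<longlonglongrightarrow> 0"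
    using b by (rule L2_norm_tendsto_0_le)
qed

lemma completion_sequence_cscale:
  assumes "completion_sequence \<alpha> \<Omega> a \<phi> u"
  shows "completion_sequence \<alpha> \<Omega> a (\<lambda>n. cscale c (\<phi> n)) (cscale c u)"
proof -
  note t = completion_sequenceD[OF assms]
  have d: "cscale c f - cscale c g = cscale c (f - g)" for f g :: "real^2 \<Rightarrow> complex"
    by (simp add: fun_eq_iff cscale_def algebra_simps)
  show ?thesis
    unfolding completion_sequence_def d
  proof (intro conjI allI impI)
    fix e :: real assume "e > 0"
    then have "e / (norm c + 1) > 0" by (simp add: add_nonneg_pos)
    then obtain N where N: "\<And>m n. m \<ge> N \<Longrightarrow> n \<ge> N \<Longrightarrow> magnetic_norm \<alpha> \<Omega> a (\<phi> m - \<phi> n) < e / (norm c + 1)"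
      using t(2) by blast
    have "magnetic_norm \<alpha> \<Omega> a (cscale c (\<phi> m - \<phi> n)) < e" if "m \<ge> N" "n \<ge> N" for m n
    proof -
      have "norm c * magnetic_norm \<alpha> \<Omega> a (\<phi> m - \<phi> n) \<le> (norm c + 1) * magnetic_norm \<alpha> \<Omega> a (\<phi> m - \<phi> n)"
        by (simp add: magnetic_norm_nonneg algebra_simps)
      also have "\<dots> < e" using N[OF that] by (simp add: pos_less_divide_eq add_nonneg_pos mult.commute)
      finally show ?thesis by (simp add: magnetic_norm_cscale[OF test_function_diff[OF t(1) t(1)]])
    qed
    then show "\<exists>N. \<forall>m\<ge>N. \<forall>n\<ge>N. magnetic_norm \<alpha> \<Omega> a (cscale c (\<phi> m - \<phi> n)) < e" by blast
  next
    have "L2_norm \<Omega> (cscale c f) = norm c * L2_norm \<Omega> f" for f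
      by (simp add: cscale_def L2_norm_cmult)
    then show "(\<lambda>n. L2_norm \<Omega> (cscale c (\<phi> n - u))) \<longlonglongrightarrow> 0"
      using tendsto_mult_right_zero[OF t(3)] by simp
  qed (intro test_function_cscale t(1))
qed

text \<open>
  The definite description in the norm denotes something because the limit is the same for all sequences
  that represent \<open>u\<close>: the difference of two of them represents zero, and the form is closable.
\<close>

lemma completion_sequence_H1_norm:
  assumes "open \<Omega>" "completion_sequence \<alpha> \<Omega> a \<phi> u" "u \<in> L2_functions \<Omega>"
  shows "(\<lambda>n. magnetic_norm \<alpha> \<Omega> a (\<phi> n)) \<longlonglongrightarrow> H1_magnetic_norm \<alpha> \<Omega> a u"
proof -
  note t = completion_sequenceD[OF assms(2)]
  note test = t(1)
  have u: "sq_integrable \<Omega> u" using assms(3) by (simp add: L2_functions_eq)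
  have "Cauchy (\<lambda>n. magnetic_norm \<alpha> \<Omega> a (\<phi> n))"
  proof (rule metric_CauchyI)
    fix e :: real assume "e > 0"
    then obtain N where N: "\<And>m n. m \<ge> N \<Longrightarrow> n \<ge> N \<Longrightarrow> magnetic_norm \<alpha> \<Omega> a (\<phi> m - \<phi> n) < e"
      using t(2) by blast
    have "dist (magnetic_norm \<alpha> \<Omega> a (\<phi> m)) (magnetic_norm \<alpha> \<Omega> a (\<phi> n)) < e" if "m \<ge> N" "n \<ge> N" for m n
      using magnetic_norm_diff(2)[OF test test assms(1), of \<alpha> m n] N[OF that] by (simp add: dist_real_def)
    then show "\<exists>N. \<forall>m\<ge>N. \<forall>n\<ge>N. dist (magnetic_norm \<alpha> \<Omega> a (\<phi> m)) (magnetic_norm \<alpha> \<Omega> a (\<phi> n)) < e" by blast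
  qed
  then obtain r where r: "(\<lambda>n. magnetic_norm \<alpha> \<Omega> a (\<phi> n)) \<longlonglongrightarrow> r"
    using real_Cauchy_convergent convergent_def by blast
  have "s = r" if \<psi>: "completion_sequence \<alpha> \<Omega> a \<psi> u" and s: "(\<lambda>n. magnetic_norm \<alpha> \<Omega> a (\<psi> n)) \<longlonglongrightarrow> s" for \<psi> s
  proof -
    have eq: "\<phi> n + cscale (- 1) (\<psi> n) = \<phi> n - \<psi> n" "u + cscale (- 1) u = 0" for n
      by (simp_all add: fun_eq_iff cscale_def)
    have "sq_integrable \<Omega> (cscale (- 1) u)" unfolding cscale_def by (rule sq_integrable_cmult[OF u])
    from completion_sequence_add[OF assms(2) completion_sequence_cscale[OF \<psi>] u this assms(1)]
    have diff: "completion_sequence \<alpha> \<Omega> a (\<lambda>n. \<phi> n - \<psi> n) 0" unfolding eq .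
    have "(\<lambda>n. magnetic_norm \<alpha> \<Omega> a (\<phi> n - \<psi> n)) \<longlonglongrightarrow> 0"
      using completion_sequenceD(3)[OF diff]
      by (intro magnetic_norm_closable[OF assms(1) completion_sequenceD(1)[OF diff] completion_sequenceD(2)[OF diff]]) simp_all
    moreover have "(\<lambda>n. \<bar>magnetic_norm \<alpha> \<Omega> a (\<phi> n) - magnetic_norm \<alpha> \<Omega> a (\<psi> n)\<bar>) \<longlonglongrightarrow> \<bar>r - s\<bar>"
      by (intro tendsto_intros r s)
    moreover have "\<bar>magnetic_norm \<alpha> \<Omega> a (\<phi> n) - magnetic_norm \<alpha> \<Omega> a (\<psi> n)\<bar> \<le> magnetic_norm \<alpha> \<Omega> a (\<phi> n - \<psi> n)" for n
      by (rule magnetic_norm_diff(2)[OF test completion_sequenceD(1)[OF \<psi>] assms(1)])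
    ultimately have "\<bar>r - s\<bar> \<le> 0" by (intro LIMSEQ_le) auto
    then show ?thesis by simp
  qed
  then have "H1_magnetic_norm \<alpha> \<Omega> a u = r"
    unfolding H1_magnetic_norm_def using assms(2) r by (intro the_equality) blast+
  then show ?thesis using r by simp
qed

lemma H1_magneticE:
  assumes "u \<in> H1_magnetic \<alpha> \<Omega> a" "open \<Omega>"
  obtains \<phi> where "\<And>n. \<phi> n \<in> test_functions (\<Omega> - {a})" "completion_sequence \<alpha> \<Omega> a \<phi> u"
    "sq_integrable \<Omega> u" "(\<lambda>n. magnetic_norm \<alpha> \<Omega> a (\<phi> n)) \<longlonglongrightarrow> H1_magnetic_norm \<alpha> \<Omega> a u"
    "(\<lambda>n. L2_norm \<Omega> (\<phi> n)) \<longlonglongrightarrow> L2_norm \<Omega> u"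
proof -
  obtain \<phi> where \<phi>: "completion_sequence \<alpha> \<Omega> a \<phi> u" and u: "u \<in> L2_functions \<Omega>"
    using assms by (auto simp: H1_magnetic_def)
  have test: "\<phi> n \<in> test_functions (\<Omega> - {a})" for n using \<phi> by (auto simp: completion_sequence_def)
  have sq: "sq_integrable \<Omega> u" using u by (simp add: L2_functions_eq)
  have "(\<lambda>n. L2_norm \<Omega> (\<phi> n) - L2_norm \<Omega> u) \<longlonglongrightarrow> 0"
  proof (rule Lim_null_comparison)
    show "\<forall>\<^sub>F n in sequentially. norm (L2_norm \<Omega> (\<phi> n) - L2_norm \<Omega> u) \<le> L2_norm \<Omega> (\<phi> n - u)"
      using L2_norm_triangle_diff[OF test_function_sq_integrable[OF test assms(2)] sq]
      by (simp add: fun_diff_def)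
  qed (rule completion_sequenceD(3)[OF \<phi>])
  then have "(\<lambda>n. L2_norm \<Omega> (\<phi> n)) \<longlonglongrightarrow> L2_norm \<Omega> u" by (simp add: LIM_zero_iff)
  then show thesis using that test \<phi> sq completion_sequence_H1_norm[OF assms(2) \<phi> u] by blast
qed

lemma H1_magnetic_add:
  assumes "u \<in> H1_magnetic \<alpha> \<Omega> a" "v \<in> H1_magnetic \<alpha> \<Omega> a" "open \<Omega>"
  shows "H1_magnetic_norm \<alpha> \<Omega> a (u + v) \<le> H1_magnetic_norm \<alpha> \<Omega> a u + H1_magnetic_norm \<alpha> \<Omega> a v"
proof -
  from H1_magneticE[OF assms(1,3)] obtain \<phi> where \<phi>: "\<And>n. \<phi> n \<in> test_functions (\<Omega> - {a})" "completion_sequence \<alpha> \<Omega> a \<phi> u"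
    "sq_integrable \<Omega> u" "(\<lambda>n. magnetic_norm \<alpha> \<Omega> a (\<phi> n)) \<longlonglongrightarrow> H1_magnetic_norm \<alpha> \<Omega> a u" by blast
  from H1_magneticE[OF assms(2,3)] obtain \<psi> where \<psi>: "\<And>n. \<psi> n \<in> test_functions (\<Omega> - {a})" "completion_sequence \<alpha> \<Omega> a \<psi> v"
    "sq_integrable \<Omega> v" "(\<lambda>n. magnetic_norm \<alpha> \<Omega> a (\<psi> n)) \<longlonglongrightarrow> H1_magnetic_norm \<alpha> \<Omega> a v" by blast
  have "u + v \<in> L2_functions \<Omega>"
    using sq_integrable_add(1)[OF \<phi>(3) \<psi>(3)] by (simp add: L2_functions_eq plus_fun_def)
  then have "(\<lambda>n. magnetic_norm \<alpha> \<Omega> a (\<phi> n + \<psi> n)) \<longlonglongrightarrow> H1_magnetic_norm \<alpha> \<Omega> a (u + v)"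
    by (rule completion_sequence_H1_norm[OF assms(3) completion_sequence_add[OF \<phi>(2) \<psi>(2) \<phi>(3) \<psi>(3) assms(3)]])
  then show ?thesis
    using tendsto_add[OF \<phi>(4) \<psi>(4)] magnetic_norm_add[OF \<phi>(1) \<psi>(1) assms(3)]
    by (intro LIMSEQ_le) auto
qed

lemma H1_magnetic_cscale:
  assumes "u \<in> H1_magnetic \<alpha> \<Omega> a" "open \<Omega>"
  shows "H1_magnetic_norm \<alpha> \<Omega> a (cscale c u) = norm c * H1_magnetic_norm \<alpha> \<Omega> a u"
proof -
  from H1_magneticE[OF assms] obtain \<phi> where \<phi>: "\<And>n. \<phi> n \<in> test_functions (\<Omega> - {a})" "completion_sequence \<alpha> \<Omega> a \<phi> u"
    "sq_integrable \<Omega> u" "(\<lambda>n. magnetic_norm \<alpha> \<Omega> a (\<phi> n)) \<longlonglongrightarrow> H1_magnetic_norm \<alpha> \<Omega> a u" by blast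
  have "cscale c u \<in> L2_functions \<Omega>"
    using sq_integrable_cmult[OF \<phi>(3)] by (simp add: L2_functions_eq cscale_def)
  then have "(\<lambda>n. magnetic_norm \<alpha> \<Omega> a (cscale c (\<phi> n))) \<longlonglongrightarrow> H1_magnetic_norm \<alpha> \<Omega> a (cscale c u)"
    by (rule completion_sequence_H1_norm[OF assms(2) completion_sequence_cscale[OF \<phi>(2)]])
  moreover have "(\<lambda>n. magnetic_norm \<alpha> \<Omega> a (cscale c (\<phi> n))) \<longlonglongrightarrow> norm c * H1_magnetic_norm \<alpha> \<Omega> a u"
    unfolding magnetic_norm_cscale[OF \<phi>(1)] by (intro tendsto_intros \<phi>)
  ultimately show ?thesis by (rule LIMSEQ_unique)
qed

text \<open>
  Multiplication by \<open>g\<close> carries the form with pole \<open>a\<close> to the form with pole \<open>b\<close>, up to errors of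
  relative size \<open>d\<close>. Only norms that are continuous along completion sequences occur in the estimates, and the
  conditions on \<open>g\<close> itself make the multiplication a contraction of \<open>L\<^sup>2\<close>; so everything extends from test
  functions to the completed space.
\<close>

definition transplants ::
  "real \<Rightarrow> (real^2) set \<Rightarrow> real \<Rightarrow> (real^2 \<Rightarrow> complex) \<Rightarrow> real^2 \<Rightarrow> real^2 \<Rightarrow> bool" where
  "transplants \<alpha> \<Omega> d g a b \<longleftrightarrow>
     continuous_on \<Omega> g \<and> (\<forall>x\<in>\<Omega>. norm (g x) \<le> 1) \<and>
     (\<forall>\<phi>\<in>test_functions (\<Omega> - {a}).
        (\<lambda>x. g x * \<phi> x) \<in> test_functions (\<Omega> - {b}) \<and>
        magnetic_norm \<alpha> \<Omega> b (\<lambda>x. g x * \<phi> x) \<le> (1 + d) * magnetic_norm \<alpha> \<Omega> a \<phi> + d * L2_norm \<Omega> \<phi> \<and>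
        L2_norm \<Omega> \<phi> \<le> L2_norm \<Omega> (\<lambda>x. g x * \<phi> x) + d * magnetic_norm \<alpha> \<Omega> a \<phi>)"

lemma transplants_H1:
  assumes "transplants \<alpha> \<Omega> d g a b" "d \<ge> 0" "open \<Omega>" "u \<in> H1_magnetic \<alpha> \<Omega> a"
  shows "(\<lambda>x. g x * u x) \<in> H1_magnetic \<alpha> \<Omega> b"
    and "H1_magnetic_norm \<alpha> \<Omega> b (\<lambda>x. g x * u x) \<le> (1 + d) * H1_magnetic_norm \<alpha> \<Omega> a u + d * L2_norm \<Omega> u"
    and "L2_norm \<Omega> u \<le> L2_norm \<Omega> (\<lambda>x. g x * u x) + d * H1_magnetic_norm \<alpha> \<Omega> a u"
proof -
  have g: "continuous_on \<Omega> g" "\<And>x. x \<in> \<Omega> \<Longrightarrow> norm (g x) \<le> 1"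
    and tr: "\<And>\<phi>. \<phi> \<in> test_functions (\<Omega> - {a}) \<Longrightarrow> (\<lambda>x. g x * \<phi> x) \<in> test_functions (\<Omega> - {b})"
    "\<And>\<phi>. \<phi> \<in> test_functions (\<Omega> - {a}) \<Longrightarrow> magnetic_norm \<alpha> \<Omega> b (\<lambda>x. g x * \<phi> x) \<le> (1 + d) * magnetic_norm \<alpha> \<Omega> a \<phi> + d * L2_norm \<Omega> \<phi>"
    "\<And>\<phi>. \<phi> \<in> test_functions (\<Omega> - {a}) \<Longrightarrow> L2_norm \<Omega> \<phi> \<le> L2_norm \<Omega> (\<lambda>x. g x * \<phi> x) + d * magnetic_norm \<alpha> \<Omega> a \<phi>"
    using assms(1) unfolding transplants_def by blast+
  from H1_magneticE[OF assms(4,3)] obtain \<phi> where \<phi>: "\<And>n. \<phi> n \<in> test_functions (\<Omega> - {a})" "completion_sequence \<alpha> \<Omega> a \<phi> u"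
    "sq_integrable \<Omega> u" "(\<lambda>n. magnetic_norm \<alpha> \<Omega> a (\<phi> n)) \<longlonglongrightarrow> H1_magnetic_norm \<alpha> \<Omega> a u"
    "(\<lambda>n. L2_norm \<Omega> (\<phi> n)) \<longlonglongrightarrow> L2_norm \<Omega> u" by blast
  note t = completion_sequenceD[OF \<phi>(2)]
  define T where "T v x = g x * v x" for v x
  have gm: "g \<in> borel_measurable (lebesgue_on \<Omega>)"
    using g(1) assms(3) by (intro continuous_imp_measurable_on_sets_lebesgue) auto
  have Tsq: "sq_integrable \<Omega> (T v)" if "sq_integrable \<Omega> v" for v
    using that gm g(2) by (intro sq_integrable_bound[OF that, of _ 1])
      (auto simp: T_def[abs_def] sq_integrable_def norm_mult intro!: mult_left_le_one_le)
  have Tle: "L2_norm \<Omega> (T v) \<le> L2_norm \<Omega> v" if "sq_integrable \<Omega> v" for v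
    using g(2) by (intro L2_norm_mono[OF that]) (auto simp: T_def norm_mult intro!: mult_left_le_one_le)
  have Tdiff: "T v - T w = T (v - w)" for v w by (simp add: T_def fun_eq_iff algebra_simps)
  have sqd: "sq_integrable \<Omega> (\<phi> n - u)" for n
    using sq_integrable_diff(1)[OF test_function_sq_integrable[OF \<phi>(1) assms(3)] \<phi>(3)] by (simp add: fun_diff_def)
  have comp: "completion_sequence \<alpha> \<Omega> b (\<lambda>n. T (\<phi> n)) (T u)"
    unfolding completion_sequence_def Tdiff
  proof (intro conjI allI impI)
    show "T (\<phi> n) \<in> test_functions (\<Omega> - {b})" for n
      using tr(1)[OF \<phi>(1)] by (simp add: T_def[abs_def])
    have "L2_norm \<Omega> (T (\<phi> n - u)) \<le> L2_norm \<Omega> (\<phi> n - u)" for n by (rule Tle[OF sqd])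
    then show "(\<lambda>n. L2_norm \<Omega> (T (\<phi> n - u))) \<longlonglongrightarrow> 0"
      by (rule L2_norm_tendsto_0_le[OF t(3)])
    fix e :: real assume "e > 0"
    \<comment> \<open>The form contributes less than \<open>(1 + d) * e'\<close>, and the \<open>L\<^sup>2\<close> norm at most \<open>2 * d * e'\<close>.\<close>
    define e' where "e' = e / (2 * (1 + d) + 2 * d)"
    have "e' > 0" using \<open>e > 0\<close> assms(2) by (simp add: e'_def add_pos_nonneg)
    then obtain N1 N2 where N: "\<And>m n. m \<ge> N1 \<Longrightarrow> n \<ge> N1 \<Longrightarrow> magnetic_norm \<alpha> \<Omega> a (\<phi> m - \<phi> n) < e'"
       "\<And>n. n \<ge> N2 \<Longrightarrow> L2_norm \<Omega> (\<phi> n - u) < e'"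
      using t(2)[of e'] order_tendstoD(2)[OF t(3), of e']
      unfolding eventually_sequentially by blast
    have "magnetic_norm \<alpha> \<Omega> b (T (\<phi> m - \<phi> n)) < e" if "m \<ge> max N1 N2" "n \<ge> max N1 N2" for m n
    proof -
      have "L2_norm \<Omega> (\<phi> m - \<phi> n) \<le> L2_norm \<Omega> (\<phi> m - u) + L2_norm \<Omega> (\<phi> n - u)"
        using sq_integrable_diff(2)[OF sqd[of m] sqd[of n]] by (simp add: fun_diff_def)
      also have "\<dots> < 2 * e'" using N(2)[of m] N(2)[of n] that by simp
      finally have l: "d * L2_norm \<Omega> (\<phi> m - \<phi> n) \<le> d * (2 * e')" using assms(2) by (intro mult_left_mono) auto
      have "magnetic_norm \<alpha> \<Omega> b (T (\<phi> m - \<phi> n)) \<le> (1 + d) * magnetic_norm \<alpha> \<Omega> a (\<phi> m - \<phi> n) + d * L2_norm \<Omega> (\<phi> m - \<phi> n)"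
        using tr(2)[OF test_function_diff[OF \<phi>(1) \<phi>(1)], of m n] by (simp add: T_def[abs_def])
      also have "\<dots> < (1 + d) * (2 * e') + d * (2 * e')"
        using N(1)[of m n] that assms(2) l \<open>e' > 0\<close>
        by (intro add_less_le_mono mult_strict_left_mono) auto
      also have "\<dots> = e' * (2 * (1 + d) + 2 * d)" by (simp add: algebra_simps)
      also have "\<dots> = e"
      proof -
        have "2 * (1 + d) + 2 * d > 0" using assms(2) by simp
        then show ?thesis unfolding e'_def by (metis less_irrefl nonzero_divide_eq_eq)
      qed
      finally show ?thesis .
    qed
    then show "\<exists>N. \<forall>m\<ge>N. \<forall>n\<ge>N. magnetic_norm \<alpha> \<Omega> b (T (\<phi> m - \<phi> n)) < e" by blast
  qed
  have Tu: "T u \<in> L2_functions \<Omega>" using Tsq[OF \<phi>(3)] by (simp add: L2_functions_eq)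
  show H: "(\<lambda>x. g x * u x) \<in> H1_magnetic \<alpha> \<Omega> b"
    using comp Tu unfolding H1_magnetic_def T_def[abs_def] by blast
  have lim: "(\<lambda>n. magnetic_norm \<alpha> \<Omega> b (T (\<phi> n))) \<longlonglongrightarrow> H1_magnetic_norm \<alpha> \<Omega> b (T u)"
    by (rule completion_sequence_H1_norm[OF assms(3) comp Tu])
  have "(\<lambda>n. (1 + d) * magnetic_norm \<alpha> \<Omega> a (\<phi> n) + d * L2_norm \<Omega> (\<phi> n)) \<longlonglongrightarrow> (1 + d) * H1_magnetic_norm \<alpha> \<Omega> a u + d * L2_norm \<Omega> u"
    by (intro tendsto_intros \<phi>)
  from LIMSEQ_le[OF lim this]
  show "H1_magnetic_norm \<alpha> \<Omega> b (\<lambda>x. g x * u x) \<le> (1 + d) * H1_magnetic_norm \<alpha> \<Omega> a u + d * L2_norm \<Omega> u"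
    using tr(2)[OF \<phi>(1)] by (auto simp: T_def[abs_def])
  have "(\<lambda>n. L2_norm \<Omega> (T (\<phi> n)) - L2_norm \<Omega> (T u)) \<longlonglongrightarrow> 0"
  proof (rule Lim_null_comparison)
    have "\<bar>L2_norm \<Omega> (T (\<phi> n)) - L2_norm \<Omega> (T u)\<bar> \<le> L2_norm \<Omega> (\<phi> n - u)" for n
      using L2_norm_triangle_diff[OF Tsq[OF test_function_sq_integrable[OF \<phi>(1) assms(3)]] Tsq[OF \<phi>(3)], of n]
        Tle[OF sqd[of n]] Tdiff[of "\<phi> n" u] by (simp add: fun_diff_def)
    then show "\<forall>\<^sub>F n in sequentially. norm (L2_norm \<Omega> (T (\<phi> n)) - L2_norm \<Omega> (T u)) \<le> L2_norm \<Omega> (\<phi> n - u)"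
      by simp
  qed (rule t(3))
  then have lim2: "(\<lambda>n. L2_norm \<Omega> (T (\<phi> n))) \<longlonglongrightarrow> L2_norm \<Omega> (T u)" by (simp add: LIM_zero_iff)
  have "(\<lambda>n. L2_norm \<Omega> (T (\<phi> n)) + d * magnetic_norm \<alpha> \<Omega> a (\<phi> n)) \<longlonglongrightarrow> L2_norm \<Omega> (T u) + d * H1_magnetic_norm \<alpha> \<Omega> a u"
    by (intro tendsto_intros \<phi> lim2)
  from LIMSEQ_le[OF \<phi>(5) this]
  show "L2_norm \<Omega> u \<le> L2_norm \<Omega> (\<lambda>x. g x * u x) + d * H1_magnetic_norm \<alpha> \<Omega> a u"
    using tr(3)[OF \<phi>(1)] by (auto simp: T_def[abs_def])
qed

section \<open>Comparison of eigenvalues by transplantation\<close>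

lemma seminorm_sum_le:
  fixes p :: "('a \<Rightarrow> complex) \<Rightarrow> real"
  assumes "finite A" "A \<subseteq> cfun.span B"
    and add: "\<And>u v. u \<in> cfun.span B \<Longrightarrow> v \<in> cfun.span B \<Longrightarrow> p (u + v) \<le> p u + p v"
    and scale: "\<And>c u. u \<in> cfun.span B \<Longrightarrow> p (cscale c u) = norm c * p u"
  shows "p (\<Sum>v\<in>A. cscale (c v) v) \<le> (\<Sum>v\<in>A. norm (c v) * p v)"
  using assms(1,2)
proof (induction A rule: finite_induct)
  case empty
  show ?case using scale[OF cfun.span_zero, of 0] by (simp add: zero_fun_def)
next
  case (insert v A)
  have "p (cscale (c v) v + (\<Sum>v\<in>A. cscale (c v) v)) \<le> p (cscale (c v) v) + p (\<Sum>v\<in>A. cscale (c v) v)"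
    using insert.prems by (intro add cfun.span_scale cfun.span_sum) auto
  moreover have "p (cscale (c v) v) = norm (c v) * p v" using insert.prems by (intro scale) auto
  moreover have "p (\<Sum>v\<in>A. cscale (c v) v) \<le> (\<Sum>v\<in>A. norm (c v) * p v)" using insert by auto
  ultimately show ?case unfolding sum.insert[OF insert.hyps(1,2)] by linarith
qed

text \<open>
  If the estimate fails for every \<open>e\<close>, there are coefficient vectors of length one along which \<open>q\<close> tends to
  zero. By compactness they have a limit, again of length one, on which \<open>q\<close> vanishes; this contradicts
  independence.
\<close>

lemma finite_dimensional_coordinates_bound:
  fixes q :: "('a \<Rightarrow> complex) \<Rightarrow> real"
  assumes fin: "finite B" and indep: "\<not> cfun.dependent B"
    and nonneg: "\<And>u. 0 \<le> q u"
    and add: "\<And>u v. u \<in> cfun.span B \<Longrightarrow> v \<in> cfun.span B \<Longrightarrow> q (u + v) \<le> q u + q v"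
    and scale: "\<And>c u. u \<in> cfun.span B \<Longrightarrow> q (cscale c u) = norm c * q u"
    and definite: "\<And>u. u \<in> cfun.span B \<Longrightarrow> q u = 0 \<Longrightarrow> u = 0"
  shows "\<exists>e>0. \<forall>c. e * (\<Sum>v\<in>B. norm (c v)) \<le> q (\<Sum>v\<in>B. cscale (c v) v)"
proof (rule ccontr)
  assume contr: "\<not> ?thesis"
  have "\<exists>c. q (\<Sum>v\<in>B. cscale (c v) v) < 1 / real (Suc n) * (\<Sum>v\<in>B. norm (c v))" for n
  proof (rule ccontr)
    assume "\<not> ?thesis"
    then have "1 / real (Suc n) * (\<Sum>v\<in>B. norm (c v)) \<le> q (\<Sum>v\<in>B. cscale (c v) v)" for c
      by (simp add: not_less)
    moreover have "1 / real (Suc n) > 0" by simp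
    ultimately show False using contr by blast
  qed
  then obtain c where c: "\<And>n. q (\<Sum>v\<in>B. cscale (c n v) v) < 1 / real (Suc n) * (\<Sum>v\<in>B. norm (c n v))"
    by metis
  have in_span: "(\<Sum>v\<in>B. cscale (f v) v) \<in> cfun.span B" for f
    by (intro cfun.span_sum cfun.span_scale cfun.span_base)
  define S where "S n = (\<Sum>v\<in>B. norm (c n v))" for n
  have S: "S n > 0" for n
  proof -
    have "0 < 1 / real (Suc n) * S n" using c[of n] nonneg[of "\<Sum>v\<in>B. cscale (c n v) v"] by (simp add: S_def)
    then show ?thesis unfolding zero_less_mult_iff by auto
  qed
  define d where "d n v = c n v / of_real (S n)" for n v
  have d1: "(\<Sum>v\<in>B. norm (d n v)) = 1" for n
    using S[of n] by (simp add: d_def norm_divide sum_divide_distrib[symmetric] flip: S_def)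
  have dq: "q (\<Sum>v\<in>B. cscale (d n v) v) < 1 / real (Suc n)" for n
  proof -
    have e: "(\<Sum>v\<in>B. cscale (d n v) v) = cscale (1 / of_real (S n)) (\<Sum>v\<in>B. cscale (c n v) v)"
      by (simp add: cfun.scale_sum_right d_def)
    have "q (\<Sum>v\<in>B. cscale (d n v) v) = 1 / S n * q (\<Sum>v\<in>B. cscale (c n v) v)"
      unfolding e using S[of n]
      by (subst scale) (auto simp: norm_divide in_span)
    also have "\<dots> < 1 / S n * (1 / real (Suc n) * S n)"
      using c[of n] S[of n] unfolding S_def by (intro mult_strict_left_mono) auto
    also have "\<dots> = 1 / real (Suc n)" using S[of n] by simp
    finally show ?thesis .
  qed
  have "bounded (range (\<lambda>n. d n v))" if "v \<in> B" for v
  proof -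
    have "norm (d n v) \<le> 1" for n
      using member_le_sum[OF that, of "\<lambda>v. norm (d n v)"] fin d1[of n] by simp
    then show ?thesis unfolding bounded_iff by blast
  qed
  then have "\<forall>\<delta>\<subseteq>B. \<exists>l r. strict_mono (r::nat\<Rightarrow>nat) \<and>
      (\<forall>\<epsilon>>0. eventually (\<lambda>n. \<forall>i\<in>\<delta>. dist (d (r n) i) (l i) < \<epsilon>) sequentially)"
    using compact_lemma_general[OF fin, of "\<lambda>f v. f v" d "\<lambda>f. f"] by (simp add: image_image)
  then obtain l r where r: "strict_mono (r::nat\<Rightarrow>nat)"
    and l: "\<And>\<epsilon>. \<epsilon> > 0 \<Longrightarrow> eventually (\<lambda>n. \<forall>i\<in>B. dist (d (r n) i) (l i) < \<epsilon>) sequentially"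
    by blast
  have lim: "(\<lambda>n. d (r n) v) \<longlonglongrightarrow> l v" if "v \<in> B" for v
    by (rule tendstoI, rule eventually_mono[OF l]) (use that in auto)
  have "(\<lambda>n. \<Sum>v\<in>B. norm (d (r n) v)) \<longlonglongrightarrow> (\<Sum>v\<in>B. norm (l v))"
    by (intro tendsto_sum tendsto_norm lim)
  then have l1: "(\<Sum>v\<in>B. norm (l v)) = 1" by (simp add: d1 LIMSEQ_const_iff)
  have qbound: "q (\<Sum>v\<in>B. cscale (l v) v) \<le> (\<Sum>v\<in>B. norm (l v - d (r n) v) * q v) + 1 / real (Suc (r n))" for n
  proof -
    have e: "(\<Sum>v\<in>B. cscale (l v) v) = (\<Sum>v\<in>B. cscale (l v - d (r n) v) v) + (\<Sum>v\<in>B. cscale (d (r n) v) v)"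
      by (simp add: sum.distrib[symmetric] cfun.scale_left_diff_distrib)
    have "q (\<Sum>v\<in>B. cscale (l v) v) \<le> q (\<Sum>v\<in>B. cscale (l v - d (r n) v) v) + q (\<Sum>v\<in>B. cscale (d (r n) v) v)"
      unfolding e by (intro add in_span)
    moreover have "q (\<Sum>v\<in>B. cscale (l v - d (r n) v) v) \<le> (\<Sum>v\<in>B. norm (l v - d (r n) v) * q v)"
      by (rule seminorm_sum_le[OF fin _ add scale]) (auto intro: cfun.span_base)
    ultimately show ?thesis using dq[of "r n"] by simp
  qed
  have qlim: "(\<lambda>n. (\<Sum>v\<in>B. norm (l v - d (r n) v) * q v) + 1 / real (Suc (r n))) \<longlonglongrightarrow> (\<Sum>v\<in>B. norm (l v - l v) * q v) + 0"
    using LIMSEQ_subseq_LIMSEQ[OF LIMSEQ_Suc[OF lim_1_over_n] r]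
    by (intro tendsto_add tendsto_sum tendsto_mult tendsto_norm tendsto_diff tendsto_const lim) (auto simp: o_def)
  have "q (\<Sum>v\<in>B. cscale (l v) v) \<le> (\<Sum>v\<in>B. norm (l v - l v) * q v) + 0"
    by (rule LIMSEQ_le_const[OF qlim]) (use qbound in blast)
  then have "q (\<Sum>v\<in>B. cscale (l v) v) = 0" using nonneg by (simp add: antisym)
  then have "(\<Sum>v\<in>B. cscale (l v) v) = 0"
    by (intro definite in_span)
  then have "l v = 0" if "v \<in> B" for v
    using cfun.independentD[OF indep fin order_refl _ that, of l] by blast
  then show False using l1 by simp
qed

lemma finite_dimensional_seminorm_bound:
  fixes p q :: "('a \<Rightarrow> complex) \<Rightarrow> real"
  assumes fin: "finite B" and indep: "\<not> cfun.dependent B"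
    and q: "\<And>u. 0 \<le> q u"
      "\<And>u v. u \<in> cfun.span B \<Longrightarrow> v \<in> cfun.span B \<Longrightarrow> q (u + v) \<le> q u + q v"
      "\<And>c u. u \<in> cfun.span B \<Longrightarrow> q (cscale c u) = norm c * q u"
      "\<And>u. u \<in> cfun.span B \<Longrightarrow> q u = 0 \<Longrightarrow> u = 0"
    and p: "\<And>u v. u \<in> cfun.span B \<Longrightarrow> v \<in> cfun.span B \<Longrightarrow> p (u + v) \<le> p u + p v"
      "\<And>c u. u \<in> cfun.span B \<Longrightarrow> p (cscale c u) = norm c * p u"
  obtains C where "\<And>u. u \<in> cfun.span B \<Longrightarrow> p u \<le> C * q u"
proof -
  obtain e where e: "e > 0" "\<And>c. e * (\<Sum>v\<in>B. norm (c v)) \<le> q (\<Sum>v\<in>B. cscale (c v) v)"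
    using finite_dimensional_coordinates_bound[OF fin indep q] by blast
  define M where "M = (\<Sum>v\<in>B. \<bar>p v\<bar>)"
  have M: "p v \<le> M" if "v \<in> B" for v
    using member_le_sum[OF that, of "\<lambda>v. \<bar>p v\<bar>"] fin unfolding M_def by fastforce
  have M0: "M \<ge> 0" by (simp add: M_def sum_nonneg)
  show thesis
  proof (rule that)
    fix u assume "u \<in> cfun.span B"
    then obtain c where c: "u = (\<Sum>v\<in>B. cscale (c v) v)"
      using cfun.span_finite[OF fin] by auto
    have "p u \<le> (\<Sum>v\<in>B. norm (c v) * p v)"
      unfolding c by (rule seminorm_sum_le[OF fin _ p]) (auto intro: cfun.span_base)
    also have "\<dots> \<le> (\<Sum>v\<in>B. norm (c v) * M)"
      by (intro sum_mono mult_left_mono M) auto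
    also have "\<dots> = M / e * (e * (\<Sum>v\<in>B. norm (c v)))"
      using e(1) by (simp add: sum_distrib_right[symmetric])
    also have "\<dots> \<le> M / e * q u"
      unfolding c using e M0 by (intro mult_left_mono) auto
    finally show "p u \<le> M / e * q u" .
  qed
qed

definition rayleigh_sup :: "real \<Rightarrow> (real^2) set \<Rightarrow> real^2 \<Rightarrow> (real^2 \<Rightarrow> complex) set \<Rightarrow> real" where
  "rayleigh_sup \<alpha> \<Omega> a W = (SUP \<Phi> \<in> W - {0}. (H1_magnetic_norm \<alpha> \<Omega> a \<Phi>)\<^sup>2 / (L2_norm \<Omega> \<Phi>)\<^sup>2)"

lemma AB_eigenvalue_eq: "AB_eigenvalue \<alpha> \<Omega> j a = (INF W \<in> H1_subspaces \<alpha> \<Omega> a j. rayleigh_sup \<alpha> \<Omega> a W)"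
  by (simp add: AB_eigenvalue_def rayleigh_sup_def)

lemma H1_magnetic_sq_integrable: "u \<in> H1_magnetic \<alpha> \<Omega> a \<Longrightarrow> sq_integrable \<Omega> u"
  by (simp add: H1_magnetic_def L2_functions_eq)

lemma H1_magnetic_norm_nonneg:
  assumes "u \<in> H1_magnetic \<alpha> \<Omega> a" "open \<Omega>"
  shows "0 \<le> H1_magnetic_norm \<alpha> \<Omega> a u"
proof -
  obtain \<phi> where "(\<lambda>n. magnetic_norm \<alpha> \<Omega> a (\<phi> n)) \<longlonglongrightarrow> H1_magnetic_norm \<alpha> \<Omega> a u"
    using H1_magneticE[OF assms] by blast
  then show ?thesis by (rule LIMSEQ_le_const) (auto simp: magnetic_norm_nonneg)
qed

lemma H1_subspaces_basis:
  assumes "W \<in> H1_subspaces \<alpha> \<Omega> a j" "1 \<le> j"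
  obtains B where "finite B" "\<not> cfun.dependent B" "W = cfun.span B" "card B = j" "B \<noteq> {}"
proof -
  have W: "cfun.subspace W" "cfun.dim W = j" using assms by (auto simp: H1_subspaces_def)
  obtain B where B: "B \<subseteq> W" "\<not> cfun.dependent B" "W \<subseteq> cfun.span B" "card B = j"
    using cfun.basis_exists[of W] W(2) by metis
  have "W = cfun.span B" using B cfun.span_minimal[OF B(1) W(1)] by auto
  moreover have "finite B" "B \<noteq> {}" using B(4) assms(2) by (auto intro: card_ge_0_finite)
  ultimately show thesis using that B by blast
qed

lemma H1_subspaces_L2_pos:
  assumes "W \<in> H1_subspaces \<alpha> \<Omega> a j" "u \<in> W" "u \<noteq> 0"
  shows "L2_norm \<Omega> u > 0"
proof -
  have "sq_integrable \<Omega> u" using assms by (auto simp: H1_subspaces_def intro: H1_magnetic_sq_integrable)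
  then show ?thesis using L2_norm_eq_0_iff[of \<Omega> u] assms L2_norm_nonneg[of \<Omega> u]
    by (auto simp: H1_subspaces_def less_le)
qed

text \<open>
  The Rayleigh quotient is bounded on a finite-dimensional space because the \<open>L\<^sup>2\<close> norm is a norm there. Its
  supremum therefore is an upper bound, which an unbounded set of reals would not guarantee.
\<close>

lemma H1_subspaces_rayleigh:
  assumes W: "W \<in> H1_subspaces \<alpha> \<Omega> a j" and j: "1 \<le> j" and op: "open \<Omega>"
  shows "W - {0} \<noteq> {}" and "0 \<le> rayleigh_sup \<alpha> \<Omega> a W"
    and "\<And>u. u \<in> W \<Longrightarrow> H1_magnetic_norm \<alpha> \<Omega> a u \<le> sqrt (rayleigh_sup \<alpha> \<Omega> a W) * L2_norm \<Omega> u"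
proof -
  obtain B where B: "finite B" "\<not> cfun.dependent B" "W = cfun.span B" "B \<noteq> {}"
    using H1_subspaces_basis[OF W j] by metis
  have WH: "u \<in> H1_magnetic \<alpha> \<Omega> a" if "u \<in> W" for u using W that by (auto simp: H1_subspaces_def)
  show ne: "W - {0} \<noteq> {}"
  proof -
    obtain b where "b \<in> B" using B by blast
    then have "b \<in> W" "b \<noteq> 0" using B cfun.dependent_zero cfun.span_base by auto
    then show ?thesis by blast
  qed
  obtain C where C: "\<And>u. u \<in> cfun.span B \<Longrightarrow> H1_magnetic_norm \<alpha> \<Omega> a u \<le> C * L2_norm \<Omega> u"
  proof (rule finite_dimensional_seminorm_bound[OF B(1,2), of "L2_norm \<Omega>" "H1_magnetic_norm \<alpha> \<Omega> a"])
    show "L2_norm \<Omega> (u + v) \<le> L2_norm \<Omega> u + L2_norm \<Omega> v" if "u \<in> cfun.span B" "v \<in> cfun.span B" for u v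
      using sq_integrable_add(2)[OF H1_magnetic_sq_integrable[OF WH] H1_magnetic_sq_integrable[OF WH]] that B(3)
      by (simp add: plus_fun_def)
    show "L2_norm \<Omega> (cscale c u) = norm c * L2_norm \<Omega> u" for c u
      by (simp add: cscale_def L2_norm_cmult)
    show "u = 0" if "u \<in> cfun.span B" "L2_norm \<Omega> u = 0" for u
      using H1_subspaces_L2_pos[OF W, of u] that B(3) by auto
    show "H1_magnetic_norm \<alpha> \<Omega> a (u + v) \<le> H1_magnetic_norm \<alpha> \<Omega> a u + H1_magnetic_norm \<alpha> \<Omega> a v"
      if "u \<in> cfun.span B" "v \<in> cfun.span B" for u v
      using H1_magnetic_add[OF WH WH op] that B(3) by simp
    show "H1_magnetic_norm \<alpha> \<Omega> a (cscale c u) = norm c * H1_magnetic_norm \<alpha> \<Omega> a u"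
      if "u \<in> cfun.span B" for c u
      using H1_magnetic_cscale[OF WH op] that B(3) by simp
  qed (auto simp: L2_norm_nonneg)
  let ?q = "\<lambda>\<Phi>. (H1_magnetic_norm \<alpha> \<Omega> a \<Phi>)\<^sup>2 / (L2_norm \<Omega> \<Phi>)\<^sup>2"
  have bdd: "bdd_above (?q ` (W - {0}))"
  proof (rule bdd_aboveI2)
    fix u assume u: "u \<in> W - {0}"
    have "(H1_magnetic_norm \<alpha> \<Omega> a u)\<^sup>2 \<le> (C * L2_norm \<Omega> u)\<^sup>2"
      using C[of u] u B(3) H1_magnetic_norm_nonneg[OF WH op, of u] by (intro power_mono) auto
    then show "?q u \<le> C\<^sup>2"
      using H1_subspaces_L2_pos[OF W, of u] u by (simp add: divide_le_eq power_mult_distrib)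
  qed
  show nn: "0 \<le> rayleigh_sup \<alpha> \<Omega> a W"
  proof -
    obtain u where u: "u \<in> W - {0}" using ne by blast
    have "0 \<le> ?q u" by simp
    also have "\<dots> \<le> rayleigh_sup \<alpha> \<Omega> a W" unfolding rayleigh_sup_def by (rule cSUP_upper[OF u bdd])
    finally show ?thesis .
  qed
  fix u assume u: "u \<in> W"
  show "H1_magnetic_norm \<alpha> \<Omega> a u \<le> sqrt (rayleigh_sup \<alpha> \<Omega> a W) * L2_norm \<Omega> u"
  proof (cases "u = 0")
    case True
    have "cscale 0 u = 0" by (simp add: cscale_def fun_eq_iff)
    then have "H1_magnetic_norm \<alpha> \<Omega> a u = 0"
      using H1_magnetic_cscale[OF WH[OF u] op, of 0] True by simp
    then show ?thesis using nn by (simp add: L2_norm_nonneg)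
  next
    case False
    have "?q u \<le> rayleigh_sup \<alpha> \<Omega> a W" unfolding rayleigh_sup_def
      using u False by (intro cSUP_upper[OF _ bdd]) auto
    then have "(H1_magnetic_norm \<alpha> \<Omega> a u)\<^sup>2 \<le> rayleigh_sup \<alpha> \<Omega> a W * (L2_norm \<Omega> u)\<^sup>2"
      using H1_subspaces_L2_pos[OF W u False] by (simp add: divide_le_eq)
    also have "\<dots> = (sqrt (rayleigh_sup \<alpha> \<Omega> a W) * L2_norm \<Omega> u)\<^sup>2"
      using nn by (simp add: power_mult_distrib)
    finally show ?thesis by (rule power2_le_imp_le) (use nn in \<open>simp add: L2_norm_nonneg\<close>)
  qed
qed

text \<open>
  On \<open>W\<close> the form is at most \<open>t\<close> times the \<open>L\<^sup>2\<close> norm, so multiplication by \<open>g\<close> shrinks the \<open>L\<^sup>2\<close> norm at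
  most by the factor \<open>1 - d * t\<close>. This is positive, hence the multiplication is injective and the image is a
  trial space of the same dimension.
\<close>

lemma transplants_subspace:
  assumes tr: "transplants \<alpha> \<Omega> d g a b" and d: "d \<ge> 0" and op: "open \<Omega>" and j: "1 \<le> j"
    and W: "W \<in> H1_subspaces \<alpha> \<Omega> a j" and t: "sqrt (rayleigh_sup \<alpha> \<Omega> a W) \<le> t" "d * t < 1"
  shows "\<exists>W'\<in>H1_subspaces \<alpha> \<Omega> b j. rayleigh_sup \<alpha> \<Omega> b W' \<le> (((1 + d) * t + d) / (1 - d * t))\<^sup>2"
proof -
  define T where "T u = (\<lambda>x. g x * u x)" for u
  interpret T: Vector_Spaces.linear cscale cscale T
    by (auto simp: Vector_Spaces.linear_iff T_def cscale_def fun_eq_iff algebra_simps cfun.vector_space_axioms)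
  have WH: "u \<in> H1_magnetic \<alpha> \<Omega> a" if "u \<in> W" for u using W that by (auto simp: H1_subspaces_def)
  have H1: "H1_magnetic_norm \<alpha> \<Omega> a u \<le> t * L2_norm \<Omega> u" if "u \<in> W" for u
    using H1_subspaces_rayleigh(3)[OF W j op that] mult_right_mono[OF t(1) L2_norm_nonneg[of \<Omega> u]] by simp
  have TL2: "(1 - d * t) * L2_norm \<Omega> u \<le> L2_norm \<Omega> (T u)" if "u \<in> W" for u
    using transplants_H1(3)[OF tr d op WH[OF that]] mult_left_mono[OF H1[OF that] d]
    unfolding T_def by (simp add: algebra_simps)
  have TH1: "H1_magnetic_norm \<alpha> \<Omega> b (T u) \<le> ((1 + d) * t + d) * L2_norm \<Omega> u" if "u \<in> W" for u
    using transplants_H1(2)[OF tr d op WH[OF that]] mult_left_mono[OF H1[OF that], of "1 + d"] d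
    unfolding T_def by (simp add: algebra_simps)
  have TH: "T u \<in> H1_magnetic \<alpha> \<Omega> b" if "u \<in> W" for u
    using transplants_H1(1)[OF tr d op WH[OF that]] unfolding T_def .
  have inj: "u = 0" if "u \<in> W" "L2_norm \<Omega> (T u) = 0" for u
  proof (rule ccontr)
    assume "u \<noteq> 0"
    then have "0 < (1 - d * t) * L2_norm \<Omega> u" using H1_subspaces_L2_pos[OF W that(1)] t(2) by simp
    then show False using TL2[OF that(1)] that(2) by simp
  qed
  have W_sub: "cfun.subspace W" using W by (simp add: H1_subspaces_def)
  have inj_on: "inj_on T W"
  proof (rule inj_onI)
    fix u v assume uv: "u \<in> W" "v \<in> W" "T u = T v"
    have "T (u - v) = 0" using uv(3) T.diff by simp
    then have "L2_norm \<Omega> (T (u - v)) = 0" by (simp add: L2_norm_def)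
    then have "u - v = 0" using inj cfun.subspace_diff[OF W_sub uv(1,2)] by blast
    then show "u = v" by simp
  qed
  obtain B where B: "finite B" "\<not> cfun.dependent B" "W = cfun.span B" "card B = j" "B \<noteq> {}"
    using H1_subspaces_basis[OF W j] by metis
  have TW: "T ` W = cfun.span (T ` B)" unfolding B(3) by (rule T.span_image[symmetric])
  have "cfun.dim (T ` W) = card (T ` B)"
    unfolding TW using T.independent_injective_image[OF B(2)] inj_on B(3)
    by (intro cfun.dim_span_eq_card_independent) auto
  also have "\<dots> = j"
    using card_image[OF inj_on_subset[OF inj_on]] B(3,4) cfun.span_superset by metis
  finally have dim: "cfun.dim (T ` W) = j" .
  have W': "T ` W \<in> H1_subspaces \<alpha> \<Omega> b j"
    unfolding H1_subspaces_def
  proof (intro CollectI conjI ballI impI dim)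
    show "T ` W \<subseteq> H1_magnetic \<alpha> \<Omega> b" using TH by auto
    show "cfun.subspace (T ` W)" unfolding TW by (rule cfun.subspace_span)
    fix \<Phi> assume "\<Phi> \<in> T ` W" and ae: "AE x in lebesgue_on \<Omega>. \<Phi> x = 0"
    then obtain u where u: "u \<in> W" "\<Phi> = T u" by auto
    have "L2_norm \<Omega> (T u) = 0"
      using ae u L2_norm_eq_0_iff[OF H1_magnetic_sq_integrable[OF TH[OF u(1)]]] by simp
    then have "u = 0" using inj u by blast
    then show "\<Phi> = 0" using u T.zero by simp
  qed
  have t0: "t \<ge> 0" using H1_subspaces_rayleigh(2)[OF W j op] t(1) by (meson order_trans real_sqrt_ge_zero)
  have "rayleigh_sup \<alpha> \<Omega> b (T ` W) \<le> (((1 + d) * t + d) / (1 - d * t))\<^sup>2"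
    unfolding rayleigh_sup_def
  proof (rule cSUP_least[OF H1_subspaces_rayleigh(1)[OF W' j op]])
    fix \<Phi> assume "\<Phi> \<in> T ` W - {0}"
    then obtain u where u: "u \<in> W" "\<Phi> = T u" "T u \<noteq> 0" by auto
    have pos: "L2_norm \<Omega> (T u) > 0" using H1_subspaces_L2_pos[OF W'] u by auto
    have "L2_norm \<Omega> u \<le> L2_norm \<Omega> (T u) / (1 - d * t)"
      using TL2[OF u(1)] t(2) by (simp add: pos_le_divide_eq mult.commute)
    then have "((1 + d) * t + d) * L2_norm \<Omega> u \<le> ((1 + d) * t + d) * (L2_norm \<Omega> (T u) / (1 - d * t))"
      using t0 d by (intro mult_left_mono) auto
    then have "H1_magnetic_norm \<alpha> \<Omega> b (T u) \<le> ((1 + d) * t + d) / (1 - d * t) * L2_norm \<Omega> (T u)"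
      using TH1[OF u(1)] by simp
    then have "H1_magnetic_norm \<alpha> \<Omega> b (T u) / L2_norm \<Omega> (T u) \<le> ((1 + d) * t + d) / (1 - d * t)"
      using pos by (simp add: pos_divide_le_eq)
    then have "(H1_magnetic_norm \<alpha> \<Omega> b (T u) / L2_norm \<Omega> (T u))\<^sup>2 \<le> (((1 + d) * t + d) / (1 - d * t))\<^sup>2"
      using H1_magnetic_norm_nonneg[OF TH[OF u(1)] op] pos by (intro power_mono) auto
    then show "(H1_magnetic_norm \<alpha> \<Omega> b \<Phi>)\<^sup>2 / (L2_norm \<Omega> \<Phi>)\<^sup>2 \<le> (((1 + d) * t + d) / (1 - d * t))\<^sup>2"
      using u(2) by (simp add: power_divide)
  qed
  then show ?thesis using W' by blast
qed

lemma AB_eigenvalue_nonneg: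
  assumes "open \<Omega>" "1 \<le> j" "H1_subspaces \<alpha> \<Omega> a j \<noteq> {}"
  shows "0 \<le> AB_eigenvalue \<alpha> \<Omega> j a"
  unfolding AB_eigenvalue_eq
  by (rule cINF_greatest[OF assms(3)]) (rule H1_subspaces_rayleigh(2)[OF _ assms(2,1)])

text \<open>
  A trial space whose supremum is nearly optimal for \<open>a\<close> is transplanted to \<open>b\<close>; then \<open>t\<close> decreases to
  \<open>s\<close>, the square root of the eigenvalue at \<open>a\<close>.
\<close>

lemma AB_eigenvalue_transplant:
  assumes tr: "transplants \<alpha> \<Omega> d g a b" and d: "d \<ge> 0" and op: "open \<Omega>" and j: "1 \<le> j"
    and ne: "H1_subspaces \<alpha> \<Omega> a j \<noteq> {}" and small: "d * sqrt (AB_eigenvalue \<alpha> \<Omega> j a) < 1"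
  shows "sqrt (AB_eigenvalue \<alpha> \<Omega> j b)
    \<le> ((1 + d) * sqrt (AB_eigenvalue \<alpha> \<Omega> j a) + d) / (1 - d * sqrt (AB_eigenvalue \<alpha> \<Omega> j a))"
proof -
  define s where "s = sqrt (AB_eigenvalue \<alpha> \<Omega> j a)"
  have nn: "0 \<le> AB_eigenvalue \<alpha> \<Omega> j a" by (rule AB_eigenvalue_nonneg[OF op j ne])
  then have s: "0 \<le> s" "AB_eigenvalue \<alpha> \<Omega> j a = s\<^sup>2" by (auto simp: s_def)
  have bdd: "bdd_below (rayleigh_sup \<alpha> \<Omega> c ` H1_subspaces \<alpha> \<Omega> c j)" for c
    by (rule bdd_belowI2[of _ 0]) (rule H1_subspaces_rayleigh(2)[OF _ j op])
  have step: "sqrt (AB_eigenvalue \<alpha> \<Omega> j b) \<le> ((1 + d) * t + d) / (1 - d * t)" if t: "s < t" "d * t < 1" for t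
  proof -
    have "AB_eigenvalue \<alpha> \<Omega> j a < t\<^sup>2" unfolding s(2) using t s by (intro power_strict_mono) auto
    then obtain W where W: "W \<in> H1_subspaces \<alpha> \<Omega> a j" "rayleigh_sup \<alpha> \<Omega> a W < t\<^sup>2"
      unfolding AB_eigenvalue_eq cINF_less_iff[OF ne bdd] by blast
    have "sqrt (rayleigh_sup \<alpha> \<Omega> a W) \<le> t"
      using W(2) t s by (intro real_le_lsqrt) auto
    from transplants_subspace[OF tr d op j W(1) this t(2)] obtain W' where
      W': "W' \<in> H1_subspaces \<alpha> \<Omega> b j" "rayleigh_sup \<alpha> \<Omega> b W' \<le> (((1 + d) * t + d) / (1 - d * t))\<^sup>2" by blast
    have "AB_eigenvalue \<alpha> \<Omega> j b \<le> rayleigh_sup \<alpha> \<Omega> b W'"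
      unfolding AB_eigenvalue_eq by (rule cINF_lower[OF bdd W'(1)])
    then have "AB_eigenvalue \<alpha> \<Omega> j b \<le> (((1 + d) * t + d) / (1 - d * t))\<^sup>2" using W'(2) by simp
    then show ?thesis using t s d by (intro real_le_lsqrt) auto
  qed
  have ds: "1 - d * s > 0" using small by (simp add: s_def)
  have lim: "((\<lambda>t. ((1 + d) * t + d) / (1 - d * t)) \<longlongrightarrow> ((1 + d) * s + d) / (1 - d * s)) (at_right s)"
    using ds by (intro tendsto_intros) auto
  have "((\<lambda>t. d * t) \<longlongrightarrow> d * s) (at_right s)" by (intro tendsto_intros)
  then have "\<forall>\<^sub>F t in at_right s. d * t < 1" using ds by (intro order_tendstoD) auto
  moreover have "\<forall>\<^sub>F t in at_right s. s < t" by (simp add: eventually_at_right_less)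
  ultimately have "\<forall>\<^sub>F t in at_right s. sqrt (AB_eigenvalue \<alpha> \<Omega> j b) \<le> ((1 + d) * t + d) / (1 - d * t)"
    by eventually_elim (rule step)
  then show ?thesis unfolding s_def[symmetric]
    by (intro tendsto_lowerbound[OF lim]) auto
qed

section \<open>Hardy's inequality around the pole\<close>

definition rot :: "real \<Rightarrow> real^2 \<Rightarrow> real^2" where
  "rot t x = vector [cos t * x$1 - sin t * x$2, sin t * x$1 + cos t * x$2]"

lemma rot_nth [simp]: "rot t x $ 1 = cos t * x$1 - sin t * x$2" "rot t x $ 2 = sin t * x$1 + cos t * x$2"
  by (simp_all add: rot_def)

lemma linear_rot: "linear (rot t)"
  by (rule linearI) (simp_all add: vec_eq_iff forall_2 algebra_simps)

lemma norm_real2_power2: "(norm (v::real^2))\<^sup>2 = (v$1)\<^sup>2 + (v$2)\<^sup>2"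
  by (simp add: norm_vec_def L2_set_def sum_2)

lemma norm_rot: "norm (rot t x) = norm x"
proof (rule power2_eq_imp_eq)
  have "(norm (rot t x))\<^sup>2 = ((sin t)\<^sup>2 + (cos t)\<^sup>2) * (norm x)\<^sup>2"
    unfolding norm_real2_power2 rot_nth by algebra
  then show "(norm (rot t x))\<^sup>2 = (norm x)\<^sup>2" by simp
qed auto

lemma orthogonal_transformation_rot: "orthogonal_transformation (rot t)"
  by (simp add: orthogonal_transformation linear_rot norm_rot)

lemma rot_inverse: "rot (- t) (rot t x) = x"
proof -
  have "cos t * (cos t * x$1 - sin t * x$2) + sin t * (sin t * x$1 + cos t * x$2) = ((sin t)\<^sup>2 + (cos t)\<^sup>2) * x$1"
    "cos t * (sin t * x$1 + cos t * x$2) - sin t * (cos t * x$1 - sin t * x$2) = ((sin t)\<^sup>2 + (cos t)\<^sup>2) * x$2"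
    by algebra+
  then show ?thesis by (simp add: vec_eq_iff forall_2)
qed

lemma continuous_rot: "continuous_on UNIV (rot t)"
  using linear_rot by (simp add: linear_continuous_on linear_conv_bounded_linear)

lemma distr_rot: "distr lborel borel (rot t) = lborel"
proof (rule lborel_eqI[symmetric])
  fix l u :: "real^2" assume lu: "\<And>b. b \<in> Basis \<Longrightarrow> l \<bullet> b \<le> u \<bullet> b"
  have m: "rot t \<in> borel_measurable borel" using continuous_rot by (rule borel_measurable_continuous_onI)
  have v: "rot t -` box l u = rot (- t) ` box l u"
  proof (intro set_eqI iffI)
    fix x assume "x \<in> rot t -` box l u"
    then show "x \<in> rot (- t) ` box l u" using rot_inverse[of t x] by (metis image_eqI vimageD)
  next
    fix x assume "x \<in> rot (- t) ` box l u"
    then show "x \<in> rot t -` box l u" using rot_inverse[of "- t"] by auto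
  qed
  have bm: "rot t -` box l u \<in> sets borel" using measurable_sets[OF m, of "box l u"] by simp
  have lm: "rot t -` box l u \<in> lmeasurable"
    unfolding v by (rule measurable_orthogonal_image[OF orthogonal_transformation_rot]) auto
  have "emeasure (distr lborel borel (rot t)) (box l u) = emeasure lborel (rot t -` box l u)"
    using m by (subst emeasure_distr) auto
  also have "\<dots> = emeasure lebesgue (rot t -` box l u)" using bm by simp
  also have "\<dots> = ennreal (measure lebesgue (rot t -` box l u))"
    by (rule emeasure_eq_measure2[OF lm])
  also have "measure lebesgue (rot t -` box l u) = measure lebesgue (box l u)"
    unfolding v by (rule measure_orthogonal_image[OF orthogonal_transformation_rot]) auto
  also have "\<dots> = (\<Prod>b\<in>Basis. (u - l) \<bullet> b)" using lu by simp
  finally show "emeasure (distr lborel borel (rot t)) (box l u) = ennreal (\<Prod>b\<in>Basis. (u - l) \<bullet> b)" .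
qed simp

lemma nn_integral_rot:
  fixes F :: "real^2 \<Rightarrow> ennreal"
  assumes [measurable]: "F \<in> borel_measurable borel"
  shows "(\<integral>\<^sup>+x. F (a + rot t (x - a)) \<partial>lborel) = (\<integral>\<^sup>+x. F x \<partial>lborel)"
proof -
  have m[measurable]: "rot t \<in> borel_measurable borel" using continuous_rot by (rule borel_measurable_continuous_onI)
  have "(\<integral>\<^sup>+x. F (a + rot t (x - a)) \<partial>lborel) = (\<integral>\<^sup>+x. F (a + rot t (x - a)) \<partial>distr lborel borel ((+) a))"
    by (simp add: lborel_distr_plus)
  also have "\<dots> = (\<integral>\<^sup>+x. F (a + rot t x) \<partial>lborel)" by (subst nn_integral_distr) auto
  also have "\<dots> = (\<integral>\<^sup>+x. F (a + x) \<partial>distr lborel borel (rot t))" by (subst nn_integral_distr) auto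
  also have "\<dots> = (\<integral>\<^sup>+x. F (a + x) \<partial>lborel)" by (simp add: distr_rot)
  also have "\<dots> = (\<integral>\<^sup>+x. F x \<partial>distr lborel borel ((+) a))" by (subst nn_integral_distr) auto
  also have "\<dots> = (\<integral>\<^sup>+x. F x \<partial>lborel)" by (simp add: lborel_distr_plus)
  finally show ?thesis .
qed

text \<open>
  Up to the length of the vector, this is the angular direction: a point \<open>x\<close> that turns around \<open>a\<close> has
  velocity \<open>perp (x - a)\<close>, and the potential is a multiple of it.
\<close>

definition perp :: "real^2 \<Rightarrow> real^2" where
  "perp v = vector [- v$2, v$1]"

lemma perp_nth [simp]: "perp v $ 1 = - v$2" "perp v $ 2 = v$1"
  by (simp_all add: perp_def)

lemma linear_perp: "linear perp"
  by (rule linearI) (simp_all add: vec_eq_iff forall_2 algebra_simps)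

lemma norm_perp: "norm (perp v) = norm v"
  by (rule power2_eq_imp_eq) (auto simp: norm_real2_power2)

lemma rot_eq_perp: "rot t v = cos t *\<^sub>R v + sin t *\<^sub>R perp v"
  by (simp add: vec_eq_iff forall_2)

text \<open>
  The potential has inner product \<open>\<alpha>\<close> with the angular velocity \<open>perp (y - a)\<close>, whatever the distance from
  the pole.
\<close>

lemma angular_derivative_le_magnetic_gradient:
  assumes "\<phi> \<in> test_functions U" "y \<noteq> a"
  shows "norm (frechet_derivative \<phi> (at y) (perp (y - a)) - \<i> * of_real \<alpha> * \<phi> y)
    \<le> norm (y - a) * norm (magnetic_gradient \<alpha> a \<phi> y)"
proof -
  define J where "J = perp (y - a)"
  define D where "D = magnetic_gradient \<alpha> a \<phi> y"
  let ?f = "frechet_derivative \<phi> (at y)"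
  have lin: "linear ?f" using test_function_has_derivative[OF assms(1)] has_derivative_linear by blast
  have nJ: "norm J = norm (y - a)"
    by (rule power2_eq_imp_eq) (auto simp: J_def norm_real2_power2 power2_commute)
  have "J = J$1 *\<^sub>R axis 1 1 + J$2 *\<^sub>R axis 2 1"
    by (simp add: vec_eq_iff forall_2 axis_def)
  then have f: "?f J = of_real (J$1) * ?f (axis 1 1) + of_real (J$2) * ?f (axis 2 1)"
    using linear_add[OF lin] linear_scale[OF lin] by (metis scaleR_conv_of_real)
  have A: "J$1 * AB_potential \<alpha> a y $ 1 + J$2 * AB_potential \<alpha> a y $ 2 = \<alpha>"
  proof -
    have "J$1 * AB_potential \<alpha> a y $ 1 + J$2 * AB_potential \<alpha> a y $ 2 = \<alpha> * (norm (y - a))\<^sup>2 / (norm (y - a))\<^sup>2"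
      unfolding AB_potential_nth J_def perp_nth norm_real2_power2[of "y - a"]
      by (simp add: add_divide_distrib[symmetric] diff_divide_distrib[symmetric] power2_eq_square algebra_simps)
    then show ?thesis using assms(2) by simp
  qed
  have "of_real (J$1) * D$1 + of_real (J$2) * D$2 = \<i> * ?f J +
      of_real (J$1 * AB_potential \<alpha> a y $ 1 + J$2 * AB_potential \<alpha> a y $ 2) * \<phi> y"
    unfolding f D_def magnetic_gradient_def by (simp add: algebra_simps)
  then have e: "of_real (J$1) * D$1 + of_real (J$2) * D$2 = \<i> * (?f J - \<i> * of_real \<alpha> * \<phi> y)"
    unfolding A by (simp add: algebra_simps)
  have "norm (?f J - \<i> * of_real \<alpha> * \<phi> y) = norm (of_real (J$1) * D$1 + of_real (J$2) * D$2)"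
    unfolding e by (simp add: norm_mult)
  also have "\<dots> \<le> \<bar>J$1\<bar> * norm (D$1) + \<bar>J$2\<bar> * norm (D$2)"
    by (rule order_trans[OF norm_triangle_ineq]) (simp add: norm_mult)
  also have "\<dots> \<le> norm J * norm D"
  proof (rule power2_le_imp_le)
    have "(p * r + q * s)\<^sup>2 \<le> (p\<^sup>2 + q\<^sup>2) * (r\<^sup>2 + s\<^sup>2)" for p q r s :: real
      using zero_le_power2[of "p * s - q * r"] by (simp add: power2_eq_square algebra_simps)
    from this[of "\<bar>J$1\<bar>" "norm (D$1)" "\<bar>J$2\<bar>" "norm (D$2)"]
    show "(\<bar>J$1\<bar> * norm (D$1) + \<bar>J$2\<bar> * norm (D$2))\<^sup>2 \<le> (norm J * norm D)\<^sup>2"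
      by (simp add: power_mult_distrib norm_real2_power2 norm_complex2_power2)
  qed simp
  finally show ?thesis unfolding nJ unfolding J_def D_def .
qed

text \<open>
  Let \<open>u\<close> be \<open>\<phi>\<close> along the circle around \<open>a\<close> through \<open>x\<close>. The derivative of \<open>exp (-i\<alpha>t) u(t)\<close> has the
  modulus of \<open>u' - i\<alpha>u\<close>, which the magnetic gradient controls. In one turn \<open>u\<close> returns to its
  value while the exponential factor does not, so the increment is \<open>(exp (-2\<pi>i\<alpha>) - 1) \<phi>(x)\<close>.
\<close>

lemma circle_inequality:
  assumes test: "\<phi> \<in> test_functions (\<Omega> - {a})" and x: "x \<noteq> a"
  shows "ennreal ((norm (cis (- 2 * pi * \<alpha>) - 1))\<^sup>2 * (norm (\<phi> x) / norm (x - a))\<^sup>2)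
    \<le> ennreal (2 * pi) * (\<integral>\<^sup>+t. indicator {0..2*pi} t * ennreal ((norm (magnetic_gradient \<alpha> a \<phi> (a + rot t (x - a))))\<^sup>2) \<partial>lborel)"
proof -
  define \<rho> where "\<rho> = norm (x - a)"
  have \<rho>: "\<rho> > 0" using x by (simp add: \<rho>_def)
  define y where "y t = a + rot t (x - a)" for t
  have ya: "norm (y t - a) = \<rho>" for t by (simp add: y_def norm_rot \<rho>_def)
  then have yn: "y t \<noteq> a" for t using \<rho> by (metis norm_zero right_minus_eq less_irrefl)
  have dy: "(y has_derivative (\<lambda>s. s *\<^sub>R perp (y t - a))) (at t)" for t
  proof -
    have "((\<lambda>t. a + (cos t *\<^sub>R (x - a) + sin t *\<^sub>R perp (x - a))) has_derivative
       (\<lambda>s. (s * - sin t) *\<^sub>R (x - a) + (s * cos t) *\<^sub>R perp (x - a))) (at t)"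
      by (auto intro!: derivative_eq_intros simp: fun_eq_iff)
    moreover have "(s * - sin t) *\<^sub>R (x - a) + (s * cos t) *\<^sub>R perp (x - a) = s *\<^sub>R perp (y t - a)" for s
      by (simp add: vec_eq_iff forall_2 y_def algebra_simps)
    ultimately show ?thesis unfolding y_def[abs_def] rot_eq_perp by (simp add: y_def rot_eq_perp)
  qed
  have conty: "continuous_on UNIV y"
    using dy by (auto intro!: continuous_at_imp_continuous_on has_derivative_continuous)
  \<comment> \<open>The derivative of the twisted function along the circle.\<close>
  define w' where "w' t = cis (- \<alpha> * t) * (frechet_derivative \<phi> (at (y t)) (perp (y t - a)) - \<i> * of_real \<alpha> * \<phi> (y t))" for t
  have dw: "((\<lambda>t. cis (- \<alpha> * t) * \<phi> (y t)) has_vector_derivative w' t) (at t within T)" for t T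
  proof -
    have lin: "linear (frechet_derivative \<phi> (at (y t)))"
      using test_function_has_derivative[OF test] has_derivative_linear by blast
    have 1: "((\<lambda>t. \<phi> (y t)) has_derivative (\<lambda>s. s *\<^sub>R frechet_derivative \<phi> (at (y t)) (perp (y t - a)))) (at t)"
      using has_derivative_compose[OF dy[of t] test_function_has_derivative[OF test, of "y t"]]
      by (simp add: linear_scale[OF lin])
    have 2: "((\<lambda>t. cis (- \<alpha> * t)) has_derivative (\<lambda>s. (- \<alpha> * s) *\<^sub>R (\<i> * cis (- \<alpha> * t)))) (at t)"
      by (rule has_derivative_cis) (auto intro!: derivative_eq_intros)
    have "((\<lambda>t. cis (- \<alpha> * t) * \<phi> (y t)) has_derivative (\<lambda>s. s *\<^sub>R w' t)) (at t)"
      by (rule has_derivative_eq_rhs[OF has_derivative_mult[OF 2 1]])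
        (simp add: fun_eq_iff w'_def scaleR_conv_of_real algebra_simps)
    then show ?thesis unfolding has_vector_derivative_def by (rule has_derivative_at_withinI)
  qed
  define h where "h t = norm (magnetic_gradient \<alpha> a \<phi> (y t))" for t
  have conth: "continuous_on UNIV h"
  proof -
    have "continuous_on UNIV (magnetic_gradient \<alpha> a \<phi>)"
      using magnetic_gradient_test_support[OF test] by blast
    then show ?thesis unfolding h_def
      by (intro continuous_on_norm continuous_on_compose2[OF _ conty]) auto
  qed
  have w'_le: "norm (w' t) \<le> \<rho> * h t" for t
    using angular_derivative_le_magnetic_gradient[OF test yn[of t], of \<alpha>] ya[of t]
    by (simp add: w'_def norm_mult h_def)
  have ftc: "(w' has_integral (cis (- \<alpha> * (2 * pi)) * \<phi> (y (2 * pi)) - cis (- \<alpha> * 0) * \<phi> (y 0))) {0..2*pi}"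
    by (rule fundamental_theorem_of_calculus, simp, rule dw)
  have y0: "y 0 = x" "y (2 * pi) = x" by (simp_all add: y_def vec_eq_iff forall_2)
  have hint: "(\<lambda>t. \<rho> * h t) integrable_on {0..2*pi}"
    by (intro integrable_continuous_real continuous_intros continuous_on_subset[OF conth]) simp
  have set_int: "set_integrable lborel {0..2*pi} f" if "continuous_on UNIV f" for f :: "real \<Rightarrow> real"
    unfolding set_integrable_def by (rule borel_integrable_compact) (auto intro: continuous_on_subset[OF that])
  have indh2: "integrable lborel (\<lambda>t. (indicator {0..2*pi} t * h t)\<^sup>2)"
  proof -
    have "(\<lambda>t. (indicator {0..2*pi} t * h t)\<^sup>2) = (\<lambda>t. indicator {0..2*pi} t *\<^sub>R (h t)\<^sup>2)"
      by (auto simp: indicator_def)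
    moreover have "set_integrable lborel {0..2*pi} (\<lambda>t. (h t)\<^sup>2)"
      by (intro set_int continuous_on_power conth)
    ultimately show ?thesis by (simp add: set_integrable_def)
  qed
  have "norm (cis (- 2 * pi * \<alpha>) - 1) * norm (\<phi> x) = norm (cis (- \<alpha> * (2 * pi)) * \<phi> (y (2 * pi)) - cis (- \<alpha> * 0) * \<phi> (y 0))"
    unfolding y0 by (simp add: norm_mult[symmetric] algebra_simps)
  also have "\<dots> = norm (integral {0..2*pi} w')" using ftc by (simp add: integral_unique)
  also have "\<dots> \<le> integral {0..2*pi} (\<lambda>t. \<rho> * h t)"
    by (rule integral_norm_bound_integral) (use ftc hint w'_le in auto)
  also have "\<dots> = \<rho> * integral {0..2*pi} h" by simp
  also have "integral {0..2*pi} h = (\<integral>t. indicator {0..2*pi} t * (indicator {0..2*pi} t * h t) \<partial>lborel)"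
  proof -
    have "(\<integral>t. indicator {0..2*pi} t * (indicator {0..2*pi} t * h t) \<partial>lborel) = (LINT t : {0..2*pi} | lborel. h t)"
      unfolding set_lebesgue_integral_def by (rule Bochner_Integration.integral_cong) (auto simp: indicator_def)
    then show ?thesis using set_borel_integral_eq_integral(2)[OF set_int[OF conth]] by simp
  qed
  also have "\<dots> \<le> sqrt (\<integral>t. (indicator {0..2*pi} t)\<^sup>2 \<partial>lborel) * sqrt (\<integral>t. (indicator {0..2*pi} t * h t)\<^sup>2 \<partial>lborel)"
  proof (rule Cauchy_Schwarz_integral(2))
    have hm: "h \<in> borel_measurable borel" using conth by (rule borel_measurable_continuous_onI)
    then show "(\<lambda>t. indicator {0..2*pi} t * h t) \<in> borel_measurable lborel" by simp
    have "(\<lambda>t. (indicator {0..2*pi} t :: real)\<^sup>2) = (\<lambda>t. indicator {0..2*pi} t *\<^sub>R 1)"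
      by (auto simp: indicator_def)
    then show "integrable lborel (\<lambda>t. (indicator {0..2*pi} t :: real)\<^sup>2)"
      using set_int[of "\<lambda>_. 1"] by (simp add: set_integrable_def)
    show "integrable lborel (\<lambda>t. (indicator {0..2*pi} t * h t)\<^sup>2)"
      by (rule indh2)
  qed simp
  also have "(\<integral>t. (indicator {0..2*pi} t :: real)\<^sup>2 \<partial>lborel) = 2 * pi"
  proof -
    have "(\<lambda>t. (indicator {0..2*pi} t :: real)\<^sup>2) = indicator {0..2*pi}" by (auto simp: indicator_def)
    then show ?thesis by simp
  qed
  finally have "norm (cis (- 2 * pi * \<alpha>) - 1) * norm (\<phi> x)
     \<le> \<rho> * (sqrt (2 * pi) * sqrt (\<integral>t. (indicator {0..2*pi} t * h t)\<^sup>2 \<partial>lborel))"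
    using \<rho> by simp
  then have "norm (cis (- 2 * pi * \<alpha>) - 1) * (norm (\<phi> x) / \<rho>)
     \<le> sqrt (2 * pi) * sqrt (\<integral>t. (indicator {0..2*pi} t * h t)\<^sup>2 \<partial>lborel)"
    using \<rho> by (simp add: field_simps)
  then have sq: "(norm (cis (- 2 * pi * \<alpha>) - 1) * (norm (\<phi> x) / \<rho>))\<^sup>2
     \<le> (sqrt (2 * pi) * sqrt (\<integral>t. (indicator {0..2*pi} t * h t)\<^sup>2 \<partial>lborel))\<^sup>2"
    using \<rho> by (intro power_mono) auto
  have main: "(norm (cis (- 2 * pi * \<alpha>) - 1))\<^sup>2 * (norm (\<phi> x) / \<rho>)\<^sup>2
     \<le> 2 * pi * (\<integral>t. (indicator {0..2*pi} t * h t)\<^sup>2 \<partial>lborel)"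
  proof -
    have "p\<^sup>2 * q\<^sup>2 \<le> r * I" if "(p * q)\<^sup>2 \<le> (sqrt r * sqrt I)\<^sup>2" "0 \<le> r" "0 \<le> I" for p q r I :: real
      using that by (simp add: power_mult_distrib)
    from this[OF sq] show ?thesis by simp
  qed
  have "ennreal (\<integral>t. (indicator {0..2*pi} t * h t)\<^sup>2 \<partial>lborel) = (\<integral>\<^sup>+t. ennreal ((indicator {0..2*pi} t * h t)\<^sup>2) \<partial>lborel)"
  proof (rule nn_integral_eq_integral[symmetric])
    show "integrable lborel (\<lambda>t. (indicator {0..2*pi} t * h t)\<^sup>2)"
      by (rule indh2)
  qed simp
  also have "\<dots> = (\<integral>\<^sup>+t. indicator {0..2*pi} t * ennreal ((h t)\<^sup>2) \<partial>lborel)"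
    by (rule nn_integral_cong) (auto simp: indicator_def)
  finally have "ennreal (2 * pi * (\<integral>t. (indicator {0..2*pi} t * h t)\<^sup>2 \<partial>lborel))
     = ennreal (2 * pi) * (\<integral>\<^sup>+t. indicator {0..2*pi} t * ennreal ((h t)\<^sup>2) \<partial>lborel)"
    by (simp add: ennreal_mult)
  then show ?thesis using ennreal_leI[OF main] unfolding h_def y_def \<rho>_def by simp
qed

text \<open>
  Integrate the inequality on circles over all starting points \<open>x\<close> and exchange the integrals. As rotations
  preserve the Lebesgue measure, every angle contributes the same integral of the squared magnetic gradient.
\<close>

lemma Hardy_inequality:
  assumes test: "\<phi> \<in> test_functions (\<Omega> - {a})" and op: "open \<Omega>"
  shows "sq_integrable \<Omega> (\<lambda>x. norm (\<phi> x) / norm (x - a))"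
    and "norm (cis (- 2 * pi * \<alpha>) - 1) * L2_norm \<Omega> (\<lambda>x. norm (\<phi> x) / norm (x - a))
      \<le> 2 * pi * magnetic_norm \<alpha> \<Omega> a \<phi>"
proof -
  define w where "w x = norm (\<phi> x) / norm (x - a)" for x
  define D where "D = magnetic_gradient \<alpha> a \<phi>"
  define c where "c = norm (cis (- 2 * pi * \<alpha>) - 1)"
  have \<phi>c: "continuous_on UNIV \<phi>" using test unfolding test_functions_iff by (blast intro: smooth_on_continuous)
  have [measurable]: "\<phi> \<in> borel_measurable borel" using \<phi>c by (rule borel_measurable_continuous_onI)
  have wm[measurable]: "w \<in> borel_measurable borel" unfolding w_def[abs_def] by measurable
  obtain K where K: "compact K" "K \<subseteq> \<Omega> - {a}" "\<And>x. x \<notin> K \<Longrightarrow> \<phi> x = 0" "\<And>x. x \<notin> K \<Longrightarrow> D x = 0"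
    and Dc: "continuous_on UNIV D"
    using magnetic_gradient_test_support[OF test, of \<alpha>] unfolding D_def by blast
  have Dm[measurable]: "D \<in> borel_measurable borel" using Dc by (rule borel_measurable_continuous_onI)
  have o: "open (- {a})" by auto
  have "smooth_on (- {a}) (\<lambda>x. inverse ((norm (x - a))\<^sup>2))"
    by (rule smooth_on_compose_real[OF o, of "- {0}"])
      (auto intro: smooth_on_inverse smooth_on_subset[OF smooth_on_norm_power2])
  then have "smooth_on (- {a}) (\<lambda>x. complex_of_real (inverse ((norm (x - a))\<^sup>2)))"
    by (intro smooth_on_linear_compose[OF bounded_linear_of_real] o)
  then have "(\<lambda>x. complex_of_real (inverse ((norm (x - a))\<^sup>2)) * \<phi> x) \<in> test_functions (\<Omega> - {a})"
    by (intro test_function_mult[OF test o]) auto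
  then have "continuous_on UNIV (\<lambda>x. complex_of_real (inverse ((norm (x - a))\<^sup>2)) * \<phi> x)"
    unfolding test_functions_iff by (blast intro: smooth_on_continuous)
  then have "continuous_on UNIV (\<lambda>x. norm (complex_of_real (inverse ((norm (x - a))\<^sup>2)) * \<phi> x) * norm (\<phi> x))"
    by (rule continuous_on_mult[OF continuous_on_norm continuous_on_norm[OF \<phi>c]])
  moreover have "norm (complex_of_real (inverse ((norm (x - a))\<^sup>2)) * \<phi> x) * norm (\<phi> x) = (norm (w x))\<^sup>2" for x
    by (simp add: w_def norm_mult norm_inverse norm_power power_divide divide_inverse power2_eq_square)
  ultimately have w2c: "continuous_on UNIV (\<lambda>x. (norm (w x))\<^sup>2)" by simp
  have w0: "w x = 0" if "x \<notin> K" for x using K(3)[OF that] by (simp add: w_def)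
  have wint: "integrable lborel (\<lambda>x. (norm (w x))\<^sup>2)"
    by (rule integrable_continuous_compact_support[OF w2c K(1)]) (simp add: w0)
  have Dint: "integrable lborel (\<lambda>x. (norm (D x))\<^sup>2)"
    by (rule integrable_continuous_compact_support[OF _ K(1)]) (auto intro!: continuous_intros Dc simp: K(4))
  show "sq_integrable \<Omega> (\<lambda>x. norm (\<phi> x) / norm (x - a))"
    using sq_integrable_if_lborel[OF wm wint op] unfolding w_def[abs_def] .
  have w2: "(L2_norm \<Omega> w)\<^sup>2 = (\<integral>x. (norm (w x))\<^sup>2 \<partial>lborel)"
    unfolding L2_norm_power2 using K(2) w0 op by (intro integral_lebesgue_on_eq_lborel) auto
  have D2: "(magnetic_norm \<alpha> \<Omega> a \<phi>)\<^sup>2 = (\<integral>x. (norm (D x))\<^sup>2 \<partial>lborel)"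
    unfolding magnetic_norm_def L2_norm_power2 D_def[symmetric] using K op
    by (intro integral_lebesgue_on_eq_lborel) auto
  define G where "G t x = indicator {0..2*pi} t * ennreal ((norm (D (a + rot t (x - a))))\<^sup>2)" for t :: real and x
  have Gm: "case_prod G \<in> borel_measurable (lborel \<Otimes>\<^sub>M lborel)"
  proof -
    have "continuous_on UNIV (\<lambda>z :: real \<times> (real^2). a + (cos (fst z) *\<^sub>R (snd z - a) + sin (fst z) *\<^sub>R perp (snd z - a)))"
    proof -
      have "continuous_on UNIV perp"
        using linear_perp by (simp add: linear_continuous_on linear_conv_bounded_linear)
      then have "continuous_on UNIV (\<lambda>z :: real \<times> (real^2). perp (snd z - a))"
        by (rule continuous_on_compose2) (auto intro!: continuous_intros)
      then show ?thesis by (intro continuous_intros)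
    qed
    then have "continuous_on UNIV (\<lambda>z :: real \<times> (real^2). a + rot (fst z) (snd z - a))"
      by (simp add: rot_eq_perp)
    then have "(\<lambda>z :: real \<times> (real^2). a + rot (fst z) (snd z - a)) \<in> borel_measurable (borel \<Otimes>\<^sub>M borel)"
      unfolding borel_prod by (rule borel_measurable_continuous_onI)
    from measurable_compose[OF measurable_compose[OF this Dm] borel_measurable_continuous_onI[OF continuous_on_norm_id]]
    have "(\<lambda>z. norm (D (a + rot (fst z) (snd z - a)))) \<in> borel_measurable (borel \<Otimes>\<^sub>M borel)" .
    moreover have "(\<lambda>z :: real \<times> (real^2). indicator {0..2*pi} (fst z) :: ennreal) \<in> borel_measurable (borel \<Otimes>\<^sub>M borel)"
      by measurable
    ultimately have "(\<lambda>z. indicator {0..2*pi} (fst z) * ennreal ((norm (D (a + rot (fst z) (snd z - a))))\<^sup>2)) \<in> borel_measurable (borel \<Otimes>\<^sub>M borel)"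
      by (intro borel_measurable_times_ennreal measurable_compose[OF _ measurable_ennreal] borel_measurable_power)
    moreover have "sets (lborel \<Otimes>\<^sub>M lborel) = sets (borel \<Otimes>\<^sub>M borel :: (real \<times> (real^2)) measure)"
      by (intro sets_pair_measure_cong) auto
    ultimately show ?thesis
      unfolding G_def case_prod_unfold by (subst measurable_cong_sets[OF _ refl, of _ "borel \<Otimes>\<^sub>M borel"])
  qed
  have Dm2: "(\<lambda>x. ennreal ((norm (D x))\<^sup>2)) \<in> borel_measurable borel" by measurable
  have "ennreal (c\<^sup>2 * (L2_norm \<Omega> w)\<^sup>2) = (\<integral>\<^sup>+x. ennreal (c\<^sup>2 * (norm (w x))\<^sup>2) \<partial>lborel)"
    unfolding w2 using wint by (subst nn_integral_eq_integral) auto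
  also have "\<dots> \<le> (\<integral>\<^sup>+x. ennreal (2 * pi) * (\<integral>\<^sup>+t. G t x \<partial>lborel) \<partial>lborel)"
  proof (rule nn_integral_mono)
    fix x
    show "ennreal (c\<^sup>2 * (norm (w x))\<^sup>2) \<le> ennreal (2 * pi) * (\<integral>\<^sup>+t. G t x \<partial>lborel)"
    proof (cases "x = a")
      case True then show ?thesis by (simp add: w_def)
    next
      case False
      show ?thesis using circle_inequality[OF test False, of \<alpha>]
        by (simp add: G_def D_def c_def w_def)
    qed
  qed
  also have "\<dots> = ennreal (2 * pi) * (\<integral>\<^sup>+x. (\<integral>\<^sup>+t. G t x \<partial>lborel) \<partial>lborel)"
  proof (rule nn_integral_cmult)
    have "(\<lambda>(x, t). G t x) \<in> borel_measurable (lborel \<Otimes>\<^sub>M lborel)"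
      using measurable_pair_swap[OF Gm] by simp
    then show "(\<lambda>x. \<integral>\<^sup>+t. G t x \<partial>lborel) \<in> borel_measurable lborel"
      by (rule lborel.borel_measurable_nn_integral)
  qed
  also have "(\<integral>\<^sup>+x. (\<integral>\<^sup>+t. G t x \<partial>lborel) \<partial>lborel) = (\<integral>\<^sup>+t. (\<integral>\<^sup>+x. G t x \<partial>lborel) \<partial>lborel)"
    by (rule lborel_pair.Fubini'[OF Gm])
  also have "\<dots> = (\<integral>\<^sup>+t. indicator {0..2*pi} t * (\<integral>\<^sup>+x. ennreal ((norm (D x))\<^sup>2) \<partial>lborel) \<partial>lborel)"
  proof (rule nn_integral_cong)
    fix t
    have m: "(\<lambda>x. ennreal ((norm (D (a + rot t (x - a))))\<^sup>2)) \<in> borel_measurable lborel"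
    proof -
      have [measurable]: "rot t \<in> borel_measurable borel" using continuous_rot by (rule borel_measurable_continuous_onI)
      show ?thesis by measurable
    qed
    show "(\<integral>\<^sup>+x. G t x \<partial>lborel) = indicator {0..2*pi} t * (\<integral>\<^sup>+x. ennreal ((norm (D x))\<^sup>2) \<partial>lborel)"
      unfolding G_def nn_integral_cmult[OF m] nn_integral_rot[OF Dm2] ..
  qed
  also have "\<dots> = ennreal (2 * pi) * (\<integral>\<^sup>+x. ennreal ((norm (D x))\<^sup>2) \<partial>lborel)"
    by (subst nn_integral_multc) (auto simp: nn_integral_indicator)
  also have "(\<integral>\<^sup>+x. ennreal ((norm (D x))\<^sup>2) \<partial>lborel) = ennreal ((magnetic_norm \<alpha> \<Omega> a \<phi>)\<^sup>2)"
    unfolding D2 by (rule nn_integral_eq_integral[OF Dint]) simp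
  finally have le: "ennreal (c\<^sup>2 * (L2_norm \<Omega> w)\<^sup>2)
      \<le> ennreal (2 * pi) * (ennreal (2 * pi) * ennreal ((magnetic_norm \<alpha> \<Omega> a \<phi>)\<^sup>2))" .
  have e: "ennreal p * (ennreal p * ennreal m) = ennreal (p * (p * m))" if "0 \<le> p" "0 \<le> m" for p m
    using that by (simp add: ennreal_mult)
  have "ennreal (c\<^sup>2 * (L2_norm \<Omega> w)\<^sup>2) \<le> ennreal (2 * pi * (2 * pi * (magnetic_norm \<alpha> \<Omega> a \<phi>)\<^sup>2))"
    using le by (subst (asm) e) auto
  then have "c\<^sup>2 * (L2_norm \<Omega> w)\<^sup>2 \<le> 2 * pi * (2 * pi * (magnetic_norm \<alpha> \<Omega> a \<phi>)\<^sup>2)"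
    by (subst (asm) ennreal_le_iff) auto
  then have "(c * L2_norm \<Omega> w)\<^sup>2 \<le> (2 * pi * magnetic_norm \<alpha> \<Omega> a \<phi>)\<^sup>2"
    by (simp add: power_mult_distrib power2_eq_square algebra_simps)
  then show "norm (cis (- 2 * pi * \<alpha>) - 1) * L2_norm \<Omega> (\<lambda>x. norm (\<phi> x) / norm (x - a)) \<le> 2 * pi * magnetic_norm \<alpha> \<Omega> a \<phi>"
    unfolding c_def[symmetric] w_def[abs_def, symmetric]
    by (rule power2_le_imp_le) (simp add: magnetic_norm_nonneg)
qed

section \<open>Continuity of the eigenvalues in the pole\<close>

text \<open>
  How the inversion in the unit sphere distorts distances. The Aharonov-Bohm potential is an
  inversion followed by a quarter turn.
\<close>

lemma norm_inversion_diff: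
  fixes u v :: "'a::real_inner"
  assumes "u \<noteq> 0" "v \<noteq> 0"
  shows "norm ((1 / (norm u)\<^sup>2) *\<^sub>R u - (1 / (norm v)\<^sup>2) *\<^sub>R v) = norm (u - v) / (norm u * norm v)"
proof (rule power2_eq_imp_eq)
  define p q r where "p = (norm u)\<^sup>2" and "q = (norm v)\<^sup>2" and "r = u \<bullet> v"
  have pq: "p > 0" "q > 0" using assms by (auto simp: p_def q_def)
  have uu: "u \<bullet> u = p" "v \<bullet> v = q" by (auto simp: p_def q_def power2_norm_eq_inner)
  have 1: "(norm ((1 / p) *\<^sub>R u - (1 / q) *\<^sub>R v))\<^sup>2 = (1 / p) * (1 / p) * p - 2 * ((1 / p) * (1 / q) * r) + (1 / q) * (1 / q) * q"
    unfolding power2_norm_eq_inner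
    using pq by (simp add: inner_diff_left inner_diff_right uu inner_commute[of v u] field_simps flip: r_def)
  have 2: "(norm (u - v))\<^sup>2 = p - 2 * r + q"
    unfolding power2_norm_eq_inner
    by (simp add: inner_diff_left inner_diff_right uu inner_commute[of v u] flip: r_def)
  show "(norm ((1 / (norm u)\<^sup>2) *\<^sub>R u - (1 / (norm v)\<^sup>2) *\<^sub>R v))\<^sup>2 = (norm (u - v) / (norm u * norm v))\<^sup>2"
    unfolding power_divide power_mult_distrib 2 p_def[symmetric] q_def[symmetric] 1
    using pq by (simp add: divide_simps)
qed (auto intro: divide_nonneg_nonneg)

lemma AB_potential_eq_perp: "AB_potential \<alpha> a x = \<alpha> *\<^sub>R perp ((1 / (norm (x - a))\<^sup>2) *\<^sub>R (x - a))"
  by (simp add: vec_eq_iff forall_2 AB_potential_nth right_diff_distrib diff_divide_distrib)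

lemma norm_AB_potential_diff:
  assumes "x \<noteq> a" "x \<noteq> b"
  shows "norm (AB_potential \<alpha> b x - AB_potential \<alpha> a x) = \<bar>\<alpha>\<bar> * norm (a - b) / (norm (x - a) * norm (x - b))"
proof -
  have "norm (AB_potential \<alpha> b x - AB_potential \<alpha> a x)
      = \<bar>\<alpha>\<bar> * norm ((1 / (norm (x - b))\<^sup>2) *\<^sub>R (x - b) - (1 / (norm (x - a))\<^sup>2) *\<^sub>R (x - a))"
    unfolding AB_potential_eq_perp scaleR_diff_right[symmetric] linear_diff[OF linear_perp, symmetric]
    by (simp add: norm_perp)
  then show ?thesis using norm_inversion_diff[of "x - b" "x - a"] assms by (simp add: mult.commute)
qed

lemma complex_scaleR_of_real_mult: "r *\<^sub>R (z::complex) = of_real r * z"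
  by (rule scaleR_conv_of_real)

lemma norm_magnetic_gradient_real_mult:
  fixes \<eta> :: "real^2 \<Rightarrow> real"
  assumes "(\<eta> has_derivative (\<lambda>v. P \<bullet> v)) (at x)" "0 \<le> \<eta> x" "\<eta> x \<le> 1"
    and "(\<phi> has_derivative \<phi>') (at x)"
  shows "norm (magnetic_gradient \<alpha> b (\<lambda>x. of_real (\<eta> x) * \<phi> x) x)
    \<le> norm (magnetic_gradient \<alpha> a \<phi> x) + (norm P + norm (AB_potential \<alpha> b x - AB_potential \<alpha> a x) * \<eta> x) * norm (\<phi> x)"
proof -
  define Q where "Q = AB_potential \<alpha> b x - AB_potential \<alpha> a x"
  define D where "D = magnetic_gradient \<alpha> a \<phi> x"
  define V :: "complex^2" where "V = (\<chi> k. (\<i> * of_real (P $ k) + of_real (Q $ k * \<eta> x)) * \<phi> x)"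
  have der: "((\<lambda>x. complex_of_real (\<eta> x)) has_derivative (\<lambda>v. of_real (P \<bullet> v))) (at x)"
    by (rule has_derivative_of_real[OF assms(1)])
  have "magnetic_gradient \<alpha> b (\<lambda>x. of_real (\<eta> x) * \<phi> x) x = \<eta> x *\<^sub>R D + V"
    unfolding vec_eq_iff vector_add_component vector_scaleR_component
    by (auto simp: magnetic_gradient_mult[OF der assms(4), where a=a] D_def V_def Q_def inner_axis
        complex_scaleR_of_real_mult)
  then have "norm (magnetic_gradient \<alpha> b (\<lambda>x. of_real (\<eta> x) * \<phi> x) x) \<le> norm (\<eta> x *\<^sub>R D) + norm V"
    using norm_triangle_ineq by metis
  also have "norm (\<eta> x *\<^sub>R D) \<le> norm D"
    using assms(2,3) by (simp add: mult_left_le_one_le)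
  also have "norm V \<le> (norm P + norm Q * \<eta> x) * norm (\<phi> x)"
  proof (rule power2_le_imp_le)
    have c: "(norm (\<i> * of_real p + of_real q))\<^sup>2 = p\<^sup>2 + q\<^sup>2" for p q :: real
      by (simp add: cmod_power2)
    have "(norm V)\<^sup>2 = ((P$1)\<^sup>2 + (Q$1 * \<eta> x)\<^sup>2) * (norm (\<phi> x))\<^sup>2 + ((P$2)\<^sup>2 + (Q$2 * \<eta> x)\<^sup>2) * (norm (\<phi> x))\<^sup>2"
      unfolding norm_complex2_power2 V_def by (simp add: norm_mult power_mult_distrib c del: of_real_mult)
    also have "\<dots> = ((norm P)\<^sup>2 + (norm Q * \<eta> x)\<^sup>2) * (norm (\<phi> x))\<^sup>2"
      by (simp add: norm_real2_power2 power_mult_distrib algebra_simps)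
    also have "\<dots> \<le> (norm P + norm Q * \<eta> x)\<^sup>2 * (norm (\<phi> x))\<^sup>2"
      using assms(2) by (intro mult_right_mono) (auto simp: power2_sum)
    finally show "(norm V)\<^sup>2 \<le> ((norm P + norm Q * \<eta> x) * norm (\<phi> x))\<^sup>2" by (simp add: power_mult_distrib)
  qed (use assms(2) in auto)
  finally show ?thesis by (simp add: D_def Q_def)
qed

text \<open>
  A smooth step applied to a multiple of \<open>ln |x - a|\<close>. The gradient decays like the weight in Hardy's
  inequality, with an arbitrarily small constant \<open>\<delta>\<close>, at the price of an inner radius \<open>r1\<close> that is
  exponentially small in \<open>1 / \<delta>\<close>. One \<open>r1\<close> serves all centres \<open>a\<close>, which makes the final estimate uniform.
\<close>

lemma log_cutoff_exists:
  fixes \<delta> :: real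
  assumes "\<delta> > 0" "r > 0"
  obtains r1 where "0 < r1"
    "\<And>a :: real^2. \<exists>\<eta> P. smooth_on UNIV \<eta> \<and> (\<forall>x. 0 \<le> \<eta> x \<and> \<eta> x \<le> 1) \<and>
       (\<forall>x. norm (x - a) < r1 \<longrightarrow> \<eta> x = 0) \<and> (\<forall>x. norm (x - a) \<ge> r \<longrightarrow> \<eta> x = (1::real)) \<and>
       (\<forall>x. (\<eta> has_derivative (\<lambda>v. P x \<bullet> v)) (at x) \<and> norm (P x) \<le> \<delta> / norm (x - a))"
proof -
  obtain \<sigma> :: "real \<Rightarrow> real" where \<sigma>: "smooth_on UNIV \<sigma>" "\<And>t. t \<le> 0 \<Longrightarrow> \<sigma> t = 0" "\<And>t. t \<ge> 1 \<Longrightarrow> \<sigma> t = 1"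
    "\<And>t. 0 \<le> \<sigma> t \<and> \<sigma> t \<le> 1" using smooth_step_exists by blast
  obtain \<sigma>' C where \<sigma>': "\<And>t. (\<sigma> has_real_derivative \<sigma>' t) (at t)" "\<And>t. \<bar>\<sigma>' t\<bar> \<le> C" "C > 0"
    using smooth_on_derivative_bounded[OF \<sigma>(1-3)] by blast
  \<comment> \<open>The logarithm of \<open>|x - a|\<^sup>2\<close> has a gradient of length \<open>2 / |x - a|\<close>.\<close>
  define \<kappa> where "\<kappa> = \<delta> / (2 * C)"
  have \<kappa>: "\<kappa> > 0" "2 * \<kappa> * C = \<delta>" using assms \<sigma>'(3) by (auto simp: \<kappa>_def)
  \<comment> \<open>With this inner radius the argument \<open>s\<close> of the step runs from 0 to 1 as \<open>|x - a|\<close> runs from \<open>r1\<close> to \<open>r\<close>.\<close>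
  define r1 where "r1 = r * exp (- 1 / (2 * \<kappa>))"
  have r1: "r1 > 0" using assms by (simp add: r1_def)
  have lnr: "ln (r1\<^sup>2) = ln (r\<^sup>2) - 1 / \<kappa>"
    using assms \<kappa> by (simp add: r1_def power_mult_distrib ln_mult ln_realpow)
  show thesis
  proof (rule that[OF r1])
    fix a :: "real^2"
    define s where "s x = \<kappa> * (ln ((norm (x - a))\<^sup>2) - ln (r1\<^sup>2))" for x
    \<comment> \<open>The case distinction matters only at \<open>a\<close>, where the logarithm has the default value zero.\<close>
    define \<eta> where "\<eta> x = (if norm (x - a) < r1 then 0 else \<sigma> (s x))" for x
    define P where "P x = (if x = a then 0 else (\<sigma>' (s x) * \<kappa> * 2 / (norm (x - a))\<^sup>2) *\<^sub>R (x - a))" for x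
    have \<eta>_eq: "\<eta> x = \<sigma> (s x)" if "x \<noteq> a" for x
    proof (cases "norm (x - a) < r1")
      case True
      then have "ln ((norm (x - a))\<^sup>2) \<le> ln (r1\<^sup>2)"
        using that r1 by (subst ln_le_cancel_iff) (auto intro!: power_mono)
      then have "s x \<le> 0" using \<kappa>(1) by (simp add: s_def mult_le_0_iff)
      then show ?thesis using True \<sigma>(2) by (simp add: \<eta>_def)
    qed (simp add: \<eta>_def)
    have o: "open (- {a})" by auto
    have "smooth_on (- {a}) (\<lambda>x. ln ((norm (x - a))\<^sup>2))"
      by (rule smooth_on_compose_real[OF o, of "{0<..}"])
        (auto intro: smooth_on_ln smooth_on_subset[OF smooth_on_norm_power2])
    then have "smooth_on (- {a}) s" unfolding s_def[abs_def]
      by (intro smooth_on_mult smooth_on_diff smooth_on_const o)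
    then have "smooth_on (- {a}) (\<lambda>x. \<sigma> (s x))"
      by (intro smooth_on_compose_real[OF o open_UNIV _ _ \<sigma>(1)]) auto
    then have sm1: "smooth_on (- {a}) \<eta>"
      using smooth_on_cong[OF o, of \<eta> "\<lambda>x. \<sigma> (s x)"] \<eta>_eq by auto
    have ball0: "\<eta> x = 0" if "x \<in> ball a r1" for x
      using that by (simp add: \<eta>_def dist_norm norm_minus_commute)
    have sm2: "smooth_on (ball a r1) \<eta>"
      using smooth_on_cong[OF open_ball, of a r1 \<eta> "\<lambda>x. 0"] ball0 smooth_on_const[of "ball a r1" "0::real"] by auto
    have "- {a} \<union> ball a r1 = UNIV" using r1 by auto
    then have sm: "smooth_on UNIV \<eta>" using smooth_on_Un[OF o open_ball sm1 sm2] by simp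
    have der: "(\<eta> has_derivative (\<lambda>v. P x \<bullet> v)) (at x)" for x
    proof (cases "x = a")
      case True
      have "((\<lambda>x. 0) has_derivative (\<lambda>v. P x \<bullet> v)) (at x)" using True by (simp add: P_def)
      then show ?thesis
        by (rule has_derivative_transform_within_open[of _ _ _ _ "ball a r1"]) (use True r1 ball0 in auto)
    next
      case False
      have n: "(norm (x - a))\<^sup>2 > 0" using False by simp
      have 1: "((\<lambda>x. (norm (x - a))\<^sup>2) has_derivative (\<lambda>v. 2 * ((x - a) \<bullet> v))) (at x)"
        unfolding power2_norm_eq_inner
        by (rule has_derivative_eq_rhs, rule has_derivative_inner) (auto intro!: derivative_eq_intros simp: inner_commute)
      have 2: "(s has_derivative (\<lambda>v. \<kappa> * (inverse ((norm (x - a))\<^sup>2) * (2 * ((x - a) \<bullet> v))))) (at x)"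
        unfolding s_def[abs_def]
        by (rule has_derivative_eq_rhs, rule has_derivative_mult_right, rule has_derivative_diff,
            rule has_derivative_compose[OF 1 DERIV_ln[OF n, unfolded has_field_derivative_def]], rule has_derivative_const)
           auto
      have 3: "((\<lambda>x. \<sigma> (s x)) has_derivative (\<lambda>v. \<sigma>' (s x) * (\<kappa> * (inverse ((norm (x - a))\<^sup>2) * (2 * ((x - a) \<bullet> v)))))) (at x)"
        by (rule has_derivative_compose[OF 2 \<sigma>'(1)[unfolded has_field_derivative_def]])
      have 4: "(\<lambda>v. \<sigma>' (s x) * (\<kappa> * (inverse ((norm (x - a))\<^sup>2) * (2 * ((x - a) \<bullet> v))))) = (\<lambda>v. P x \<bullet> v)"
        using False by (simp add: P_def fun_eq_iff divide_inverse)
      show ?thesis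
        by (rule has_derivative_transform_within_open[OF 3[unfolded 4] o]) (use False \<eta>_eq in auto)
    qed
    have Pb: "norm (P x) \<le> \<delta> / norm (x - a)" for x
    proof (cases "x = a")
      case False
      then have "norm (P x) = (\<bar>\<sigma>' (s x)\<bar> * (2 * \<kappa>)) / norm (x - a)"
        using \<kappa>(1) by (simp add: P_def abs_mult power2_eq_square)
      also have "\<dots> \<le> (C * (2 * \<kappa>)) / norm (x - a)"
        using \<sigma>'(2)[of "s x"] \<kappa>(1) by (intro divide_right_mono mult_right_mono) auto
      finally show ?thesis using \<kappa>(2) by (simp add: mult.commute)
    qed (simp add: P_def)
    have one: "\<eta> x = 1" if x: "norm (x - a) \<ge> r" for x
    proof -
      have "x \<noteq> a" using x assms by auto
      have "ln (r\<^sup>2) \<le> ln ((norm (x - a))\<^sup>2)"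
        using x assms \<open>x \<noteq> a\<close> by (subst ln_le_cancel_iff) (auto intro!: power_mono)
      then have "\<kappa> * (1 / \<kappa>) \<le> s x" unfolding s_def lnr using \<kappa>(1) by (intro mult_left_mono) auto
      then show ?thesis using \<eta>_eq[OF \<open>x \<noteq> a\<close>] \<sigma>(3) \<kappa>(1) by simp
    qed
    have "0 \<le> \<eta> x \<and> \<eta> x \<le> 1" for x using \<sigma>(4) by (simp add: \<eta>_def)
    moreover have "\<eta> x = 0" if "norm (x - a) < r1" for x using that by (simp add: \<eta>_def)
    ultimately show "\<exists>\<eta> P. smooth_on UNIV \<eta> \<and> (\<forall>x. 0 \<le> \<eta> x \<and> \<eta> x \<le> 1) \<and>
       (\<forall>x. norm (x - a) < r1 \<longrightarrow> \<eta> x = 0) \<and> (\<forall>x. norm (x - a) \<ge> r \<longrightarrow> \<eta> x = (1::real)) \<and>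
       (\<forall>x. (\<eta> has_derivative (\<lambda>v. P x \<bullet> v)) (at x) \<and> norm (P x) \<le> \<delta> / norm (x - a))"
      using sm one der Pb by blast
  qed
qed

lemma cis_2pi_neq_1:
  assumes "0 < \<alpha>" "\<alpha> < 1"
  shows "norm (cis (- 2 * pi * \<alpha>) - 1) > 0"
proof -
  have "sin (pi * \<alpha>) > 0" using assms by (intro sin_gt_zero) auto
  then have "cos (2 * (pi * \<alpha>)) \<noteq> 1" using cos_double_sin[of "pi * \<alpha>"] by auto
  then have "cis (- 2 * pi * \<alpha>) \<noteq> 1" by (auto simp: complex_eq_iff mult.assoc)
  then show ?thesis by simp
qed

text \<open>
  Three errors have to be at most \<open>d\<close>. The gradient of the cutoff costs \<open>(d / H) \<parallel>\<phi> / |x - a|\<parallel>\<close> and the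
  part of \<open>\<phi>\<close> that is cut off has \<open>L\<^sup>2\<close> norm at most \<open>(d / H) \<parallel>\<phi> / |x - a|\<parallel>\<close>, as it lives within
  distance \<open>d / H\<close> of the pole; by Hardy's inequality with constant \<open>H\<close> both are at most
  \<open>d\<close> times the magnetic norm. The third error is the change of the potential away from both poles.
\<close>

lemma cutoff_transplants:
  assumes op: "open \<Omega>" and \<alpha>: "0 < \<alpha>" "\<alpha> < 1" and d: "d > 0"
  obtains \<rho> where "\<rho> > 0" "\<And>a b. norm (a - b) < \<rho> \<Longrightarrow> \<exists>g. transplants \<alpha> \<Omega> d g a b"
proof -
  define H where "H = 2 * pi / norm (cis (- 2 * pi * \<alpha>) - 1)"
  note c0 = cis_2pi_neq_1[OF \<alpha>]
  have H: "H > 0" unfolding H_def using c0 pi_gt_zero by (intro divide_pos_pos) linarith+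
  have r: "d / H > 0" using d H by simp
  obtain r1 where r1: "r1 > 0"
    "\<And>a :: real^2. \<exists>\<eta> P. smooth_on UNIV \<eta> \<and> (\<forall>x. 0 \<le> \<eta> x \<and> \<eta> x \<le> 1) \<and>
       (\<forall>x. norm (x - a) < r1 \<longrightarrow> \<eta> x = 0) \<and> (\<forall>x. norm (x - a) \<ge> d / H \<longrightarrow> \<eta> x = (1::real)) \<and>
       (\<forall>x. (\<eta> has_derivative (\<lambda>v. P x \<bullet> v)) (at x) \<and> norm (P x) \<le> (d / H) / norm (x - a))"
    using log_cutoff_exists[OF r r] by blast
  \<comment> \<open>The first bound keeps \<open>b\<close> well inside the hole of the cutoff, the second one makes the potentials differ
    by at most \<open>d\<close> outside of the hole.\<close>
  define \<rho> where "\<rho> = min (r1 / 2) (d * r1\<^sup>2 / 2)"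
  have \<rho>: "\<rho> > 0" "\<rho> \<le> r1 / 2" "\<rho> \<le> d * r1\<^sup>2 / 2" using d r1(1) by (auto simp: \<rho>_def)
  show thesis
  proof (rule that[OF \<rho>(1)])
    fix a b :: "real^2" assume ab: "norm (a - b) < \<rho>"
    obtain \<eta> P where \<eta>: "smooth_on UNIV \<eta>" "\<And>x. 0 \<le> \<eta> x \<and> \<eta> x \<le> 1"
      "\<And>x. norm (x - a) < r1 \<Longrightarrow> \<eta> x = 0" "\<And>x. norm (x - a) \<ge> d / H \<Longrightarrow> \<eta> x = (1::real)"
      "\<And>x. (\<eta> has_derivative (\<lambda>v. P x \<bullet> v)) (at x)" "\<And>x. norm (P x) \<le> (d / H) / norm (x - a)"
      using r1(2)[of a] by blast
    define g where "g x = complex_of_real (\<eta> x)" for x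
    have gs: "smooth_on UNIV g" unfolding g_def[abs_def]
      by (intro smooth_on_linear_compose[OF bounded_linear_of_real] \<eta>(1)) auto
    have potential: "norm (AB_potential \<alpha> b x - AB_potential \<alpha> a x) * \<eta> x \<le> d" for x
    proof (cases "norm (x - a) < r1")
      case True then show ?thesis using \<eta>(3) d by simp
    next
      case False
      have xb: "norm (x - b) \<ge> r1 / 2"
        using norm_triangle_ineq2[of "x - a" "b - a"] False ab \<rho>(2) by (simp add: norm_minus_commute)
      have xa: "norm (x - a) \<ge> r1" using False by simp
      have ne: "x \<noteq> a" "x \<noteq> b" using xa xb r1(1) by auto
      have "norm (AB_potential \<alpha> b x - AB_potential \<alpha> a x) \<le> 1 * (d * r1\<^sup>2 / 2) / (r1 * (r1 / 2))"
        unfolding norm_AB_potential_diff[OF ne]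
        using \<alpha> ab \<rho> xa xb r1(1) d by (intro frac_le mult_mono) auto
      also have "\<dots> = d" using r1(1) by (simp add: power2_eq_square)
      finally have "norm (AB_potential \<alpha> b x - AB_potential \<alpha> a x) * \<eta> x \<le> d * 1"
        using \<eta>(2)[of x] d by (intro mult_mono) auto
      then show ?thesis by simp
    qed
    have "transplants \<alpha> \<Omega> d g a b"
      unfolding transplants_def
    proof (intro conjI ballI)
      show "continuous_on \<Omega> g" using smooth_on_continuous[OF gs] continuous_on_subset by blast
      show "norm (g x) \<le> 1" for x using \<eta>(2)[of x] by (simp add: g_def)
      fix \<phi> assume \<phi>: "\<phi> \<in> test_functions (\<Omega> - {a})"
      define w where "w x = norm (\<phi> x) / norm (x - a)" for x
      have wsq: "sq_integrable \<Omega> w" unfolding w_def by (rule Hardy_inequality(1)[OF \<phi> op])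
      have wH: "L2_norm \<Omega> w \<le> H * magnetic_norm \<alpha> \<Omega> a \<phi>"
        using Hardy_inequality(2)[OF \<phi> op, of \<alpha>] c0
        unfolding w_def[symmetric] H_def by (simp add: field_simps)
      have \<phi>a: "\<phi> a = 0" using \<phi> unfolding test_functions_iff by blast
      obtain K where K: "smooth_on UNIV \<phi>" "compact K" "K \<subseteq> \<Omega> - {a}" "\<And>x. x \<notin> K \<Longrightarrow> \<phi> x = 0"
        using \<phi> unfolding test_functions_iff by blast
      show test: "(\<lambda>x. g x * \<phi> x) \<in> test_functions (\<Omega> - {b})"
        unfolding test_functions_iff
      proof (intro conjI exI)
        show "smooth_on UNIV (\<lambda>x. g x * \<phi> x)" by (intro smooth_on_mult gs K open_UNIV)
        show "compact (K - ball a r1)" using K(2) by (simp add: compact_diff)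
        show "K - ball a r1 \<subseteq> \<Omega> - {b}" using K(3) ab \<rho>(2) r1(1) by (auto simp: dist_norm)
        show "\<forall>x. x \<notin> K - ball a r1 \<longrightarrow> g x * \<phi> x = 0"
          using K(4) \<eta>(3) by (auto simp: g_def dist_norm norm_minus_commute)
      qed
      have \<phi>sq: "sq_integrable \<Omega> \<phi>" by (rule test_function_sq_integrable[OF \<phi> op])
      have Dsq: "sq_integrable \<Omega> (magnetic_gradient \<alpha> a \<phi>)" by (rule sq_integrable_magnetic_gradient[OF \<phi> op])
      define B where "B x = norm (magnetic_gradient \<alpha> a \<phi> x) + (d / H * w x + d * norm (\<phi> x))" for x
      have B2: "sq_integrable \<Omega> (\<lambda>x. d / H * w x + d * norm (\<phi> x))"
        by (intro sq_integrable_add sq_integrable_cmult wsq sq_integrable_norm \<phi>sq)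
      have Bsq: "sq_integrable \<Omega> B" unfolding B_def[abs_def]
        by (intro sq_integrable_add(1) sq_integrable_norm Dsq B2)
      have wnn: "0 \<le> w x" for x by (simp add: w_def)
      have pointwise: "norm (magnetic_gradient \<alpha> b (\<lambda>x. g x * \<phi> x) x) \<le> norm (B x)" for x
      proof -
        have "norm (magnetic_gradient \<alpha> b (\<lambda>x. g x * \<phi> x) x)
          \<le> norm (magnetic_gradient \<alpha> a \<phi> x) + (norm (P x) + norm (AB_potential \<alpha> b x - AB_potential \<alpha> a x) * \<eta> x) * norm (\<phi> x)"
          unfolding g_def
          using norm_magnetic_gradient_real_mult[OF \<eta>(5) _ _ test_function_has_derivative[OF \<phi>]] \<eta>(2) by blast
        also have "\<dots> \<le> norm (magnetic_gradient \<alpha> a \<phi> x) + ((d / H) / norm (x - a) + d) * norm (\<phi> x)"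
          by (intro add_left_mono mult_right_mono add_mono \<eta>(6) potential) auto
        also have "\<dots> = B x" by (simp add: B_def w_def algebra_simps)
        also have "\<dots> \<le> norm (B x)" by simp
        finally show ?thesis .
      qed
      have "magnetic_norm \<alpha> \<Omega> b (\<lambda>x. g x * \<phi> x) \<le> L2_norm \<Omega> B"
        unfolding magnetic_norm_def by (rule L2_norm_mono[OF Bsq pointwise])
      also have "\<dots> \<le> L2_norm \<Omega> (\<lambda>x. norm (magnetic_gradient \<alpha> a \<phi> x)) + L2_norm \<Omega> (\<lambda>x. d / H * w x + d * norm (\<phi> x))"
        unfolding B_def[abs_def] by (intro sq_integrable_add(2) sq_integrable_norm Dsq B2)
      also have "L2_norm \<Omega> (\<lambda>x. norm (magnetic_gradient \<alpha> a \<phi> x)) = magnetic_norm \<alpha> \<Omega> a \<phi>"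
        by (simp add: L2_norm_norm magnetic_norm_def)
      also have "L2_norm \<Omega> (\<lambda>x. d / H * w x + d * norm (\<phi> x)) \<le> L2_norm \<Omega> (\<lambda>x. d / H * w x) + L2_norm \<Omega> (\<lambda>x. d * norm (\<phi> x))"
        by (intro sq_integrable_add(2) sq_integrable_cmult wsq sq_integrable_norm \<phi>sq)
      also have "\<dots> = d / H * L2_norm \<Omega> w + d * L2_norm \<Omega> \<phi>"
        using L2_norm_cmult[of \<Omega> "d / H" w] L2_norm_cmult[of \<Omega> d "\<lambda>x. norm (\<phi> x)"] r d
        by (simp only: L2_norm_norm real_norm_def abs_of_pos)
      also have "d / H * L2_norm \<Omega> w \<le> d / H * (H * magnetic_norm \<alpha> \<Omega> a \<phi>)"
        using r by (intro mult_left_mono wH) auto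
      also have "\<dots> = d * magnetic_norm \<alpha> \<Omega> a \<phi>" using H by simp
      finally show "magnetic_norm \<alpha> \<Omega> b (\<lambda>x. g x * \<phi> x) \<le> (1 + d) * magnetic_norm \<alpha> \<Omega> a \<phi> + d * L2_norm \<Omega> \<phi>"
        by (simp add: algebra_simps)
      have gsq: "sq_integrable \<Omega> (\<lambda>x. g x * \<phi> x)" by (rule test_function_sq_integrable[OF test op])
      have rest: "norm (\<phi> x - g x * \<phi> x) \<le> norm (d / H * w x)" for x
      proof (cases "norm (x - a) \<ge> d / H")
        case True then show ?thesis using \<eta>(4) by (simp add: g_def)
      next
        case False
        have "\<phi> x - g x * \<phi> x = of_real (1 - \<eta> x) * \<phi> x" by (simp add: g_def algebra_simps)
        then have "norm (\<phi> x - g x * \<phi> x) = \<bar>1 - \<eta> x\<bar> * norm (\<phi> x)" by (simp only: norm_mult norm_of_real)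
        also have "\<dots> \<le> norm (\<phi> x)" using \<eta>(2)[of x] by (simp add: mult_left_le_one_le)
        also have "\<dots> = norm (x - a) * w x" using \<phi>a by (cases "x = a") (auto simp: w_def)
        also have "\<dots> \<le> d / H * w x" using False wnn by (intro mult_right_mono) auto
        also have "\<dots> \<le> norm (d / H * w x)" unfolding real_norm_def by (rule abs_ge_self)
        finally show ?thesis .
      qed
      have "L2_norm \<Omega> \<phi> = L2_norm \<Omega> (\<lambda>x. g x * \<phi> x + (\<phi> x - g x * \<phi> x))" by simp
      also have "\<dots> \<le> L2_norm \<Omega> (\<lambda>x. g x * \<phi> x) + L2_norm \<Omega> (\<lambda>x. \<phi> x - g x * \<phi> x)"
        by (intro sq_integrable_add(2) sq_integrable_diff(1) gsq \<phi>sq)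
      also have "L2_norm \<Omega> (\<lambda>x. \<phi> x - g x * \<phi> x) \<le> L2_norm \<Omega> (\<lambda>x. d / H * w x)"
        by (rule L2_norm_mono[OF sq_integrable_cmult[OF wsq] rest])
      also have "\<dots> = d / H * L2_norm \<Omega> w"
        using L2_norm_cmult[of \<Omega> "d / H" w] r by (simp only: real_norm_def abs_of_pos)
      also have "\<dots> \<le> d / H * (H * magnetic_norm \<alpha> \<Omega> a \<phi>)"
        using r by (intro mult_left_mono wH) auto
      also have "\<dots> = d * magnetic_norm \<alpha> \<Omega> a \<phi>" using H by simp
      finally show "L2_norm \<Omega> \<phi> \<le> L2_norm \<Omega> (\<lambda>x. g x * \<phi> x) + d * magnetic_norm \<alpha> \<Omega> a \<phi>" by simp
    qed
    then show "\<exists>g. transplants \<alpha> \<Omega> d g a b" by blast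
  qed
qed

lemma transplant_bound_le:
  fixes s d :: real
  assumes "0 \<le> s" "0 \<le> d" "d * s \<le> 1 / 2"
  shows "((1 + d) * s + d) / (1 - d * s) \<le> s + 2 * d * (1 + s + s\<^sup>2)"
proof -
  have "0 \<le> d * (1 + s + s\<^sup>2)" using assms by simp
  then have "d * (1 + s + s\<^sup>2) * 1 \<le> d * (1 + s + s\<^sup>2) * (2 * (1 - d * s))"
    using assms(3) by (intro mult_left_mono) auto
  then have "(1 + d) * s + d \<le> (s + 2 * d * (1 + s + s\<^sup>2)) * (1 - d * s)"
    by (simp add: algebra_simps power2_eq_square)
  then show ?thesis using assms(3) by (simp add: pos_divide_le_eq)
qed

text \<open>
  The comparison is used in both directions. From \<open>a\<close> to \<open>b\<close> it bounds the eigenvalue at \<open>b\<close> by that at \<open>a\<close>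
  plus a small error, and this bound makes the error in the direction from \<open>b\<close> to \<open>a\<close> uniform in \<open>b\<close>.
\<close>

lemma continuous_AB_eigenvalue:
  assumes op: "open \<Omega>" and \<alpha>: "0 < \<alpha>" "\<alpha> < 1" and j: "1 \<le> j"
    and ne: "\<And>a. H1_subspaces \<alpha> \<Omega> a j \<noteq> {}"
  shows "continuous_on UNIV (AB_eigenvalue \<alpha> \<Omega> j)"
proof -
  define s where "s a = sqrt (AB_eigenvalue \<alpha> \<Omega> j a)" for a
  have nn: "0 \<le> AB_eigenvalue \<alpha> \<Omega> j a" for a by (rule AB_eigenvalue_nonneg[OF op j ne])
  then have s0: "0 \<le> s a" and s2: "AB_eigenvalue \<alpha> \<Omega> j a = (s a)\<^sup>2" for a by (auto simp: s_def)
  have step: "s b \<le> s a + 2 * d * (1 + s a + (s a)\<^sup>2)"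
    if "transplants \<alpha> \<Omega> d g a b" "0 \<le> d" "d * s a \<le> 1 / 2" for a b d g
    using AB_eigenvalue_transplant[OF that(1,2) op j ne] that(3) transplant_bound_le[OF s0 that(2,3)]
    unfolding s_def[symmetric] by linarith
  have "\<exists>\<rho>>0. \<forall>b. dist b a < \<rho> \<longrightarrow> dist (s b) (s a) < e" if e: "e > 0" for a e
  proof -
    \<comment> \<open>An a priori bound for the square roots of the eigenvalues at all poles close to \<open>a\<close>.\<close>
    define S where "S = s a + 1"
    have S: "S \<ge> 1" using s0 by (simp add: S_def)
    define M where "M = 1 + S + S\<^sup>2"
    have M: "M \<ge> 1" "S \<le> M" using S by (auto simp: M_def)
    define d where "d = min e 1 / (4 * M)"
    have d: "d > 0" using e M by (simp add: d_def)
    have "2 * d * M = min e 1 / 2" using M by (simp add: d_def)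
    moreover have "min e 1 > 0" using e by simp
    ultimately have dM: "2 * d * M < min e 1" by linarith
    have small: "d * t \<le> 1 / 2" if "t \<le> S" for t
    proof -
      have "d * t \<le> d * M" using that M d by (intro mult_left_mono) auto
      then show ?thesis using dM by linarith
    qed
    have le: "2 * d * (1 + t + t\<^sup>2) \<le> 2 * d * M" if "0 \<le> t" "t \<le> S" for t
      using that d unfolding M_def by (intro mult_left_mono add_mono power_mono) auto
    obtain \<rho> where \<rho>: "\<rho> > 0" "\<And>a b. norm (a - b) < \<rho> \<Longrightarrow> \<exists>g. transplants \<alpha> \<Omega> d g a b"
      using cutoff_transplants[OF op \<alpha> d] by blast
    have "dist (s b) (s a) < e" if "dist b a < \<rho>" for b
    proof -
      obtain g g' where g: "transplants \<alpha> \<Omega> d g a b" "transplants \<alpha> \<Omega> d g' b a"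
        using \<rho>(2)[of a b] \<rho>(2)[of b a] \<open>dist b a < \<rho>\<close> by (auto simp: dist_norm norm_minus_commute)
      have sa: "s a \<le> S" by (simp add: S_def)
      have b1: "s b < s a + min e 1"
        using step[OF g(1) _ small[OF sa]] le[OF s0 sa] d dM by linarith
      then have sb: "s b \<le> S" by (simp add: S_def)
      have "s a < s b + min e 1"
        using step[OF g(2) _ small[OF sb]] le[OF s0 sb] d dM by linarith
      then show ?thesis using b1 min.cobounded1[of e 1] unfolding dist_real_def abs_less_iff by linarith
    qed
    then show ?thesis using \<rho>(1) by blast
  qed
  then have "continuous_on UNIV s" unfolding continuous_on_iff by auto
  then have "continuous_on UNIV (\<lambda>a. (s a)\<^sup>2)" by (intro continuous_intros)
  then show ?thesis by (simp add: s2[symmetric])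
qed

section \<open>Gauge invariance for poles outside the domain\<close>

definition cplane :: "real^2 \<Rightarrow> complex" where
  "cplane x = Complex (x$1) (x$2)"

lemma bounded_linear_cplane: "bounded_linear cplane"
  unfolding linear_conv_bounded_linear[symmetric]
  by (rule linearI) (simp_all add: cplane_def complex_eq_iff)

lemma cplane_eq_iff [simp]: "cplane x = cplane y \<longleftrightarrow> x = y"
  by (auto simp: cplane_def vec_eq_iff forall_2)

text \<open>
  The potential with \<open>\<alpha> = 1\<close> is the gradient of the polar angle around \<open>b\<close>, the imaginary part of
  \<open>ln (z - b)\<close>.
\<close>

lemma Im_cplane_divide:
  "Im (cplane v / cplane (x - b)) = AB_potential 1 b x \<bullet> v"
proof -
  have n: "(norm (x - b))\<^sup>2 = (x$1 - b$1)\<^sup>2 + (x$2 - b$2)\<^sup>2"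
    by (simp add: norm_real2_power2)
  show ?thesis
    by (simp add: Im_divide cplane_def inner_vec_def sum_2 AB_potential_nth n add_divide_distrib diff_divide_distrib algebra_simps)
qed

text \<open>
  The quotient \<open>(z - b') / (z - b)\<close> has neither zeros nor poles on the simply connected set \<open>\<Omega>\<close>, so it has a
  continuous logarithm there. Near each point this is a translate of the principal branch, hence it is
  differentiable; its imaginary part is the difference of the two polar angles.
\<close>

lemma angle_function_exists:
  assumes op: "open \<Omega>" and sc: "simply_connected \<Omega>" and b: "b \<notin> \<Omega>" "b' \<notin> \<Omega>"
  obtains \<theta> :: "real^2 \<Rightarrow> real" where
    "\<And>x. x \<in> \<Omega> \<Longrightarrow> (\<theta> has_derivative (\<lambda>v. (AB_potential 1 b' x - AB_potential 1 b x) \<bullet> v)) (at x)"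
proof -
  define f where "f x = cplane (x - b') / cplane (x - b)" for x
  have ne: "cplane (x - b') \<noteq> 0" "cplane (x - b) \<noteq> 0" if "x \<in> \<Omega>" for x
    using that b cplane_eq_iff[of "x - b'" 0] cplane_eq_iff[of "x - b" 0]
    by (auto simp: linear_0[OF bounded_linear.linear[OF bounded_linear_cplane]])
  have dz: "((\<lambda>x. cplane (x - c)) has_derivative cplane) (at x)" for c x
    by (rule bounded_linear.has_derivative[OF bounded_linear_cplane, where g="\<lambda>x. x - c" and g'="\<lambda>v. v", simplified])
       (auto intro!: derivative_eq_intros)
  have df: "(f has_derivative (\<lambda>v. f x * (cplane v / cplane (x - b') - cplane v / cplane (x - b)))) (at x)" if "x \<in> \<Omega>" for x
    unfolding f_def[abs_def]
    by (rule has_derivative_eq_rhs[OF has_derivative_divide[OF dz dz ne(2)[OF that]]])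
      (use ne[OF that] in \<open>simp add: fun_eq_iff field_simps\<close>)
  have "continuous_on \<Omega> f"
    using df has_derivative_continuous continuous_at_imp_continuous_on by blast
  moreover have "locally path_connected \<Omega>"
    using op by (simp add: open_imp_locally_path_connected)
  ultimately obtain G where G: "continuous_on \<Omega> G" "\<And>x. x \<in> \<Omega> \<Longrightarrow> f x = exp (G x)"
    using continuous_logarithm_on_simply_connected[OF _ sc, of f] ne by (metis f_def divide_eq_0_iff)
  have dG: "(G has_derivative (\<lambda>v. cplane v / cplane (x - b') - cplane v / cplane (x - b))) (at x)" if x: "x \<in> \<Omega>" for x
  proof -
    have fx: "f x \<noteq> 0" using G(2)[OF x] by simp
    have "continuous (at x) G" using G(1) op x continuous_on_eq_continuous_at by blast
    then obtain e where e: "e > 0" "\<And>y. dist y x < e \<Longrightarrow> dist (G y) (G x) < pi"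
      unfolding continuous_at_eps_delta using pi_gt_zero by blast
    have loc: "G x + Ln (f y / f x) = G y" if y: "y \<in> \<Omega> \<inter> ball x e" for y
    proof -
      have "norm (G y - G x) < pi" using e(2)[of y] y by (simp add: dist_norm norm_minus_commute)
      then have "\<bar>Im (G y - G x)\<bar> < pi" using abs_Im_le_cmod[of "G y - G x"] by linarith
      then have "Ln (exp (G y - G x)) = G y - G x" by (intro Ln_exp) (auto simp: abs_less_iff)
      moreover have "exp (G y - G x) = f y / f x" using G(2) x y by (simp add: exp_diff)
      ultimately show ?thesis by simp
    qed
    have 1: "((\<lambda>y. f y / f x) has_derivative (\<lambda>v. cplane v / cplane (x - b') - cplane v / cplane (x - b))) (at x)"
      by (rule has_derivative_eq_rhs[OF bounded_linear.has_derivative[OF bounded_linear_divide df[OF x]]]) (use fx in auto)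
    have "(Ln has_field_derivative inverse (f x / f x)) (at (f x / f x))"
      using fx by (intro has_field_derivative_Ln) auto
    then have 2: "(Ln has_derivative (\<lambda>w. w)) (at (f x / f x))"
      unfolding has_field_derivative_def by (rule has_derivative_eq_rhs) (use fx in auto)
    have "((\<lambda>y. G x + Ln (f y / f x)) has_derivative (\<lambda>v. 0 + (cplane v / cplane (x - b') - cplane v / cplane (x - b)))) (at x)"
      by (rule has_derivative_add[OF has_derivative_const has_derivative_compose[OF 1 2]])
    then have "((\<lambda>y. G x + Ln (f y / f x)) has_derivative (\<lambda>v. cplane v / cplane (x - b') - cplane v / cplane (x - b))) (at x)"
      by simp
    then show ?thesis
      by (rule has_derivative_transform_within_open[of _ _ _ _ "\<Omega> \<inter> ball x e"]) (use op x e loc in auto)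
  qed
  show thesis
  proof (rule that[of "\<lambda>x. Im (G x)"])
    fix x assume x: "x \<in> \<Omega>"
    have "((\<lambda>x. Im (G x)) has_derivative (\<lambda>v. Im (cplane v / cplane (x - b') - cplane v / cplane (x - b)))) (at x)"
      by (rule bounded_linear.has_derivative[OF bounded_linear_Im dG[OF x]])
    then show "((\<lambda>x. Im (G x)) has_derivative (\<lambda>v. (AB_potential 1 b' x - AB_potential 1 b x) \<bullet> v)) (at x)"
      by (simp add: Im_cplane_divide inner_diff_left)
  qed
qed

lemma AB_potential_scale: "AB_potential \<alpha> a x = \<alpha> *\<^sub>R AB_potential 1 a x"
  by (simp add: AB_potential_def)

text \<open>
  For \<open>g = exp (i\<alpha>\<theta>)\<close> with \<open>\<theta>\<close> the difference of the polar angles, the error term in the product rule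
  vanishes identically.
\<close>

lemma gauge_transplants:
  assumes op: "open \<Omega>" and sc: "simply_connected \<Omega>" and b: "b \<notin> \<Omega>" "b' \<notin> \<Omega>"
  obtains g where "transplants \<alpha> \<Omega> 0 g b b'"
proof -
  obtain \<theta> :: "real^2 \<Rightarrow> real" where \<theta>:
    "\<And>x. x \<in> \<Omega> \<Longrightarrow> (\<theta> has_derivative (\<lambda>v. (AB_potential 1 b' x - AB_potential 1 b x) \<bullet> v)) (at x)"
    using angle_function_exists[OF op sc b] by blast
  have \<theta>s: "smooth_on \<Omega> \<theta>"
  proof -
    have A: "smooth_on \<Omega> (\<lambda>x. AB_potential 1 c x $ k)" if "c \<notin> \<Omega>" for c k
      using that by (intro smooth_on_subset[OF smooth_on_AB_potential]) auto
    have "smooth_on \<Omega> (\<lambda>x. (AB_potential 1 b' x - AB_potential 1 b x) \<bullet> v)" for v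
      unfolding inner_vec_def sum_2 inner_real_def vector_minus_component
      by (intro smooth_on_add smooth_on_mult smooth_on_diff smooth_on_const A b op)
    then have "Ck_on (Suc k) \<Omega> \<theta>" for k
      by (intro Ck_on_SucI[OF op \<theta>]) (auto simp: smooth_on_def)
    then show ?thesis unfolding smooth_on_def using Ck_on_Suc_D by blast
  qed
  define g where "g x = cis (\<alpha> * \<theta> x)" for x
  have gs: "smooth_on \<Omega> g" unfolding g_def[abs_def]
    by (rule smooth_on_compose_real[OF op open_UNIV _ _ smooth_on_cis])
      (auto intro: smooth_on_mult smooth_on_const op \<theta>s)
  have dg: "(g has_derivative (\<lambda>v. (\<alpha> * ((AB_potential 1 b' x - AB_potential 1 b x) \<bullet> v)) *\<^sub>R (\<i> * g x))) (at x)" if "x \<in> \<Omega>" for x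
    unfolding g_def by (rule has_derivative_cis[OF has_derivative_mult_right[OF \<theta>[OF that]]])
  have om: "\<Omega> - {b} = \<Omega>" "\<Omega> - {b'} = \<Omega>" using b by auto
  have "transplants \<alpha> \<Omega> 0 g b b'"
    unfolding transplants_def om
  proof (intro conjI ballI)
    show "continuous_on \<Omega> g" by (rule smooth_on_continuous[OF gs])
    show "norm (g x) \<le> 1" for x by (simp add: g_def)
    fix \<phi> assume \<phi>: "\<phi> \<in> test_functions \<Omega>"
    show "(\<lambda>x. g x * \<phi> x) \<in> test_functions \<Omega>" by (rule test_function_mult[OF \<phi> op gs]) simp
    have "norm (magnetic_gradient \<alpha> b' (\<lambda>x. g x * \<phi> x) x) = norm (magnetic_gradient \<alpha> b \<phi> x)" if x: "x \<in> \<Omega>" for x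
    proof (rule power2_eq_imp_eq)
      have "magnetic_gradient \<alpha> b' (\<lambda>x. g x * \<phi> x) x $ k = g x * magnetic_gradient \<alpha> b \<phi> x $ k" for k
        unfolding magnetic_gradient_mult[OF dg[OF x] test_function_has_derivative[OF \<phi>], where a=b]
        by (simp add: inner_axis AB_potential_scale[of \<alpha>] complex_scaleR_of_real_mult algebra_simps)
      then show "(norm (magnetic_gradient \<alpha> b' (\<lambda>x. g x * \<phi> x) x))\<^sup>2 = (norm (magnetic_gradient \<alpha> b \<phi> x))\<^sup>2"
        unfolding norm_complex2_power2 by (simp add: norm_mult g_def)
    qed auto
    then show "magnetic_norm \<alpha> \<Omega> b' (\<lambda>x. g x * \<phi> x) \<le> (1 + 0) * magnetic_norm \<alpha> \<Omega> b \<phi> + 0 * L2_norm \<Omega> \<phi>"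
      using L2_norm_cong[of \<Omega> "magnetic_gradient \<alpha> b' (\<lambda>x. g x * \<phi> x)" "magnetic_gradient \<alpha> b \<phi>"]
      by (simp add: magnetic_norm_def)
    show "L2_norm \<Omega> \<phi> \<le> L2_norm \<Omega> (\<lambda>x. g x * \<phi> x) + 0 * magnetic_norm \<alpha> \<Omega> b \<phi>"
      using L2_norm_cong[of \<Omega> \<phi> "\<lambda>x. g x * \<phi> x"] by (simp add: norm_mult g_def)
  qed
  then show thesis by (rule that)
qed

lemma AB_eigenvalue_constant_outside:
  assumes op: "open \<Omega>" and sc: "simply_connected \<Omega>" and b: "b \<notin> \<Omega>" "b' \<notin> \<Omega>" and j: "1 \<le> j"
    and ne: "\<And>a. H1_subspaces \<alpha> \<Omega> a j \<noteq> {}"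
  shows "AB_eigenvalue \<alpha> \<Omega> j b = AB_eigenvalue \<alpha> \<Omega> j b'"
proof -
  have "sqrt (AB_eigenvalue \<alpha> \<Omega> j c') \<le> sqrt (AB_eigenvalue \<alpha> \<Omega> j c)" if c: "c \<notin> \<Omega>" "c' \<notin> \<Omega>" for c c'
  proof -
    obtain g where "transplants \<alpha> \<Omega> 0 g c c'" using gauge_transplants[OF op sc c] by blast
    from AB_eigenvalue_transplant[OF this _ op j ne] show ?thesis by simp
  qed
  from this[OF b] this[OF b(2,1)] show ?thesis by simp
qed

section \<open>Trial spaces of every dimension and the extremal point\<close>

lemma test_function_H1:
  assumes "\<phi> \<in> test_functions (\<Omega> - {a})" "open \<Omega>"
  shows "\<phi> \<in> H1_magnetic \<alpha> \<Omega> a"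
proof -
  have "magnetic_norm \<alpha> \<Omega> a 0 = 0"
    using magnetic_norm_cscale[OF assms(1), of \<alpha> \<Omega> a 0] by (simp add: cscale_def zero_fun_def)
  then have "completion_sequence \<alpha> \<Omega> a (\<lambda>n. \<phi>) \<phi>"
    unfolding completion_sequence_def using assms(1) by (auto simp: L2_norm_def)
  moreover have "\<phi> \<in> L2_functions \<Omega>"
    using test_function_sq_integrable[OF assms] by (simp add: L2_functions_eq)
  ultimately show ?thesis unfolding H1_magnetic_def by blast
qed

lemma test_function_AE_zero:
  assumes "\<phi> \<in> test_functions (\<Omega> - {a})" "open \<Omega>" "AE x in lebesgue_on \<Omega>. \<phi> x = 0"
  shows "\<phi> = 0"
proof
  have c: "continuous_on UNIV \<phi>" using assms(1) unfolding test_functions_iff by (blast intro: smooth_on_continuous)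
  have "AE x in lebesgue. x \<in> \<Omega> \<longrightarrow> \<phi> x = 0"
    using assms(2,3) by (subst (asm) AE_restrict_space_iff) auto
  then have "negligible {x. \<not> (x \<in> \<Omega> \<longrightarrow> \<phi> x = 0)}"
    by (simp add: eventually_ae_filter_negligible) (metis (mono_tags, lifting) negligible_subset)
  moreover have "{x. \<not> (x \<in> \<Omega> \<longrightarrow> \<phi> x = 0)} = \<Omega> \<inter> \<phi> -` (- {0})" by auto
  moreover have "open (\<Omega> \<inter> \<phi> -` (- {0}))"
    using assms(2) by (intro open_Int open_vimage c) auto
  ultimately have "\<Omega> \<inter> \<phi> -` (- {0}) = {}" using open_not_negligible by metis
  then show "\<phi> x = 0 x" for x
    using assms(1) unfolding test_functions_iff by fastforce
qed

lemma sum_cscale_apply: "(\<Sum>v\<in>A. cscale (c v) v) x = (\<Sum>v\<in>A. c v * v x)"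
  by (induction A rule: infinite_finite_induct) (auto simp: cscale_def)

text \<open>
  Evaluate a vanishing linear combination at the point \<open>p i\<close>.
\<close>

lemma independent_if_peaks:
  fixes h :: "'i \<Rightarrow> 'a \<Rightarrow> complex"
  assumes "finite I" "\<And>i. i \<in> I \<Longrightarrow> h i (p i) \<noteq> 0" "\<And>i k. i \<in> I \<Longrightarrow> k \<in> I \<Longrightarrow> i \<noteq> k \<Longrightarrow> h i (p k) = 0"
  shows "\<not> cfun.dependent (h ` I)" and "card (h ` I) = card I"
proof -
  have inj: "inj_on h I"
    by (rule inj_onI) (metis assms(2,3))
  then show "card (h ` I) = card I" by (rule card_image)
  show "\<not> cfun.dependent (h ` I)"
  proof
    assume "cfun.dependent (h ` I)"
    then obtain u i where u: "i \<in> I" "u (h i) \<noteq> 0" "(\<Sum>v\<in>h ` I. cscale (u v) v) = 0"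
      using cfun.dependent_finite[of "h ` I"] assms(1) by auto
    have "0 = (\<Sum>v\<in>h ` I. cscale (u v) v) (p i)" by (simp add: u(3))
    also have "\<dots> = (\<Sum>k\<in>I. u (h k) * h k (p i))"
      unfolding sum_cscale_apply by (simp add: sum.reindex[OF inj])
    also have "\<dots> = (\<Sum>k\<in>I. if k = i then u (h i) * h i (p i) else 0)"
      by (rule sum.cong) (use assms(3) u(1) in auto)
    also have "\<dots> = u (h i) * h i (p i)" using assms(1) u(1) by simp
    finally show False using u(2) assms(2)[OF u(1)] by simp
  qed
qed

lemma bump_exists:
  fixes c :: "real^2"
  assumes "r > 0"
  obtains h :: "real^2 \<Rightarrow> complex" where "smooth_on UNIV h" "h c \<noteq> 0" "\<And>x. norm (x - c) \<ge> r \<Longrightarrow> h x = 0"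
proof
  define h where "h x = complex_of_real (flat 0 (r\<^sup>2 - (norm (x - c))\<^sup>2))" for x
  show "smooth_on UNIV h" unfolding h_def[abs_def]
    by (intro smooth_on_linear_compose[OF bounded_linear_of_real] open_UNIV
        smooth_on_compose_real[OF open_UNIV open_UNIV _ _ smooth_on_flat] smooth_on_diff smooth_on_const smooth_on_norm_power2) auto
  show "h c \<noteq> 0" using assms by (simp add: h_def flat_def)
  fix x assume "norm (x - c) \<ge> r"
  then have "r\<^sup>2 \<le> (norm (x - c))\<^sup>2" using assms by (intro power_mono) auto
  then show "h x = 0" by (simp add: h_def flat_def)
qed

text \<open>
  Bump functions on disjoint discs that are lined up inside \<open>\<Omega>\<close> and avoid the pole.
\<close>

lemma H1_subspaces_nonempty:
  assumes op: "open \<Omega>" and "\<Omega> \<noteq> {}"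
  shows "H1_subspaces \<alpha> \<Omega> a j \<noteq> {}"
proof -
  have "\<not> \<Omega> \<subseteq> {a}"
    using assms by (metis finite.emptyI finite.insertI finite_imp_not_open finite_subset)
  then obtain c0 where "c0 \<in> \<Omega> - {a}" by blast
  moreover have "open (\<Omega> - {a})" using op by auto
  ultimately obtain R where R: "R > 0" "ball c0 R \<subseteq> \<Omega> - {a}"
    using open_contains_ball by blast
  \<comment> \<open>Consecutive centres have distance \<open>2 * r\<close>, and the discs stay within \<open>3 * R / 4\<close> of \<open>c0\<close>.
    Using \<open>j + 1\<close> avoids division by zero.\<close>
  define c where "c k = c0 + (R * (real k / (2 * real (j + 1)))) *\<^sub>R (axis 1 1 :: real^2)" for k
  define r where "r = R / (4 * real (j + 1))"
  have r: "r > 0" using R by (simp add: r_def)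
  have "\<exists>h :: real^2 \<Rightarrow> complex. smooth_on UNIV h \<and> h (c k) \<noteq> 0 \<and> (\<forall>x. norm (x - c k) \<ge> r \<longrightarrow> h x = 0)" for k
    using bump_exists[OF r, of "c k"] by metis
  then obtain h :: "nat \<Rightarrow> real^2 \<Rightarrow> complex" where h: "\<And>k. smooth_on UNIV (h k)" "\<And>k. h k (c k) \<noteq> 0"
    "\<And>k x. norm (x - c k) \<ge> r \<Longrightarrow> h k x = 0" by metis
  have far: "h i (c k) = 0" if "i \<noteq> k" for i k
  proof (rule h(3))
    have "c k - c i = (R * ((real k - real i) / (2 * real (j + 1)))) *\<^sub>R (axis 1 1 :: real^2)"
      by (simp add: c_def scaleR_diff_left[symmetric] diff_divide_distrib right_diff_distrib)
    then have "norm (c k - c i) = R * (\<bar>real k - real i\<bar> / (2 * real (j + 1)))"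
      using R(1) by (simp add: abs_mult)
    moreover have "\<bar>real k - real i\<bar> \<ge> 1" using that by linarith
    then have "R * (1 / (2 * real (j + 1))) \<le> R * (\<bar>real k - real i\<bar> / (2 * real (j + 1)))"
      using R(1) by (intro mult_left_mono divide_right_mono) auto
    moreover have "r \<le> R * (1 / (2 * real (j + 1)))" using R(1) by (simp add: r_def field_simps)
    ultimately show "r \<le> norm (c k - c i)" by linarith
  qed
  have test: "h k \<in> test_functions (\<Omega> - {a})" if "k < j" for k
    unfolding test_functions_iff
  proof (intro conjI exI)
    show "smooth_on UNIV (h k)" by (rule h)
    show "compact (cball (c k) r)" by simp
    have "norm (c k - c0) = R * (real k / (2 * real (j + 1)))" using R(1) by (simp add: c_def)
    also have "\<dots> \<le> R * (1 / 2)" using that R(1) by (intro mult_left_mono) (auto simp: field_simps)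
    finally have "norm (c k - c0) \<le> R / 2" by simp
    moreover have "r \<le> R / 4" using R(1) by (simp add: r_def field_simps)
    ultimately have "cball (c k) r \<subseteq> ball c0 R"
    proof (intro subsetI)
      fix x assume l: "norm (c k - c0) \<le> R / 2" "r \<le> R / 4" and "x \<in> cball (c k) r"
      then have "norm (x - c k) \<le> R / 4" by (simp add: dist_norm norm_minus_commute)
      then show "x \<in> ball c0 R" using l(1) R(1) norm_triangle_ineq[of "x - c k" "c k - c0"]
        by (simp add: dist_norm norm_minus_commute)
    qed
    then show "cball (c k) r \<subseteq> \<Omega> - {a}" using R(2) by blast
    show "\<forall>x. x \<notin> cball (c k) r \<longrightarrow> h k x = 0"
      using h(3) by (auto simp: dist_norm norm_minus_commute)
  qed
  have sub: "cfun.subspace (test_functions (\<Omega> - {a}))"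
    unfolding cfun.subspace_def using test_function_0 test_function_add test_function_cscale by blast
  define W where "W = cfun.span (h ` {..<j})"
  have W: "W \<subseteq> test_functions (\<Omega> - {a})"
    unfolding W_def by (rule cfun.span_minimal[OF _ sub]) (use test in auto)
  note ind = independent_if_peaks[of "{..<j}" h c, OF finite_lessThan h(2) far]
  have "cfun.dim W = j" unfolding W_def using cfun.dim_span_eq_card_independent[OF ind(1)] ind(2) by simp
  then have "W \<in> H1_subspaces \<alpha> \<Omega> a j"
    unfolding H1_subspaces_def
    using W test_function_H1[OF _ op] test_function_AE_zero[OF _ op] cfun.subspace_span[of "h ` {..<j}"]
    by (auto simp: W_def)
  then show ?thesis by blast
qed

theorem corollary1p2:
  fixes \<Omega> :: "(real^2) set" and \<alpha> :: real and j :: nat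
  assumes "open \<Omega>" and "simply_connected \<Omega>" and "bounded \<Omega>" and "\<Omega> \<noteq> {}"
    and "0 < \<alpha>" and "\<alpha> < 1" and "1 \<le> j"
  shows "\<exists>a\<in>\<Omega>. extremal_point (AB_eigenvalue \<alpha> \<Omega> j) \<Omega> a"
proof -
  let ?f = "AB_eigenvalue \<alpha> \<Omega> j"
  have ne: "H1_subspaces \<alpha> \<Omega> a j \<noteq> {}" for a
    by (rule H1_subspaces_nonempty[OF assms(1,4)])
  have "compact (closure \<Omega>)" using assms(3) by simp
  moreover have "closure \<Omega> \<noteq> {}" using assms(4) by simp
  moreover have "continuous_on (closure \<Omega>) ?f"
    by (rule continuous_on_subset[OF continuous_AB_eigenvalue[OF assms(1,5,6,7) ne]]) simp
  ultimately obtain p q where p: "p \<in> closure \<Omega>" "\<And>b. b \<in> closure \<Omega> \<Longrightarrow> ?f b \<le> ?f p"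
    and q: "q \<in> closure \<Omega>" "\<And>b. b \<in> closure \<Omega> \<Longrightarrow> ?f q \<le> ?f b"
    using continuous_attains_sup[of "closure \<Omega>" ?f] continuous_attains_inf[of "closure \<Omega>" ?f] by blast
  have below_p: "\<forall>\<^sub>F b in at a within \<Omega>. ?f b \<le> ?f p" and above_q: "\<forall>\<^sub>F b in at a within \<Omega>. ?f q \<le> ?f b" for a
    unfolding eventually_at_filter
    by (rule always_eventually, use p(2) q(2) closure_subset in blast)+
  consider "p \<in> \<Omega>" | "q \<in> \<Omega>" | "p \<notin> \<Omega>" "q \<notin> \<Omega>" by blast
  then show ?thesis
  proof cases
    case 1
    then have "extremal_point ?f \<Omega> p"
      unfolding extremal_point_def using below_p[of p] by blast
    then show ?thesis using 1 by blast
  next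
    case 2
    then have "extremal_point ?f \<Omega> q"
      unfolding extremal_point_def using above_q[of q] by blast
    then show ?thesis using 2 by blast
  next
    case 3
    have "?f p = ?f q"
      by (rule AB_eigenvalue_constant_outside[OF assms(1,2) 3 assms(7) ne])
    then have const: "?f b = ?f p" if "b \<in> closure \<Omega>" for b
      using p(2)[OF that] q(2)[OF that] by simp
    obtain a where a: "a \<in> \<Omega>" using assms(4) by blast
    then have fa: "?f a = ?f p" using const closure_subset by blast
    have "extremal_point ?f \<Omega> a"
      unfolding extremal_point_def using a below_p[of a] fa by auto
    then show ?thesis using a by blast
  qed
qed

end
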